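(* Let $n\in\omega$ with $n\geq 2$. The following are equivalent over $\mathbf{ECST}$: (1) $\mathrm{NID}_{<\omega}$: for each set $S$ and each set $R$ of finitary rules on $S$, the class of $R$-closed subsets of $S$ is set-generated; (2) $\mathrm{NID}_{n}$: for each set $S$ and each set $R$ of $n$-ary rules on $S$, the class of $R$-closed subsets of $S$ is set-generated.
   Context: Base theory. $\mathbf{ECST}$ (elementary constructive set theory) is the theory in intuitionistic first-order logic with equality and $\in$ whose axioms are Extensionality, Pairing, Union, Restricted Separation (separation for formulas all of whose quantifiers are bounded), Replacement (for arbitrary formulas, with $\exists!$ in the hypothesis), and Strong Infinity (existence of the least set $\omega$ containing $\emptyset$ and closed under $x\mapsto x\cup\{x\}$). There is no power set axiom; $\mathrm{Pow}(S)$ denotes the class of subsets of $S$. A set $A$ is finitely enumerable if there is a surjection $\{0,\dots,n-1\}\to A$ for some $n\in\omega$. Rules. A rule on a set $S$ is a pair $(a,b)$ of subsets of $S$; it is finitary if $a$ is finitely enumerable, and $n$-ary if there is a surjection $\{0,\dots,n-1\}\to a$. Write $b\between\alpha$ to mean that $b\cap\alpha$ is inhabited. A subset $\alpha\subseteq S$ is closed under $(a,b)$ if $a\subseteq\alpha$ implies $b\between\alpha$; it is $R$-closed if closed under every rule in the set $R$ of rules. Set-generation. A subclass $\mathcal{C}$ of $\mathrm{Pow}(S)$ is set-generated if there is a set $G\subseteq\mathcal{C}$ such that $\forall\alpha\in\mathcal{C}\,\forall x\in\alpha\,\exists\beta\in G\,(x\in\beta\subseteq\alpha)$. *)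

theory Defs
  imports Main
begin

(* First-order formulas over equality and membership, in de Bruijn form. The only terms are
   variables, so a term is an index: index i refers to the i-th enclosing quantifier (0 is the
   innermost), and indices beyond the enclosing quantifiers are free variables. *)

datatype fm =
    Mem nat nat  (infix "\<^bold>\<in>" 60)
  | Eq nat nat  (infix "\<^bold>=" 60)
  | Falsum  ("\<^bold>\<bottom>")
  | Conj fm fm  (infixr "\<^bold>\<and>" 58)
  | Disj fm fm  (infixr "\<^bold>\<or>" 56)
  | Impl fm fm  (infixr "\<^bold>\<longrightarrow>" 54)
  | Forall fm
  | Exists fm

abbreviation Iff :: "fm \<Rightarrow> fm \<Rightarrow> fm"  (infix "\<^bold>\<longleftrightarrow>" 52) where
  "\<phi> \<^bold>\<longleftrightarrow> \<psi> \<equiv> (\<phi> \<^bold>\<longrightarrow> \<psi>) \<^bold>\<and> (\<psi> \<^bold>\<longrightarrow> \<phi>)"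

(* Bounded quantifiers: the bound x is an index outside the scope of the new quantifier. *)

abbreviation BForall :: "nat \<Rightarrow> fm \<Rightarrow> fm" where
  "BForall x \<phi> \<equiv> Forall (0 \<^bold>\<in> Suc x \<^bold>\<longrightarrow> \<phi>)"

abbreviation BExists :: "nat \<Rightarrow> fm \<Rightarrow> fm" where
  "BExists x \<phi> \<equiv> Exists (0 \<^bold>\<in> Suc x \<^bold>\<and> \<phi>)"

definition lift :: "(nat \<Rightarrow> nat) \<Rightarrow> nat \<Rightarrow> nat" where
  "lift f = case_nat 0 (\<lambda>i. Suc (f i))"

primrec rename :: "(nat \<Rightarrow> nat) \<Rightarrow> fm \<Rightarrow> fm" where
  "rename f (x \<^bold>\<in> y) = f x \<^bold>\<in> f y"
| "rename f (x \<^bold>= y) = f x \<^bold>= f y"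
| "rename f \<^bold>\<bottom> = \<^bold>\<bottom>"
| "rename f (\<phi> \<^bold>\<and> \<psi>) = rename f \<phi> \<^bold>\<and> rename f \<psi>"
| "rename f (\<phi> \<^bold>\<or> \<psi>) = rename f \<phi> \<^bold>\<or> rename f \<psi>"
| "rename f (\<phi> \<^bold>\<longrightarrow> \<psi>) = rename f \<phi> \<^bold>\<longrightarrow> rename f \<psi>"
| "rename f (Forall \<phi>) = Forall (rename (lift f) \<phi>)"
| "rename f (Exists \<phi>) = Exists (rename (lift f) \<phi>)"

(* Substitution of the variable t for index 0; the remaining indices move down by one. *)
definition inst :: "fm \<Rightarrow> nat \<Rightarrow> fm" where
  "inst \<phi> t = rename (case_nat t (\<lambda>i. i)) \<phi>"

(* "rename (lift Suc) \<phi>" keeps index 0 and weakens \<phi> by one variable placed just above it. *)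
definition Exists1 :: "fm \<Rightarrow> fm" where
  "Exists1 \<phi> = Exists (\<phi> \<^bold>\<and> Forall (rename (lift Suc) \<phi> \<^bold>\<longrightarrow> 0 \<^bold>= 1))"

(* Intuitionistic natural deduction with equality. T is the set of non-logical axioms and
   G the set of open assumptions. Axioms, unlike assumptions, are available unchanged below
   quantifier introductions, so an axiom with free variables has the force of its universal
   closure. *)
inductive derives :: "fm set \<Rightarrow> fm set \<Rightarrow> fm \<Rightarrow> bool" for T :: "fm set" where
  axiom: "\<phi> \<in> T \<Longrightarrow> derives T G \<phi>"
| assm: "\<phi> \<in> G \<Longrightarrow> derives T G \<phi>"
| falsumE: "derives T G \<^bold>\<bottom> \<Longrightarrow> derives T G \<phi>"
| conjI: "derives T G \<phi> \<Longrightarrow> derives T G \<psi> \<Longrightarrow> derives T G (\<phi> \<^bold>\<and> \<psi>)"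
| conjE1: "derives T G (\<phi> \<^bold>\<and> \<psi>) \<Longrightarrow> derives T G \<phi>"
| conjE2: "derives T G (\<phi> \<^bold>\<and> \<psi>) \<Longrightarrow> derives T G \<psi>"
| disjI1: "derives T G \<phi> \<Longrightarrow> derives T G (\<phi> \<^bold>\<or> \<psi>)"
| disjI2: "derives T G \<psi> \<Longrightarrow> derives T G (\<phi> \<^bold>\<or> \<psi>)"
| disjE: "derives T G (\<phi> \<^bold>\<or> \<psi>) \<Longrightarrow> derives T (insert \<phi> G) \<chi> \<Longrightarrow> derives T (insert \<psi> G) \<chi>
    \<Longrightarrow> derives T G \<chi>"
| implI: "derives T (insert \<phi> G) \<psi> \<Longrightarrow> derives T G (\<phi> \<^bold>\<longrightarrow> \<psi>)"
| implE: "derives T G (\<phi> \<^bold>\<longrightarrow> \<psi>) \<Longrightarrow> derives T G \<phi> \<Longrightarrow> derives T G \<psi>"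
| forallI: "derives T (rename Suc ` G) \<phi> \<Longrightarrow> derives T G (Forall \<phi>)"
| forallE: "derives T G (Forall \<phi>) \<Longrightarrow> derives T G (inst \<phi> t)"
| existsI: "derives T G (inst \<phi> t) \<Longrightarrow> derives T G (Exists \<phi>)"
| existsE: "derives T G (Exists \<phi>) \<Longrightarrow> derives T (insert \<phi> (rename Suc ` G)) (rename Suc \<psi>)
    \<Longrightarrow> derives T G \<psi>"
| eqI: "derives T G (x \<^bold>= x)"
| eqE: "derives T G (x \<^bold>= y) \<Longrightarrow> derives T G (inst \<phi> x) \<Longrightarrow> derives T G (inst \<phi> y)"

abbreviation proves :: "fm set \<Rightarrow> fm \<Rightarrow> bool"  (infix "\<turnstile>" 50) where
  "T \<turnstile> \<phi> \<equiv> derives T {} \<phi>"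

inductive restricted :: "fm \<Rightarrow> bool" where
  "restricted (x \<^bold>\<in> y)"
| "restricted (x \<^bold>= y)"
| "restricted \<^bold>\<bottom>"
| "restricted \<phi> \<Longrightarrow> restricted \<psi> \<Longrightarrow> restricted (\<phi> \<^bold>\<and> \<psi>)"
| "restricted \<phi> \<Longrightarrow> restricted \<psi> \<Longrightarrow> restricted (\<phi> \<^bold>\<or> \<psi>)"
| "restricted \<phi> \<Longrightarrow> restricted \<psi> \<Longrightarrow> restricted (\<phi> \<^bold>\<longrightarrow> \<psi>)"
| "restricted \<phi> \<Longrightarrow> restricted (BForall x \<phi>)"
| "restricted \<phi> \<Longrightarrow> restricted (BExists x \<phi>)"

(* The arguments of the following formulas are indices of variables in the current scope. *)

definition is_subset :: "nat \<Rightarrow> nat \<Rightarrow> fm" where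
  "is_subset x y = BForall x (0 \<^bold>\<in> Suc y)"

definition is_empty :: "nat \<Rightarrow> fm" where
  "is_empty x = BForall x \<^bold>\<bottom>"

(* y = x \<union> {x} *)
definition is_succ :: "nat \<Rightarrow> nat \<Rightarrow> fm" where
  "is_succ y x = is_subset x y \<^bold>\<and> x \<^bold>\<in> y \<^bold>\<and> BForall y (0 \<^bold>\<in> Suc x \<^bold>\<or> 0 \<^bold>= Suc x)"

definition is_inductive :: "nat \<Rightarrow> fm" where
  "is_inductive w = BExists w (is_empty 0) \<^bold>\<and> BForall w (BExists (Suc w) (is_succ 0 1))"

definition is_omega :: "nat \<Rightarrow> fm" where
  "is_omega w = is_inductive w \<^bold>\<and> Forall (is_inductive 0 \<^bold>\<longrightarrow> is_subset (Suc w) 0)"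

(* In separation, index 0 of \<phi> is the element and index 1 the given set; in replacement, index 0
   of \<phi> is the value, index 1 the argument and index 2 the given set. All further indices are
   parameters. The renamings make \<phi> independent of the set being asserted to exist. *)
inductive_set ECST :: "fm set" where
  extensionality:
    "Forall (Forall (Forall (0 \<^bold>\<in> 2 \<^bold>\<longleftrightarrow> 0 \<^bold>\<in> 1) \<^bold>\<longrightarrow> 1 \<^bold>= 0)) \<in> ECST"
| pairing:
    "Forall (Forall (Exists (Forall (0 \<^bold>\<in> 1 \<^bold>\<longleftrightarrow> 0 \<^bold>= 3 \<^bold>\<or> 0 \<^bold>= 2)))) \<in> ECST"
| union:
    "Forall (Exists (Forall (0 \<^bold>\<in> 1 \<^bold>\<longleftrightarrow> BExists 2 (1 \<^bold>\<in> 0)))) \<in> ECST"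
| restricted_separation:
    "restricted \<phi> \<Longrightarrow>
      Forall (Exists (Forall (0 \<^bold>\<in> 1 \<^bold>\<longleftrightarrow> 0 \<^bold>\<in> 2 \<^bold>\<and> rename (lift Suc) \<phi>))) \<in> ECST"
| replacement:
    "Forall (BForall 0 (Exists1 \<phi>) \<^bold>\<longrightarrow>
      Exists (Forall (0 \<^bold>\<in> 1 \<^bold>\<longleftrightarrow>
        BExists 2 (rename (case_nat 1 (case_nat 0 (\<lambda>i. i + 3))) \<phi>)))) \<in> ECST"
| strong_infinity:
    "Exists (is_omega 0) \<in> ECST"

(* z = {x, y} *)
definition is_upair :: "nat \<Rightarrow> nat \<Rightarrow> nat \<Rightarrow> fm" where
  "is_upair z x y = x \<^bold>\<in> z \<^bold>\<and> y \<^bold>\<in> z \<^bold>\<and> BForall z (0 \<^bold>= Suc x \<^bold>\<or> 0 \<^bold>= Suc y)"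

(* p is the Kuratowski pair {{x}, {x, y}} *)
definition is_pair :: "nat \<Rightarrow> nat \<Rightarrow> nat \<Rightarrow> fm" where
  "is_pair p x y = BExists p (BExists (p + 1)
    (is_upair 1 (x + 2) (x + 2) \<^bold>\<and> is_upair 0 (x + 2) (y + 2) \<^bold>\<and> is_upair (p + 2) 1 0))"

(* (x, y) \<in> f *)
definition maps_to :: "nat \<Rightarrow> nat \<Rightarrow> nat \<Rightarrow> fm" where
  "maps_to f x y = BExists f (is_pair 0 (Suc x) (Suc y))"

definition is_function :: "nat \<Rightarrow> nat \<Rightarrow> nat \<Rightarrow> fm" where
  "is_function f A B =
    BForall f (BExists (A + 1) (BExists (B + 2) (is_pair 2 1 0))) \<^bold>\<and>
    BForall A (BExists (B + 1)
      (maps_to (f + 2) 1 0 \<^bold>\<and> BForall (B + 2) (maps_to (f + 3) 2 0 \<^bold>\<longrightarrow> 0 \<^bold>= 1)))"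

definition is_surjection :: "nat \<Rightarrow> nat \<Rightarrow> nat \<Rightarrow> fm" where
  "is_surjection f A B =
    is_function f A B \<^bold>\<and> BForall B (BExists (A + 1) (maps_to (f + 2) 0 1))"

(* For n in omega the set {0, ..., n-1} is n itself. *)
definition enumerated_by :: "nat \<Rightarrow> nat \<Rightarrow> fm" where
  "enumerated_by n a = Exists (is_surjection 0 (n + 1) (a + 1))"

definition finitely_enumerable :: "nat \<Rightarrow> fm" where
  "finitely_enumerable a = Exists (is_omega 0 \<^bold>\<and> BExists 0 (enumerated_by 0 (a + 2)))"

(* r is the rule (a, b) on S *)
definition is_rule :: "nat \<Rightarrow> nat \<Rightarrow> nat \<Rightarrow> nat \<Rightarrow> fm" where
  "is_rule r a b S = is_pair r a b \<^bold>\<and> is_subset a S \<^bold>\<and> is_subset b S"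

definition finitary_rules :: "nat \<Rightarrow> nat \<Rightarrow> fm" where
  "finitary_rules R S =
    BForall R (Exists (Exists (is_rule 2 1 0 (S + 3) \<^bold>\<and> finitely_enumerable 1)))"

definition nary_rules :: "nat \<Rightarrow> nat \<Rightarrow> nat \<Rightarrow> fm" where
  "nary_rules n R S =
    BForall R (Exists (Exists (is_rule 2 1 0 (S + 3) \<^bold>\<and> enumerated_by (n + 3) 1)))"

(* b \<inter> \<alpha> is inhabited *)
definition meets :: "nat \<Rightarrow> nat \<Rightarrow> fm" where
  "meets b \<alpha> = BExists b (0 \<^bold>\<in> Suc \<alpha>)"

definition is_closed :: "nat \<Rightarrow> nat \<Rightarrow> fm" where
  "is_closed \<alpha> R =
    BForall R (Forall (Forall (is_pair 2 1 0 \<^bold>\<longrightarrow> is_subset 1 (\<alpha> + 3) \<^bold>\<longrightarrow> meets 0 (\<alpha> + 3))))"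

definition is_closed_subset :: "nat \<Rightarrow> nat \<Rightarrow> nat \<Rightarrow> fm" where
  "is_closed_subset \<alpha> S R = is_subset \<alpha> S \<^bold>\<and> is_closed \<alpha> R"

(* C represents the class of all \<alpha> satisfying C, where \<alpha> is index 0 of C. *)
definition set_generated :: "fm \<Rightarrow> fm" where
  "set_generated C = Exists (
    BForall 0 (rename (lift Suc) C) \<^bold>\<and>
    Forall (rename (lift Suc) C \<^bold>\<longrightarrow>
      BForall 0 (BExists 2 (1 \<^bold>\<in> 0 \<^bold>\<and> is_subset 0 2))))"

(* In both principles S is the outer and R the inner quantified variable. *)

definition NID_fin :: fm where
  "NID_fin = Forall (Forall
    (finitary_rules 0 1 \<^bold>\<longrightarrow> set_generated (is_closed_subset 0 2 1)))"

definition NID :: "nat \<Rightarrow> fm" where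
  "NID n = Forall (Forall
    (nary_rules (n + 2) 0 1 \<^bold>\<longrightarrow> set_generated (is_closed_subset 0 2 1)))"

definition in_omega :: "nat \<Rightarrow> fm" where
  "in_omega n = Exists (is_omega 0 \<^bold>\<and> n + 1 \<^bold>\<in> 0)"

definition is_two :: "nat \<Rightarrow> fm" where
  "is_two t = Exists (Exists (is_empty 1 \<^bold>\<and> is_succ 0 1 \<^bold>\<and> is_succ (t + 2) 0))"

(* The order on omega is the one given by membership. *)
definition at_least_two :: "nat \<Rightarrow> fm" where
  "at_least_two n = Exists (is_two 0 \<^bold>\<and> (0 \<^bold>\<in> n + 1 \<^bold>\<or> 0 \<^bold>= n + 1))"

end

(* The calculus is complete for Kripke models, because a canonical model can be built from
   prime theories with Henkin witnesses, so that the theorem may be shown by working inside an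
   arbitrary Kripke model of ECST.

   There NID_n, for n >= 2, yields NID for finitary rules on S in two steps. First, consider the
   relations g from omega to S whose domain is downward closed. These are the subsets of
   omega x S closed under the singleton-premise rules ({(j, x)}, {k} x S) for k in j. A generating
   set of this class contains every finite sequence g, since a member h with (m, g(m)) in h and
   h contained in g, where m is the last index, has the same domain as g. The images of its members
   thus give a set F of subsets of S containing all the finitely enumerable ones (if S is
   inhabited). Secondly, put on F the rules ({u, v}, {t}) for t contained in the union of u and v,
   and ({a}, {{s} | s in b}) for every given rule (a, b) with a in F. If beta is closed under
   these, so is { s | {s} in beta } under the given rules, provided it is inhabited: the elements
   of a premise a are collected one by one, so that a itself is in beta. Conversely, a set alpha
   closed under the given rules is represented by the set of all u in F that are contained in
   alpha. All these rules have at most two premises, and a set {x, y} is enumerated by any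
   n >= 2, because being zero is decidable on omega. *)

theory Submission
  imports Defs "HOL-Library.Countable" "HOL-Library.Infinite_Set"
begin

section \<open>Syntactic properties of the calculus\<close>

text \<open>In ECST \<open>om_induct\<close> reaches restricted formulas only, so the finite
  sequences in S are not collected into a set by recursion on their length. This is why NID_n is
  used twice, the first time just to supply them. The rules of that first use say nothing about
  single-valuedness, so the generating set may contain relations that are not functions, and F the
  images of these. They do no harm, since only the singletons in a closed set of members of F are
  read off at the end. The demand that the trace be inhabited comes from rules with empty premise.
  For n >= 2 a set enumerated by n is inhabited, hence the empty set is closed under every set of
  n-ary rules, whereas a finitary rule (0, b) excludes it. Any u in beta puts the empty set into
  beta, by the rule ({u, u}, {0}); and set-generation speaks about a given member s of alpha, so {s}
  is available as such a u. As it is undecided whether S is inhabited, the fact that puts the empty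
  set into F takes an element of S as hypothesis.\<close>

primrec fv :: "fm \<Rightarrow> nat set" where
  "fv (x \<^bold>\<in> y) = {x, y}"
| "fv (x \<^bold>= y) = {x, y}"
| "fv \<^bold>\<bottom> = {}"
| "fv (\<phi> \<^bold>\<and> \<psi>) = fv \<phi> \<union> fv \<psi>"
| "fv (\<phi> \<^bold>\<or> \<psi>) = fv \<phi> \<union> fv \<psi>"
| "fv (\<phi> \<^bold>\<longrightarrow> \<psi>) = fv \<phi> \<union> fv \<psi>"
| "fv (Forall \<phi>) = Suc -` fv \<phi>"
| "fv (Exists \<phi>) = Suc -` fv \<phi>"

lemma finite_fv: "finite (fv \<phi>)"
  by (induction \<phi>) (auto intro: finite_vimageI)

lemma lift_simps [simp]: "lift f 0 = 0" "lift f (Suc i) = Suc (f i)"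
  by (simp_all add: lift_def)

lemma lift_comp: "lift f \<circ> lift g = lift (f \<circ> g)"
  by (auto simp: fun_eq_iff lift_def split: nat.split)

lemma lift_id: "lift (\<lambda>i. i) = (\<lambda>i. i)"
  by (auto simp: fun_eq_iff lift_def split: nat.split)

lemma case_nat_comp_lift: "case_nat t g \<circ> lift f = case_nat t (g \<circ> f)"
  by (auto simp: fun_eq_iff split: nat.split)

lemma rename_cong: "(\<And>i. i \<in> fv \<phi> \<Longrightarrow> f i = g i) \<Longrightarrow> rename f \<phi> = rename g \<phi>"
proof (induction \<phi> arbitrary: f g)
  case (Forall \<phi>)
  have "lift f i = lift g i" if "i \<in> fv \<phi>" for i
    using Forall.prems that by (cases i) auto
  then show ?case using Forall.IH[of "lift f" "lift g"] by simp
next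
  case (Exists \<phi>)
  have "lift f i = lift g i" if "i \<in> fv \<phi>" for i
    using Exists.prems that by (cases i) auto
  then show ?case using Exists.IH[of "lift f" "lift g"] by simp
qed fastforce+

lemma rename_rename: "rename f (rename g \<phi>) = rename (f \<circ> g) \<phi>"
  by (induction \<phi> arbitrary: f g) (simp_all add: lift_comp)

lemma rename_ident: "rename (\<lambda>i. i) \<phi> = \<phi>"
  by (induction \<phi>) (simp_all add: lift_id)

lemma vimage_Suc_lift_image: "Suc -` (lift f ` A) = f ` (Suc -` A)"
proof (intro set_eqI iffI)
  fix i assume "i \<in> Suc -` (lift f ` A)"
  then obtain j where "j \<in> A" "Suc i = lift f j" by auto
  then show "i \<in> f ` (Suc -` A)" by (cases j) auto
next
  fix i assume "i \<in> f ` (Suc -` A)"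
  then obtain j where "Suc j \<in> A" "i = f j" by auto
  then have "Suc i = lift f (Suc j)" by simp
  with \<open>Suc j \<in> A\<close> show "i \<in> Suc -` (lift f ` A)" by blast
qed

lemma fv_rename: "fv (rename f \<phi>) = f ` fv \<phi>"
  by (induction \<phi> arbitrary: f) (simp_all add: vimage_Suc_lift_image image_Un)

lemma fv_inst: "fv (inst \<phi> t) \<subseteq> insert t (Suc -` fv \<phi>)"
  unfolding inst_def fv_rename by (auto split: nat.splits)

lemma rename_inst: "rename f (inst \<phi> t) = inst (rename (lift f) \<phi>) (f t)"
proof -
  have "f \<circ> case_nat t (\<lambda>i. i) = case_nat (f t) (\<lambda>i. i) \<circ> lift f"
    by (auto simp: fun_eq_iff split: nat.split)
  then show ?thesis by (simp add: inst_def rename_rename)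
qed

lemma rename_Suc: "rename (lift f) (rename Suc \<phi>) = rename Suc (rename f \<phi>)"
proof -
  have "lift f \<circ> Suc = Suc \<circ> f" by (simp add: fun_eq_iff)
  then show ?thesis by (simp add: rename_rename)
qed

text \<open>Matches the Henkin instances in a theory with the extended environments in the forcing
  clauses for quantifiers; \<open>truth\<close> and \<open>world_subst\<close> depend on it.\<close>

lemma inst_rename: "inst (rename (lift f) \<phi>) t = rename (case_nat t f) \<phi>"
  by (simp add: inst_def rename_rename case_nat_comp_lift) (simp add: o_def)

section \<open>Structural properties of derivations\<close>

lemma derives_mono: "derives T G \<phi> \<Longrightarrow> G \<subseteq> G' \<Longrightarrow> derives T G' \<phi>"
proof (induction arbitrary: G' rule: derives.induct)
  case (axiom \<phi> G)
  show ?case using axiom.hyps by (rule derives.axiom)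
next
  case (assm \<phi> G)
  then show ?case by (blast intro: derives.assm)
next
  case (falsumE G \<phi>)
  show ?case by (rule derives.falsumE, rule falsumE.IH, rule falsumE.prems)
next
  case (conjI G \<phi> \<psi>)
  then show ?case by (simp add: derives.conjI)
next
  case (conjE1 G \<phi> \<psi>)
  show ?case by (rule derives.conjE1, rule conjE1.IH, rule conjE1.prems)
next
  case (conjE2 G \<phi> \<psi>)
  show ?case by (rule derives.conjE2, rule conjE2.IH, rule conjE2.prems)
next
  case (disjI1 G \<phi> \<psi>)
  show ?case by (rule derives.disjI1, rule disjI1.IH, rule disjI1.prems)
next
  case (disjI2 G \<psi> \<phi>)
  show ?case by (rule derives.disjI2, rule disjI2.IH, rule disjI2.prems)
next
  case (disjE G \<phi> \<psi> \<chi>)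
  have "insert \<phi> G \<subseteq> insert \<phi> G'" "insert \<psi> G \<subseteq> insert \<psi> G'" using disjE.prems by blast+
  then show ?case
    by (metis derives.disjE disjE.IH disjE.prems)
next
  case (implI \<phi> G \<psi>)
  show ?case by (rule derives.implI, rule implI.IH, use implI.prems in blast)
next
  case (implE G \<phi> \<psi>)
  show ?case by (rule derives.implE[OF implE.IH]) (rule implE.prems)+
next
  case (forallI G \<phi>)
  show ?case by (rule derives.forallI, rule forallI.IH, use forallI.prems in blast)
next
  case (forallE G \<phi> t)
  show ?case by (rule derives.forallE, rule forallE.IH, rule forallE.prems)
next
  case (existsI G \<phi> t)
  show ?case by (rule derives.existsI, rule existsI.IH, rule existsI.prems)
next
  case (existsE G \<phi> \<psi>)
  show ?case
    by (rule derives.existsE[OF existsE.IH(1)[OF existsE.prems]])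
      (rule existsE.IH(2), use existsE.prems in blast)
next
  case (eqI G x)
  show ?case by (rule derives.eqI)
next
  case (eqE G x y \<phi>)
  show ?case by (rule derives.eqE[OF eqE.IH]) (rule eqE.prems)+
qed

lemma derives_cut: "derives T G \<phi> \<Longrightarrow> derives T (insert \<phi> G) \<psi> \<Longrightarrow> derives T G \<psi>"
  using implI implE by blast

text \<open>Compactness, needed because a saturated theory is the union of a chain of
  theories.\<close>

lemma derives_finite: "derives T G \<phi> \<Longrightarrow> \<exists>G0 \<subseteq> G. finite G0 \<and> derives T G0 \<phi>"
proof (induction rule: derives.induct)
  case (axiom \<phi> G)
  then show ?case by (intro exI[of _ "{}"]) (auto intro: derives.axiom)
next
  case (assm \<phi> G)
  then show ?case by (intro exI[of _ "{\<phi>}"]) (auto intro: derives.assm)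
next
  case (falsumE G \<phi>)
  then show ?case by (meson derives.falsumE)
next
  case (conjI G \<phi> \<psi>)
  then obtain A B where AB: "A \<subseteq> G" "finite A" "derives T A \<phi>" "B \<subseteq> G" "finite B" "derives T B \<psi>"
    by blast
  have "derives T (A \<union> B) (\<phi> \<^bold>\<and> \<psi>)"
    by (rule derives.conjI) (rule derives_mono, rule AB, blast)+
  with AB show ?case by (intro exI[of _ "A \<union> B"]) simp
next
  case (conjE1 G \<phi> \<psi>)
  then show ?case by (meson derives.conjE1)
next
  case (conjE2 G \<phi> \<psi>)
  then show ?case by (meson derives.conjE2)
next
  case (disjI1 G \<phi> \<psi>)
  then show ?case by (meson derives.disjI1)
next
  case (disjI2 G \<psi> \<phi>)
  then show ?case by (meson derives.disjI2)
next
  case (disjE G \<phi> \<psi> \<chi>)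
  then obtain A B C where A: "A \<subseteq> G" "finite A" "derives T A (\<phi> \<^bold>\<or> \<psi>)"
    and B: "B \<subseteq> insert \<phi> G" "finite B" "derives T B \<chi>"
    and C: "C \<subseteq> insert \<psi> G" "finite C" "derives T C \<chi>"
    by blast
  \<comment> \<open>The discharged formulas are removed, since they need not belong to
    \<open>G\<close>.\<close>
  let ?D = "A \<union> (B - {\<phi>}) \<union> (C - {\<psi>})"
  have "derives T ?D (\<phi> \<^bold>\<or> \<psi>)" using A(3) by (rule derives_mono) blast
  moreover have "derives T (insert \<phi> ?D) \<chi>" using B(3) by (rule derives_mono) blast
  moreover have "derives T (insert \<psi> ?D) \<chi>" using C(3) by (rule derives_mono) blast
  ultimately have "derives T ?D \<chi>" by (rule derives.disjE)
  with A B C show ?case by (intro exI[of _ ?D]) auto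
next
  case (implI \<phi> G \<psi>)
  then obtain A where A: "A \<subseteq> insert \<phi> G" "finite A" "derives T A \<psi>" by blast
  have "derives T (insert \<phi> (A - {\<phi>})) \<psi>" using A(3) by (rule derives_mono) blast
  then have "derives T (A - {\<phi>}) (\<phi> \<^bold>\<longrightarrow> \<psi>)" by (rule derives.implI)
  with A show ?case by (intro exI[of _ "A - {\<phi>}"]) auto
next
  case (implE G \<phi> \<psi>)
  then obtain A B where AB: "A \<subseteq> G" "finite A" "derives T A (\<phi> \<^bold>\<longrightarrow> \<psi>)" "B \<subseteq> G" "finite B" "derives T B \<phi>"
    by blast
  have "derives T (A \<union> B) \<psi>"
    by (rule derives.implE) (rule derives_mono, rule AB, blast)+
  with AB show ?case by (intro exI[of _ "A \<union> B"]) simp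
next
  case (forallI G \<phi>)
  then obtain A where "A \<subseteq> G" "finite A" "derives T (rename Suc ` A) \<phi>"
    by (metis finite_subset_image)
  then show ?case by (meson derives.forallI)
next
  case (forallE G \<phi> t)
  then show ?case by (meson derives.forallE)
next
  case (existsI G \<phi> t)
  then show ?case by (meson derives.existsI)
next
  case (existsE G \<phi> \<psi>)
  then obtain A B where A: "A \<subseteq> G" "finite A" "derives T A (Exists \<phi>)"
    and B: "B \<subseteq> insert \<phi> (rename Suc ` G)" "finite B" "derives T B (rename Suc \<psi>)"
    by blast
  \<comment> \<open>Apart from the discharged \<open>\<phi>\<close>, every assumption used is a
    shifted member of \<open>G\<close>, so finitely many preimages suffice.\<close>
  from B have "B - {\<phi>} \<subseteq> rename Suc ` G" "finite (B - {\<phi>})" by auto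
  then obtain C where C: "C \<subseteq> G" "finite C" "B - {\<phi>} = rename Suc ` C"
    by (metis finite_subset_image)
  have "derives T (A \<union> C) \<psi>"
  proof (rule derives.existsE)
    show "derives T (A \<union> C) (Exists \<phi>)" using A(3) by (rule derives_mono) blast
    show "derives T (insert \<phi> (rename Suc ` (A \<union> C))) (rename Suc \<psi>)"
      using B(3) by (rule derives_mono) (use C(3) in blast)
  qed
  with A C show ?case by (intro exI[of _ "A \<union> C"]) auto
next
  case (eqI G x)
  then show ?case by (meson derives.eqI empty_subsetI finite.emptyI)
next
  case (eqE G x y \<phi>)
  then obtain A B where AB: "A \<subseteq> G" "finite A" "derives T A (x \<^bold>= y)" "B \<subseteq> G" "finite B" "derives T B (inst \<phi> x)"
    by blast
  have "derives T (A \<union> B) (inst \<phi> y)"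
    by (rule derives.eqE) (rule derives_mono, rule AB, blast)+
  with AB show ?case by (intro exI[of _ "A \<union> B"]) simp
qed

text \<open>The rule \<open>forallI\<close> shifts the assumptions but not the axioms. A renamed
  derivation is therefore again a derivation only if renaming carries axioms to axioms.\<close>

definition rename_closed :: "fm set \<Rightarrow> bool" where
  "rename_closed T \<longleftrightarrow> (\<forall>\<phi> f. \<phi> \<in> T \<longrightarrow> rename f \<phi> \<in> T)"

lemma derives_rename:
  assumes "rename_closed T"
  shows "derives T G \<phi> \<Longrightarrow> derives T (rename f ` G) (rename f \<phi>)"
proof (induction arbitrary: f rule: derives.induct)
  case (axiom \<phi> G)
  then show ?case using assms by (simp add: rename_closed_def derives.axiom)
next
  case (assm \<phi> G)
  then show ?case by (simp add: derives.assm)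
next
  case (falsumE G \<phi>)
  from falsumE.IH[of f] show ?case by (simp add: derives.falsumE)
next
  case (conjI G \<phi> \<psi>)
  then show ?case by (simp add: derives.conjI)
next
  case (conjE1 G \<phi> \<psi>)
  from conjE1.IH[of f] show ?case unfolding rename.simps by (rule derives.conjE1)
next
  case (conjE2 G \<phi> \<psi>)
  from conjE2.IH[of f] show ?case unfolding rename.simps by (rule derives.conjE2)
next
  case (disjI1 G \<phi> \<psi>)
  then show ?case by (simp add: derives.disjI1)
next
  case (disjI2 G \<psi> \<phi>)
  then show ?case by (simp add: derives.disjI2)
next
  case (disjE G \<phi> \<psi> \<chi>)
  from disjE.IH[of f] show ?case unfolding rename.simps image_insert by (rule derives.disjE)
next
  case (implI \<phi> G \<psi>)
  from implI.IH[of f] show ?case unfolding rename.simps image_insert by (rule derives.implI)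
next
  case (implE G \<phi> \<psi>)
  from implE.IH[of f] show ?case unfolding rename.simps by (rule derives.implE)
next
  case (forallI G \<phi>)
  from forallI.IH[of "lift f"] show ?case
    by (simp add: derives.forallI image_image rename_Suc)
next
  case (forallE G \<phi> t)
  from forallE.IH[of f] show ?case by (simp add: rename_inst derives.forallE)
next
  case (existsI G \<phi> t)
  from existsI.IH[of f] show ?case unfolding rename_inst rename.simps by (rule derives.existsI)
next
  case (existsE G \<phi> \<psi>)
  have "derives T (insert (rename (lift f) \<phi>) (rename Suc ` rename f ` G)) (rename Suc (rename f \<psi>))"
    using existsE.IH(2)[of "lift f"] by (simp add: image_image rename_Suc)
  with existsE.IH(1)[of f] show ?case unfolding rename.simps by (rule derives.existsE)
next
  case (eqI G x)
  show ?case by (simp add: derives.eqI)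
next
  case (eqE G x y \<phi>)
  from eqE.IH[of f] show ?case unfolding rename_inst rename.simps by (rule derives.eqE)
qed

lemma abstract_fresh:
  assumes "c \<notin> fv \<phi>"
  shows "rename (\<lambda>i. if i = c then 0 else Suc i) \<phi> = rename Suc \<phi>"
  using assms by (intro rename_cong) auto

text \<open>Turning the named variable \<open>c\<close> into the innermost index undoes an
  instantiation by \<open>c\<close>. Below the binder \<open>c\<close> has index
  \<open>Suc c\<close>, hence the form of the freshness condition.\<close>

lemma abstract_inst:
  assumes "Suc c \<notin> fv \<phi>"
  shows "rename (\<lambda>i. if i = c then 0 else Suc i) (inst \<phi> c) = \<phi>"
proof -
  have "rename ((\<lambda>i. if i = c then 0 else Suc i) \<circ> case_nat c (\<lambda>i. i)) \<phi> = rename (\<lambda>i. i) \<phi>"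
    using assms by (intro rename_cong) (auto split: nat.split)
  then show ?thesis by (simp add: inst_def rename_rename rename_ident)
qed

text \<open>The eigenvariable form of \<open>forallI\<close>: renaming the whole derivation makes
  the fresh \<open>c\<close> the bound index, while the assumptions, which do not contain
  \<open>c\<close>, are merely shifted. The next lemma treats \<open>existsE\<close> in the same
  way.\<close>

lemma generalize:
  assumes "rename_closed T" "derives T G (inst \<phi> c)" "Suc c \<notin> fv \<phi>" "\<And>\<psi>. \<psi> \<in> G \<Longrightarrow> c \<notin> fv \<psi>"
  shows "derives T G (Forall \<phi>)"
proof (rule forallI)
  let ?f = "\<lambda>i. if i = c then 0 else Suc i"
  have "rename ?f ` G = rename Suc ` G"
    using assms(4) by (intro image_cong refl abstract_fresh)
  then show "derives T (rename Suc ` G) \<phi>"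
    using derives_rename[OF assms(1,2), of ?f] abstract_inst[OF assms(3)] by simp
qed

lemma forget_witness:
  assumes "rename_closed T" "derives T (insert (inst \<phi> c) G) \<psi>"
    and "Suc c \<notin> fv \<phi>" "c \<notin> fv \<psi>" "\<And>\<psi>. \<psi> \<in> G \<Longrightarrow> c \<notin> fv \<psi>"
  shows "derives T (insert (Exists \<phi>) G) \<psi>"
proof (rule existsE)
  let ?f = "\<lambda>i. if i = c then 0 else Suc i"
  show "derives T (insert (Exists \<phi>) G) (Exists \<phi>)" by (simp add: assm)
  have "rename ?f ` G = rename Suc ` G"
    using assms(5) by (intro image_cong refl abstract_fresh)
  then have "derives T (insert \<phi> (rename Suc ` G)) (rename Suc \<psi>)"
    using derives_rename[OF assms(1,2), of ?f] abstract_inst[OF assms(3)] abstract_fresh[OF assms(4)]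
    by simp
  then show "derives T (insert \<phi> (rename Suc ` insert (Exists \<phi>) G)) (rename Suc \<psi>)"
    by (rule derives_mono) blast
qed

section \<open>Completeness for Kripke models\<close>

instance fm :: countable
  by countable_datatype

text \<open>The variables in \<open>X\<close> play the role of the constants of the language.
  Infinitely many variables stay outside, so that a later world can still introduce fresh
  ones.\<close>

definition saturated :: "fm set \<Rightarrow> nat set \<Rightarrow> fm set \<Rightarrow> bool" where
  "saturated T X G \<longleftrightarrow> infinite (- X) \<and> (\<forall>\<phi>\<in>G. fv \<phi> \<subseteq> X) \<and>
    (\<forall>\<phi>. fv \<phi> \<subseteq> X \<longrightarrow> derives T G \<phi> \<longrightarrow> \<phi> \<in> G) \<and> \<^bold>\<bottom> \<notin> G \<and>
    (\<forall>\<phi> \<psi>. (\<phi> \<^bold>\<or> \<psi>) \<in> G \<longrightarrow> \<phi> \<in> G \<or> \<psi> \<in> G) \<and>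
    (\<forall>\<phi>. Exists \<phi> \<in> G \<longrightarrow> (\<exists>c\<in>X. inst \<phi> c \<in> G))"

lemma infinite_split:
  fixes A :: "nat set"
  assumes "infinite A"
  obtains B where "B \<subseteq> A" "infinite B" "infinite (A - B)"
proof -
  obtain h :: "nat \<Rightarrow> nat" where h: "inj h" "range h \<subseteq> A"
    using infinite_countable_subset[OF assms] by blast
  let ?B = "h ` {i. even i}" and ?C = "h ` {i. odd i}"
  have "\<not> finite {i::nat. even i}" "\<not> finite {i::nat. odd i}"
    unfolding infinite_nat_iff_unbounded mem_Collect_eq by (presburger, presburger)
  then have "infinite ?B" "infinite ?C"
    using h(1) by (simp_all add: finite_image_iff inj_on_subset)
  moreover have "?C \<subseteq> A - ?B" using h by (auto simp: inj_eq)
  ultimately show thesis using that[of ?B] h(2) by (meson image_subset_iff infinite_super rangeI subset_iff)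
qed

text \<open>Lindenbaum's construction relative to a formula \<open>\<psi>\<close> that must not
  become derivable. A formula is rejected only if adding it would yield \<open>\<psi>\<close>; so if
  both disjuncts of a member were rejected, \<open>disjE\<close> would derive
  \<open>\<psi>\<close>.\<close>

lemma saturated_extension:
  assumes T: "rename_closed T" and X: "infinite (- X)" and G: "\<forall>\<phi>\<in>G. fv \<phi> \<subseteq> X"
    and \<psi>: "fv \<psi> \<subseteq> X" and nd: "\<not> derives T G \<psi>"
  obtains X' G' where "X \<subseteq> X'" "G \<subseteq> G'" "saturated T X' G'" "\<psi> \<notin> G'"
proof -
  \<comment> \<open>One infinite half of the free variables serves as the supply of witnesses; the
    other half remains free in the new theory.\<close>
  obtain Y where Y: "Y \<subseteq> - X" "infinite Y" "infinite (- X - Y)"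
    using infinite_split[OF X] by blast
  define X' where "X' = X \<union> Y"
  \<comment> \<open>Stage \<open>n\<close> decides formula number \<open>n\<close>, adding a witness
    along with an existential formula. As \<open>G\<close> avoids \<open>Y\<close> and only finitely
    many formulas have been added to it, some variable in \<open>Y\<close> is always fresh.\<close>
  define P where "P = (\<lambda>(n::nat) D. G \<subseteq> D \<and> finite (D - G) \<and> (\<forall>\<phi>\<in>D. fv \<phi> \<subseteq> X') \<and> \<not> derives T D \<psi>)"
  define Q where "Q = (\<lambda>n D D'. D \<subseteq> D' \<and> (fv (from_nat n) \<subseteq> X' \<longrightarrow>
    derives T (insert (from_nat n) D) \<psi> \<or>
    from_nat n \<in> D' \<and> (\<forall>\<chi>. from_nat n = Exists \<chi> \<longrightarrow> (\<exists>c\<in>X'. inst \<chi> c \<in> D'))))"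
  have step: "\<exists>D'. P (Suc n) D' \<and> Q n D D'" if D: "P n D" for n D
  proof -
    let ?\<phi> = "from_nat n :: fm"
    consider "\<not> (fv ?\<phi> \<subseteq> X') \<or> derives T (insert ?\<phi> D) \<psi>"
      | \<chi> where "fv ?\<phi> \<subseteq> X'" "\<not> derives T (insert ?\<phi> D) \<psi>" "?\<phi> = Exists \<chi>"
      | "fv ?\<phi> \<subseteq> X'" "\<not> derives T (insert ?\<phi> D) \<psi>" "\<forall>\<chi>. ?\<phi> \<noteq> Exists \<chi>"
      by blast
    then show ?thesis
    proof cases
      case 1
      then show ?thesis using D by (intro exI[of _ D]) (auto simp: P_def Q_def)
    next
      case 2
      have "finite (\<Union>(fv ` (D - G)) \<union> fv ?\<phi>)"
        using D by (auto simp: P_def finite_fv)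
      then obtain c where c: "c \<in> Y" "c \<notin> \<Union>(fv ` (D - G)) \<union> fv ?\<phi>"
        using Y(2) by (meson finite_subset subsetI)
      have fresh: "c \<notin> fv \<theta>" if "\<theta> \<in> insert ?\<phi> D" for \<theta>
        using that c G Y(1) by blast
      have "c \<notin> fv \<psi>" using c(1) Y(1) \<psi> by blast
      let ?D = "insert (inst \<chi> c) (insert ?\<phi> D)"
      have "\<not> derives T ?D \<psi>"
      proof
        assume "derives T ?D \<psi>"
        then have "derives T (insert (Exists \<chi>) (insert ?\<phi> D)) \<psi>"
          using forget_witness[OF T] fresh \<open>c \<notin> fv \<psi>\<close> 2(3) by force
        then show False using 2 by simp
      qed
      moreover have "?D - G \<subseteq> insert (inst \<chi> c) (insert ?\<phi> (D - G))" by blast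
      then have "finite (?D - G)"
        using D by (metis (no_types, lifting) P_def finite.insertI rev_finite_subset)
      moreover have "fv (inst \<chi> c) \<subseteq> X'"
        using fv_inst[of \<chi> c] 2(1,3) c(1) by (auto simp: X'_def)
      ultimately have "P (Suc n) ?D" using D 2(1) unfolding P_def by auto
      moreover have "Q n D ?D" unfolding Q_def using 2(3) c(1) by (auto simp: X'_def)
      ultimately show ?thesis by blast
    next
      case 3
      have "insert ?\<phi> D - G \<subseteq> insert ?\<phi> (D - G)" by blast
      then have "finite (insert ?\<phi> D - G)"
        using D by (metis (no_types, lifting) P_def finite.insertI rev_finite_subset)
      then show ?thesis using D 3 by (intro exI[of _ "insert ?\<phi> D"]) (auto simp: P_def Q_def)
    qed
  qed
  have "P 0 G" using G nd by (auto simp: P_def X'_def)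
  then obtain F where F: "\<And>n. P n (F n)" "\<And>n. Q n (F n) (F (Suc n))"
    using dependent_nat_choice[of P Q] step by blast
  define G' where "G' = (\<Union>n. F n)"
  have "F n \<subseteq> F (Suc n)" for n using F(2)[of n] by (simp add: Q_def)
  then have mono: "F m \<subseteq> F n" if "m \<le> n" for m n using that by (rule lift_Suc_mono_le)
  have nd': "\<not> derives T G' \<psi>"
  proof
    assume "derives T G' \<psi>"
    then obtain G0 where G0: "G0 \<subseteq> G'" "finite G0" "derives T G0 \<psi>"
      using derives_finite[of T G' \<psi>] by auto
    from G0(2,1) have "\<exists>n. G0 \<subseteq> F n"
    proof (induction rule: finite_induct)
      case (insert \<phi> A)
      then obtain m n where "A \<subseteq> F m" "\<phi> \<in> F n" by (auto simp: G'_def)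
      then have "insert \<phi> A \<subseteq> F (max m n)" using mono[of m "max m n"] mono[of n "max m n"] by auto
      then show ?case by blast
    qed simp
    then show False using G0(3) F(1) derives_mono unfolding P_def by blast
  qed
  have maximal: "derives T (insert \<phi> G') \<psi> \<or> \<phi> \<in> G' \<and> (\<forall>\<chi>. \<phi> = Exists \<chi> \<longrightarrow> (\<exists>c\<in>X'. inst \<chi> c \<in> G'))"
    if "fv \<phi> \<subseteq> X'" for \<phi>
  proof -
    obtain n where n: "from_nat n = \<phi>" using from_nat_to_nat by blast
    from F(2)[of n] that n have "derives T (insert \<phi> (F n)) \<psi> \<or>
      \<phi> \<in> F (Suc n) \<and> (\<forall>\<chi>. \<phi> = Exists \<chi> \<longrightarrow> (\<exists>c\<in>X'. inst \<chi> c \<in> F (Suc n)))"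
      by (simp add: Q_def)
    then show ?thesis
    proof
      assume "derives T (insert \<phi> (F n)) \<psi>"
      then have "derives T (insert \<phi> G') \<psi>" by (rule derives_mono) (auto simp: G'_def)
      then show ?thesis ..
    qed (unfold G'_def, blast)
  qed
  have fv: "\<forall>\<phi>\<in>G'. fv \<phi> \<subseteq> X'" using F(1) by (auto simp: G'_def P_def)
  \<comment> \<open>By cut, a derivable formula cannot have been rejected.\<close>
  have closed: "\<phi> \<in> G'" if "fv \<phi> \<subseteq> X'" "derives T G' \<phi>" for \<phi>
    using maximal[OF that(1)] nd' derives_cut[OF that(2)] by blast
  have "\<^bold>\<bottom> \<notin> G'" using nd' by (meson assm falsumE)
  moreover have "\<phi> \<in> G' \<or> \<chi> \<in> G'" if "(\<phi> \<^bold>\<or> \<chi>) \<in> G'" for \<phi> \<chi>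
  proof -
    have "fv \<phi> \<subseteq> X'" "fv \<chi> \<subseteq> X'" using fv that by force+
    then show ?thesis
      using maximal nd' disjE[OF assm[OF that], of T \<psi>] by blast
  qed
  moreover have "\<exists>c\<in>X'. inst \<phi> c \<in> G'" if "Exists \<phi> \<in> G'" for \<phi>
  proof -
    have "\<not> derives T (insert (Exists \<phi>) G') \<psi>" using nd' that by (simp add: insert_absorb)
    then show ?thesis using maximal[of "Exists \<phi>"] fv that by blast
  qed
  moreover have "infinite (- X')" using Y(3) by (simp add: X'_def Diff_eq)
  ultimately have "saturated T X' G'" unfolding saturated_def using fv closed by blast
  moreover have "\<psi> \<notin> G'" using nd' assm[of \<psi> G' T] by blast
  moreover have "X \<subseteq> X'" "G \<subseteq> G'"
    using F(1)[of 0] by (auto simp: X'_def G'_def P_def)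
  ultimately show thesis using that by blast
qed

text \<open>Equality is interpreted by a congruence instead of identity, because distinct variables
  may be equal in a saturated theory; this spares a quotient of the canonical model. The predicate
  \<open>E\<close> carves growing domains out of one type.\<close>

locale kripke =
  fixes le :: "'w \<Rightarrow> 'w \<Rightarrow> bool" (infix "\<sqsubseteq>" 50)
    and E :: "'w \<Rightarrow> 'd \<Rightarrow> bool"
    and mem :: "'w \<Rightarrow> 'd \<Rightarrow> 'd \<Rightarrow> bool"
    and eq :: "'w \<Rightarrow> 'd \<Rightarrow> 'd \<Rightarrow> bool"
  assumes le_refl [simp]: "w \<sqsubseteq> w"
    and le_trans [trans]: "u \<sqsubseteq> v \<Longrightarrow> v \<sqsubseteq> w \<Longrightarrow> u \<sqsubseteq> w"
    and E_mono: "E v x \<Longrightarrow> v \<sqsubseteq> w \<Longrightarrow> E w x"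
    and mem_mono: "mem v x y \<Longrightarrow> v \<sqsubseteq> w \<Longrightarrow> mem w x y"
    and eq_mono: "eq v x y \<Longrightarrow> v \<sqsubseteq> w \<Longrightarrow> eq w x y"
    and mem_E: "mem w x y \<Longrightarrow> E w x \<and> E w y"
    and eq_E: "eq w x y \<Longrightarrow> E w x \<and> E w y"
    and eq_refl: "E w x \<Longrightarrow> eq w x x"
    and eq_sym: "eq w x y \<Longrightarrow> eq w y x"
    and eq_trans [trans]: "eq w x y \<Longrightarrow> eq w y z \<Longrightarrow> eq w x z"
    and mem_cong: "mem w x y \<Longrightarrow> eq w x x' \<Longrightarrow> eq w y y' \<Longrightarrow> mem w x' y'"
begin

primrec force :: "fm \<Rightarrow> 'w \<Rightarrow> (nat \<Rightarrow> 'd) \<Rightarrow> bool" where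
  "force (x \<^bold>\<in> y) w e \<longleftrightarrow> mem w (e x) (e y)"
| "force (x \<^bold>= y) w e \<longleftrightarrow> eq w (e x) (e y)"
| "force \<^bold>\<bottom> w e \<longleftrightarrow> False"
| "force (\<phi> \<^bold>\<and> \<psi>) w e \<longleftrightarrow> force \<phi> w e \<and> force \<psi> w e"
| "force (\<phi> \<^bold>\<or> \<psi>) w e \<longleftrightarrow> force \<phi> w e \<or> force \<psi> w e"
| "force (\<phi> \<^bold>\<longrightarrow> \<psi>) w e \<longleftrightarrow> (\<forall>v. w \<sqsubseteq> v \<longrightarrow> force \<phi> v e \<longrightarrow> force \<psi> v e)"
| "force (Forall \<phi>) w e \<longleftrightarrow> (\<forall>v d. w \<sqsubseteq> v \<longrightarrow> E v d \<longrightarrow> force \<phi> v (case_nat d e))"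
| "force (Exists \<phi>) w e \<longleftrightarrow> (\<exists>d. E w d \<and> force \<phi> w (case_nat d e))"

end

locale ECST_model = kripke le E mem eq
  for le :: "'w \<Rightarrow> 'w \<Rightarrow> bool" (infix "\<sqsubseteq>" 50)
    and E :: "'w \<Rightarrow> 'd \<Rightarrow> bool"
    and mem :: "'w \<Rightarrow> 'd \<Rightarrow> 'd \<Rightarrow> bool"
    and eq :: "'w \<Rightarrow> 'd \<Rightarrow> 'd \<Rightarrow> bool" +
  assumes ECST_valid: "\<phi> \<in> ECST \<Longrightarrow> (\<And>i. E w (e i)) \<Longrightarrow> force \<phi> w e"

lemma restricted_rename: "restricted \<phi> \<Longrightarrow> restricted (rename f \<phi>)"
  by (induction arbitrary: f rule: restricted.induct) (auto intro: restricted.intros)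

lemma lift_lift_comp_Suc: "lift (lift f) \<circ> lift Suc = lift Suc \<circ> lift f"
  by (simp add: lift_comp) (simp add: o_def)

text \<open>Renaming an instance of a schema gives the instance for a renamed formula. The renaming
  is lifted twice for separation and three times for replacement, because that many indices of the
  formula are bound in the axiom.\<close>

lemma rename_closed_ECST: "rename_closed ECST"
  unfolding rename_closed_def
proof (intro allI impI)
  fix \<phi> f assume "\<phi> \<in> ECST"
  then show "rename f \<phi> \<in> ECST"
  proof cases
    case extensionality
    then show ?thesis using ECST.extensionality by (simp add: numeral_2_eq_2)
  next
    case pairing
    then show ?thesis using ECST.pairing by (simp add: numeral_2_eq_2 numeral_3_eq_3)
  next
    case union
    then show ?thesis using ECST.union by (simp add: numeral_2_eq_2 numeral_3_eq_3)
  next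
    case (restricted_separation \<psi>)
    then show ?thesis
      using ECST.restricted_separation[OF restricted_rename[of \<psi> "lift (lift f)"]]
      by (simp add: numeral_2_eq_2 rename_rename lift_lift_comp_Suc)
  next
    case (replacement \<psi>)
    let ?g = "lift (lift (lift f))"
    have "lift ?g \<circ> case_nat 1 (case_nat 0 (\<lambda>i. i + 3)) = case_nat 1 (case_nat 0 (\<lambda>i. i + 3)) \<circ> ?g"
      by (auto simp: fun_eq_iff numeral_3_eq_3 split: nat.split)
    then show ?thesis
      using ECST.replacement[of "rename ?g \<psi>"] replacement
      by (simp add: numeral_2_eq_2 Exists1_def rename_rename lift_lift_comp_Suc)
  next
    case strong_infinity
    then show ?thesis
      using ECST.strong_infinity
      by (simp add: is_omega_def is_inductive_def is_empty_def is_succ_def is_subset_def)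
  qed
qed

section \<open>The canonical model\<close>

definition world :: "nat set \<times> fm set \<Rightarrow> bool" where
  "world w \<longleftrightarrow> saturated ECST (fst w) (snd w)"

text \<open>Pairs that are not saturated belong to the type as well. They have an empty domain by
  \<open>cE\<close>, and the last clause forbids moving from a world to such a pair, which is what
  persistence requires.\<close>

definition cle :: "nat set \<times> fm set \<Rightarrow> nat set \<times> fm set \<Rightarrow> bool" where
  "cle v w \<longleftrightarrow> fst v \<subseteq> fst w \<and> snd v \<subseteq> snd w \<and> (world v \<longrightarrow> world w)"

definition cE :: "nat set \<times> fm set \<Rightarrow> nat \<Rightarrow> bool" where
  "cE w x \<longleftrightarrow> world w \<and> x \<in> fst w"

definition cmem :: "nat set \<times> fm set \<Rightarrow> nat \<Rightarrow> nat \<Rightarrow> bool" where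
  "cmem w x y \<longleftrightarrow> world w \<and> (x \<^bold>\<in> y) \<in> snd w"

definition ceq :: "nat set \<times> fm set \<Rightarrow> nat \<Rightarrow> nat \<Rightarrow> bool" where
  "ceq w x y \<longleftrightarrow> world w \<and> (x \<^bold>= y) \<in> snd w"

lemma world_fv: "world w \<Longrightarrow> \<phi> \<in> snd w \<Longrightarrow> fv \<phi> \<subseteq> fst w"
  by (simp add: world_def saturated_def)

lemma world_closed: "world w \<Longrightarrow> fv \<phi> \<subseteq> fst w \<Longrightarrow> derives ECST (snd w) \<phi> \<Longrightarrow> \<phi> \<in> snd w"
  by (simp add: world_def saturated_def)

text \<open>The rule \<open>eqE\<close> replaces index 0 only, so a formula has to be presented with
  the variable to be exchanged at index 0. Symmetry, transitivity and congruence are instances with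
  atomic \<open>\<phi>\<close>.\<close>

lemma world_subst:
  assumes w: "world w" and "(x \<^bold>= y) \<in> snd w" "rename (case_nat x g) \<phi> \<in> snd w"
    and "fv (rename (case_nat y g) \<phi>) \<subseteq> fst w"
  shows "rename (case_nat y g) \<phi> \<in> snd w"
proof (rule world_closed[OF w])
  have "derives ECST (snd w) (inst (rename (lift g) \<phi>) y)"
    by (rule eqE[where x = x], rule assm, fact, rule assm) (use assms in \<open>simp add: inst_rename\<close>)
  then show "derives ECST (snd w) (rename (case_nat y g) \<phi>)" by (simp add: inst_rename)
qed fact

lemma world_extension:
  assumes w: "world w" and "X \<supseteq> fst w" "infinite (- X)" "\<forall>\<phi>\<in>G. fv \<phi> \<subseteq> X" "snd w \<subseteq> G"
    and "fv \<psi> \<subseteq> X" "\<not> derives ECST G \<psi>"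
  obtains v where "cle w v" "world v" "X \<subseteq> fst v" "G \<subseteq> snd v" "\<psi> \<notin> snd v"
proof -
  obtain X' G' where "X \<subseteq> X'" "G \<subseteq> G'" "saturated ECST X' G'" "\<psi> \<notin> G'"
    using saturated_extension[OF rename_closed_ECST assms(3,4,6,7)] .
  then show thesis using assms(2,5) by (intro that[of "(X', G')"]) (auto simp: cle_def world_def)
qed

text \<open>If the implication is missing, \<open>\<psi>\<close> does not follow from the theory
  with \<open>\<phi>\<close> added, so some saturated extension contains \<open>\<phi>\<close> and
  omits \<open>\<psi>\<close>.\<close>

lemma world_impl:
  assumes w: "world w" and fv: "fv (\<phi> \<^bold>\<longrightarrow> \<psi>) \<subseteq> fst w"
  shows "(\<phi> \<^bold>\<longrightarrow> \<psi>) \<in> snd w \<longleftrightarrow> (\<forall>v. cle w v \<longrightarrow> \<phi> \<in> snd v \<longrightarrow> \<psi> \<in> snd v)"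
proof
  assume *: "(\<phi> \<^bold>\<longrightarrow> \<psi>) \<in> snd w"
  show "\<forall>v. cle w v \<longrightarrow> \<phi> \<in> snd v \<longrightarrow> \<psi> \<in> snd v"
  proof (intro allI impI)
    fix v assume v: "cle w v" "\<phi> \<in> snd v"
    then have "world v" "fv \<psi> \<subseteq> fst v" "(\<phi> \<^bold>\<longrightarrow> \<psi>) \<in> snd v" using w fv * by (auto simp: cle_def)
    then show "\<psi> \<in> snd v" using v world_closed implE[OF assm assm] by blast
  qed
next
  assume *: "\<forall>v. cle w v \<longrightarrow> \<phi> \<in> snd v \<longrightarrow> \<psi> \<in> snd v"
  show "(\<phi> \<^bold>\<longrightarrow> \<psi>) \<in> snd w"
  proof (rule ccontr)
    assume "(\<phi> \<^bold>\<longrightarrow> \<psi>) \<notin> snd w"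
    then have "\<not> derives ECST (insert \<phi> (snd w)) \<psi>"
      using world_closed[OF w fv] implI[of ECST \<phi> "snd w" \<psi>] by auto
    moreover have "\<forall>\<theta>\<in>insert \<phi> (snd w). fv \<theta> \<subseteq> fst w" "fv \<psi> \<subseteq> fst w" "infinite (- fst w)"
      using fv w world_fv[OF w] by (auto simp: world_def saturated_def)
    ultimately obtain v where "cle w v" "insert \<phi> (snd w) \<subseteq> snd v" "\<psi> \<notin> snd v"
      by (meson world_extension[OF w subset_refl] subset_insertI)
    with * show False by blast
  qed
qed

text \<open>If the universal formula is missing, its instance at a variable \<open>c\<close> outside
  the domain is underivable, for otherwise \<open>generalize\<close> would apply; an extension with
  \<open>c\<close> in its domain then omits that instance.\<close>

lemma world_Forall:
  assumes w: "world w" and fv: "fv (Forall \<phi>) \<subseteq> fst w"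
  shows "Forall \<phi> \<in> snd w \<longleftrightarrow> (\<forall>v c. cle w v \<longrightarrow> c \<in> fst v \<longrightarrow> inst \<phi> c \<in> snd v)"
proof
  assume *: "Forall \<phi> \<in> snd w"
  show "\<forall>v c. cle w v \<longrightarrow> c \<in> fst v \<longrightarrow> inst \<phi> c \<in> snd v"
  proof (intro allI impI)
    fix v c assume v: "cle w v" "c \<in> fst v"
    then have "world v" "fv (inst \<phi> c) \<subseteq> fst v" "Forall \<phi> \<in> snd v"
      using w fv * fv_inst[of \<phi> c] by (auto simp: cle_def)
    then show "inst \<phi> c \<in> snd v" using world_closed forallE[OF assm] by blast
  qed
next
  assume *: "\<forall>v c. cle w v \<longrightarrow> c \<in> fst v \<longrightarrow> inst \<phi> c \<in> snd v"
  show "Forall \<phi> \<in> snd w"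
  proof (rule ccontr)
    assume "Forall \<phi> \<notin> snd w"
    then have nd: "\<not> derives ECST (snd w) (Forall \<phi>)" using world_closed[OF w fv] by blast
    have inf: "infinite (- fst w)" using w by (simp add: world_def saturated_def)
    then obtain c where c: "c \<notin> fst w" by (metis Compl_iff finite.emptyI ex_in_conv)
    have "\<not> derives ECST (snd w) (inst \<phi> c)"
    proof
      assume "derives ECST (snd w) (inst \<phi> c)"
      then have "derives ECST (snd w) (Forall \<phi>)"
        by (rule generalize[OF rename_closed_ECST]) (use c fv world_fv[OF w] in auto)
      with nd show False ..
    qed
    moreover have "- insert c (fst w) = - fst w - {c}" by blast
    then have "infinite (- insert c (fst w))" using inf by simp
    moreover have "\<forall>\<theta>\<in>snd w. fv \<theta> \<subseteq> insert c (fst w)" using world_fv[OF w] by blast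
    moreover have "fv (inst \<phi> c) \<subseteq> insert c (fst w)" using fv fv_inst[of \<phi> c] by auto
    ultimately obtain v where "cle w v" "insert c (fst w) \<subseteq> fst v" "inst \<phi> c \<notin> snd v"
      using world_extension[OF w subset_insertI] by (metis subset_refl)
    with * show False by blast
  qed
qed

interpretation canon: kripke cle cE cmem ceq
proof
  show "cmem w x y \<Longrightarrow> cE w x \<and> cE w y" "ceq w x y \<Longrightarrow> cE w x \<and> cE w y" for w x y
    using world_fv[of w "x \<^bold>\<in> y"] world_fv[of w "x \<^bold>= y"] by (auto simp: cmem_def ceq_def cE_def)
  show "cE w x \<Longrightarrow> ceq w x x" for w x
    by (auto simp: cE_def ceq_def intro!: world_closed eqI)
  show sym: "ceq w y x" if xy: "ceq w x y" for w x y
    using world_subst[of w x y "case_nat x (\<lambda>i. i)" "0 \<^bold>= 1"] world_fv[of w "x \<^bold>= y"]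
      world_closed[of w "x \<^bold>= x"] eqI[of ECST "snd w" x] xy
    by (auto simp: ceq_def)
  show "ceq w x z" if "ceq w x y" "ceq w y z" for w x y z
    using world_subst[of w y z "case_nat x (\<lambda>i. i)" "1 \<^bold>= 0"] that
      world_fv[of w "x \<^bold>= y"] world_fv[of w "y \<^bold>= z"]
    by (auto simp: ceq_def)
  show "cmem w x' y'" if "cmem w x y" "ceq w x x'" "ceq w y y'" for w x y x' y'
    using world_subst[of w x x' "case_nat y (\<lambda>i. i)" "0 \<^bold>\<in> 1"] that
      world_subst[of w y y' "case_nat x' (\<lambda>i. i)" "1 \<^bold>\<in> 0"]
      world_fv[of w "x \<^bold>\<in> y"] world_fv[of w "x \<^bold>= x'"] world_fv[of w "y \<^bold>= y'"]
    by (auto simp: ceq_def cmem_def)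
qed (auto simp: cle_def cE_def cmem_def ceq_def)

text \<open>Since all terms are variables, an environment into the canonical domain is itself a
  renaming.\<close>

lemma truth:
  "world w \<Longrightarrow> (\<And>i. e i \<in> fst w) \<Longrightarrow> canon.force \<phi> w e \<longleftrightarrow> rename e \<phi> \<in> snd w"
proof (induction \<phi> arbitrary: w e)
  case Falsum
  then show ?case by (simp add: world_def saturated_def)
next
  case (Conj \<phi> \<psi>)
  have "fv (rename e \<phi>) \<subseteq> fst w" "fv (rename e \<psi>) \<subseteq> fst w" using Conj.prems by (auto simp: fv_rename)
  then have "(rename e \<phi> \<^bold>\<and> rename e \<psi>) \<in> snd w \<longleftrightarrow> rename e \<phi> \<in> snd w \<and> rename e \<psi> \<in> snd w"
    using world_closed[OF Conj.prems(1)] conjI[OF assm assm] conjE1[OF assm] conjE2[OF assm]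
    by (metis Un_subset_iff fv.simps(4))
  then show ?case using Conj by simp
next
  case (Disj \<phi> \<psi>)
  have "fv (rename e \<phi>) \<subseteq> fst w" "fv (rename e \<psi>) \<subseteq> fst w" using Disj.prems by (auto simp: fv_rename)
  then have "(rename e \<phi> \<^bold>\<or> rename e \<psi>) \<in> snd w \<longleftrightarrow> rename e \<phi> \<in> snd w \<or> rename e \<psi> \<in> snd w"
    using world_closed[OF Disj.prems(1), of "rename e \<phi> \<^bold>\<or> rename e \<psi>"] Disj.prems(1)
      disjI1[OF assm, of "rename e \<phi>" "snd w"] disjI2[OF assm, of "rename e \<psi>" "snd w"]
    by (auto simp: world_def saturated_def)
  then show ?case using Disj by simp
next
  case (Impl \<phi> \<psi>)
  have "fv (rename e (\<phi> \<^bold>\<longrightarrow> \<psi>)) \<subseteq> fst w" using Impl.prems by (auto simp: fv_rename)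
  then have "rename e (\<phi> \<^bold>\<longrightarrow> \<psi>) \<in> snd w \<longleftrightarrow>
      (\<forall>v. cle w v \<longrightarrow> rename e \<phi> \<in> snd v \<longrightarrow> rename e \<psi> \<in> snd v)"
    using world_impl[OF Impl.prems(1), of "rename e \<phi>" "rename e \<psi>"] by simp
  moreover have "world v \<and> (\<forall>i. e i \<in> fst v)" if "cle w v" for v
    using that Impl.prems by (auto simp: cle_def)
  ultimately show ?case using Impl.IH by auto
next
  case (Forall \<phi>)
  have "fv (Forall (rename (lift e) \<phi>)) \<subseteq> fst w"
    using Forall.prems unfolding rename.simps[symmetric] fv_rename by auto
  then have "rename e (Forall \<phi>) \<in> snd w \<longleftrightarrow>
      (\<forall>v c. cle w v \<longrightarrow> c \<in> fst v \<longrightarrow> rename (case_nat c e) \<phi> \<in> snd v)"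
    using world_Forall[OF Forall.prems(1)] by (simp add: inst_rename)
  moreover have "world v \<and> (\<forall>i. case_nat c e i \<in> fst v)" if "cle w v" "c \<in> fst v" for v c
    using that Forall.prems by (auto simp: cle_def split: nat.split)
  moreover have "cE v c \<longleftrightarrow> c \<in> fst v" if "cle w v" for v c
    using that Forall.prems by (auto simp: cle_def cE_def)
  ultimately show ?case using Forall.IH by auto
next
  case (Exists \<phi>)
  have "fv (Exists (rename (lift e) \<phi>)) \<subseteq> fst w"
    using Exists.prems unfolding rename.simps[symmetric] fv_rename by auto
  then have "rename e (Exists \<phi>) \<in> snd w \<longleftrightarrow> (\<exists>c\<in>fst w. rename (case_nat c e) \<phi> \<in> snd w)"
    using world_closed[OF Exists.prems(1)] existsI[OF assm, of "rename (lift e) \<phi>"] Exists.prems(1)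
    unfolding world_def saturated_def by (metis inst_rename rename.simps(8))
  moreover have "\<forall>i. case_nat c e i \<in> fst w" if "c \<in> fst w" for c
    using that Exists.prems by (auto split: nat.split)
  moreover have "cE w c \<longleftrightarrow> c \<in> fst w" for c
    using Exists.prems by (auto simp: cE_def)
  ultimately show ?case using Exists.IH[OF Exists.prems(1)] by auto
qed (auto simp: cmem_def ceq_def)

interpretation canon: ECST_model cle cE cmem ceq
proof
  fix \<phi> w and e :: "nat \<Rightarrow> nat"
  assume \<phi>: "\<phi> \<in> ECST" and e: "\<And>i. cE w (e i)"
  then have w: "world w" and e': "\<And>i. e i \<in> fst w" by (auto simp: cE_def)
  have "derives ECST (snd w) (rename e \<phi>)"
    using \<phi> rename_closed_ECST by (simp add: rename_closed_def axiom)
  then have "rename e \<phi> \<in> snd w"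
    using e' by (intro world_closed[OF w]) (auto simp: fv_rename)
  then show "canon.force \<phi> w e" using truth[of w e \<phi>] w e' by blast
qed

theorem completeness:
  assumes "\<And>w e. (\<And>i. cE w (e i)) \<Longrightarrow> canon.force \<phi> w e"
  shows "ECST \<turnstile> \<phi>"
proof (rule ccontr)
  assume "\<not> ECST \<turnstile> \<phi>"
  moreover have "infinite (- fv \<phi>)" using finite_fv[of \<phi>] by simp
  ultimately obtain X G where X: "fv \<phi> \<subseteq> X" "saturated ECST X G" "\<phi> \<notin> G"
    using saturated_extension[OF rename_closed_ECST, of "fv \<phi>" "{}" \<phi>] by auto
  define w where "w = (X, G)"
  have w: "world w" "fst w = X" "snd w = G" using X by (simp_all add: w_def world_def)
  \<comment> \<open>An environment must assign an element of the domain to every index, even if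
    \<open>\<phi>\<close> is closed. The witness of this formula is the default value for indices
    not free in \<open>\<phi>\<close>.\<close>
  have "derives ECST G (Exists (0 \<^bold>= 0))" by (rule existsI[of _ _ _ 0]) (simp add: inst_def eqI)
  moreover have "fv (Exists (0 \<^bold>= 0)) \<subseteq> X" by auto
  ultimately have "Exists (0 \<^bold>= 0) \<in> G" using X(2) unfolding saturated_def by blast
  then obtain c where c: "c \<in> X" using X(2) by (auto simp: saturated_def)
  let ?e = "\<lambda>i. if i \<in> fv \<phi> then i else c"
  have "cE w (?e i)" for i using X(1) c w by (auto simp: cE_def)
  then have "canon.force \<phi> w ?e" by (rule assms)
  moreover have "?e i \<in> fst w" for i using X(1) c w by auto
  ultimately have "rename ?e \<phi> \<in> G" using truth[OF w(1), of ?e \<phi>] w(3) by blast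
  moreover have "rename ?e \<phi> = rename (\<lambda>i. i) \<phi>" by (rule rename_cong) simp
  ultimately show False using X(3) by (simp add: rename_ident)
qed

section \<open>Semantics of the set-theoretic formulas\<close>

abbreviation cons_env :: "'d \<Rightarrow> (nat \<Rightarrow> 'd) \<Rightarrow> nat \<Rightarrow> 'd"  (infixr "\<cdot>" 65) where
  "d \<cdot> e \<equiv> case_nat d e"

context kripke
begin

lemma force_mono: "force \<phi> v e \<Longrightarrow> v \<sqsubseteq> w \<Longrightarrow> force \<phi> w e"
proof (induction \<phi> arbitrary: v w e)
  case (Impl \<phi> \<psi>)
  then show ?case by (simp, meson le_trans)
next
  case (Forall \<phi>)
  then show ?case by (simp, meson le_trans)
next
  case (Exists \<phi>)
  then show ?case by (simp, meson E_mono)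
qed (auto intro: mem_mono eq_mono)

text \<open>Because \<open>eq\<close> is not identity, each defined predicate needs its own
  congruence law; applied to the defining formula, this lemma yields all of them.\<close>

lemma force_cong: "force \<phi> w e \<Longrightarrow> (\<And>i. eq w (e i) (e' i)) \<Longrightarrow> force \<phi> w e'"
proof (induction \<phi> arbitrary: w e e')
  case (Mem x y)
  then show ?case by (auto intro: mem_cong)
next
  case (Eq x y)
  then show ?case by simp (meson eq_sym eq_trans)
next
  case (Impl \<phi> \<psi>)
  have "force \<psi> v e'" if v: "w \<sqsubseteq> v" "force \<phi> v e'" for v
  proof -
    have *: "eq v (e i) (e' i)" for i using Impl.prems(2) v(1) eq_mono by blast
    then have "force \<phi> v e" using Impl.IH(1)[OF v(2)] eq_sym by blast
    then have "force \<psi> v e" using Impl.prems(1) v(1) by simp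
    then show ?thesis using Impl.IH(2) * by blast
  qed
  then show ?case by simp
next
  case (Forall \<phi>)
  have "force \<phi> v (d \<cdot> e')" if v: "w \<sqsubseteq> v" "E v d" for v d
  proof -
    have "eq v ((d \<cdot> e) i) ((d \<cdot> e') i)" for i
      using eq_mono[OF Forall.prems(2) v(1)] eq_refl[OF v(2)] by (auto split: nat.split)
    then show ?thesis using Forall.IH[of v "d \<cdot> e" "d \<cdot> e'"] Forall.prems(1) v by auto
  qed
  then show ?case by simp
next
  case (Exists \<phi>)
  then obtain d where d: "E w d" "force \<phi> w (d \<cdot> e)" by auto
  have "eq w ((d \<cdot> e) i) ((d \<cdot> e') i)" for i
    using Exists.prems(2) d eq_refl by (auto split: nat.split)
  then show ?case using Exists.IH d by auto
qed auto

lemma force_rename [simp]: "force (rename f \<phi>) w e \<longleftrightarrow> force \<phi> w (e \<circ> f)"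
  by (induction \<phi> arbitrary: f w e) (simp_all add: case_nat_comp_lift)

lemma cons_comp_Suc [simp]: "(d \<cdot> e) \<circ> Suc = e"
  by (simp add: fun_eq_iff)

lemma cons_comp_lift [simp]: "(d \<cdot> e) \<circ> lift f = d \<cdot> (e \<circ> f)"
  by (rule case_nat_comp_lift)

text \<open>Nested passages to later worlds collapse into one, since membership persists. Together
  with \<open>E_flatten\<close> and \<open>mem_E_drop\<close> this lets the simplifier bring forced
  bounded quantifiers into the form of the semantic definitions below.\<close>

lemma mem_flatten [simp]:
  "(\<forall>v. w \<sqsubseteq> v \<longrightarrow> (\<forall>d. mem v d x \<longrightarrow> (\<forall>u. v \<sqsubseteq> u \<longrightarrow> P u d))) \<longleftrightarrow>
    (\<forall>v. w \<sqsubseteq> v \<longrightarrow> (\<forall>d. mem v d x \<longrightarrow> P v d))"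
  by (meson le_refl le_trans mem_mono)

lemma E_flatten [simp]:
  "(\<forall>v. w \<sqsubseteq> v \<longrightarrow> (\<forall>d. E v d \<longrightarrow> (\<forall>u. v \<sqsubseteq> u \<longrightarrow> P u d))) \<longleftrightarrow>
    (\<forall>v. w \<sqsubseteq> v \<longrightarrow> (\<forall>d. E v d \<longrightarrow> P v d))"
  by (meson le_refl le_trans E_mono)

lemma cons_add_numeral [simp]: "(d \<cdot> e) (k + numeral v) = e (k + pred_numeral v)"
  by (simp add: numeral_eq_Suc)

lemma mem_E_drop [simp]:
  "(E w x \<longrightarrow> mem w x y \<longrightarrow> P) \<longleftrightarrow> (mem w x y \<longrightarrow> P)"
  "E w x \<and> mem w x y \<and> P \<longleftrightarrow> mem w x y \<and> P"
  "(E w x \<longrightarrow> \<not> mem w x y) \<longleftrightarrow> \<not> mem w x y"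
  using mem_E by blast+

lemma force_Iff:
  "force (\<phi> \<^bold>\<longleftrightarrow> \<psi>) w e \<longleftrightarrow> (\<forall>v. w \<sqsubseteq> v \<longrightarrow> force \<phi> v e \<longleftrightarrow> force \<psi> v e)"
  by auto

section \<open>Forcing conditions of the notions in the statement\<close>

definition sub :: "'w \<Rightarrow> 'd \<Rightarrow> 'd \<Rightarrow> bool" where
  "sub w x y \<longleftrightarrow> (\<forall>v z. w \<sqsubseteq> v \<longrightarrow> mem v z x \<longrightarrow> mem v z y)"

definition emp :: "'w \<Rightarrow> 'd \<Rightarrow> bool" where
  "emp w x \<longleftrightarrow> (\<forall>v z. w \<sqsubseteq> v \<longrightarrow> \<not> mem v z x)"

definition succ :: "'w \<Rightarrow> 'd \<Rightarrow> 'd \<Rightarrow> bool" where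
  "succ w y x \<longleftrightarrow> sub w x y \<and> mem w x y \<and> (\<forall>v z. w \<sqsubseteq> v \<longrightarrow> mem v z y \<longrightarrow> mem v z x \<or> eq v z x)"

definition ind :: "'w \<Rightarrow> 'd \<Rightarrow> bool" where
  "ind w x \<longleftrightarrow> (\<exists>z. mem w z x \<and> emp w z) \<and>
    (\<forall>v k. w \<sqsubseteq> v \<longrightarrow> mem v k x \<longrightarrow> (\<exists>k'. mem v k' x \<and> succ v k' k))"

definition om :: "'w \<Rightarrow> 'd \<Rightarrow> bool" where
  "om w x \<longleftrightarrow> ind w x \<and> (\<forall>v y. w \<sqsubseteq> v \<longrightarrow> E v y \<longrightarrow> ind v y \<longrightarrow> sub v x y)"

definition upair :: "'w \<Rightarrow> 'd \<Rightarrow> 'd \<Rightarrow> 'd \<Rightarrow> bool" where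
  "upair w z x y \<longleftrightarrow> mem w x z \<and> mem w y z \<and> (\<forall>v t. w \<sqsubseteq> v \<longrightarrow> mem v t z \<longrightarrow> eq v t x \<or> eq v t y)"

definition opair :: "'w \<Rightarrow> 'd \<Rightarrow> 'd \<Rightarrow> 'd \<Rightarrow> bool" where
  "opair w p x y \<longleftrightarrow> (\<exists>a b. mem w a p \<and> mem w b p \<and> upair w a x x \<and> upair w b x y \<and> upair w p a b)"

definition maps :: "'w \<Rightarrow> 'd \<Rightarrow> 'd \<Rightarrow> 'd \<Rightarrow> bool" where
  "maps w f x y \<longleftrightarrow> (\<exists>p. mem w p f \<and> opair w p x y)"

definition func :: "'w \<Rightarrow> 'd \<Rightarrow> 'd \<Rightarrow> 'd \<Rightarrow> bool" where
  "func w f A B \<longleftrightarrow>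
    (\<forall>v p. w \<sqsubseteq> v \<longrightarrow> mem v p f \<longrightarrow> (\<exists>x y. mem v x A \<and> mem v y B \<and> opair v p x y)) \<and>
    (\<forall>v x. w \<sqsubseteq> v \<longrightarrow> mem v x A \<longrightarrow> (\<exists>y. mem v y B \<and> maps v f x y \<and>
      (\<forall>u z. v \<sqsubseteq> u \<longrightarrow> mem u z B \<longrightarrow> maps u f x z \<longrightarrow> eq u z y)))"

definition surj :: "'w \<Rightarrow> 'd \<Rightarrow> 'd \<Rightarrow> 'd \<Rightarrow> bool" where
  "surj w f A B \<longleftrightarrow> func w f A B \<and> (\<forall>v y. w \<sqsubseteq> v \<longrightarrow> mem v y B \<longrightarrow> (\<exists>x. mem v x A \<and> maps v f x y))"

definition enum :: "'w \<Rightarrow> 'd \<Rightarrow> 'd \<Rightarrow> bool" where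
  "enum w n a \<longleftrightarrow> (\<exists>f. E w f \<and> surj w f n a)"

definition finenum :: "'w \<Rightarrow> 'd \<Rightarrow> bool" where
  "finenum w a \<longleftrightarrow> (\<exists>x n. E w x \<and> om w x \<and> mem w n x \<and> enum w n a)"

definition meet :: "'w \<Rightarrow> 'd \<Rightarrow> 'd \<Rightarrow> bool" where
  "meet w b \<alpha> \<longleftrightarrow> (\<exists>x. mem w x b \<and> mem w x \<alpha>)"

definition closed :: "'w \<Rightarrow> 'd \<Rightarrow> 'd \<Rightarrow> bool" where
  "closed w \<alpha> R \<longleftrightarrow> (\<forall>v r a b. w \<sqsubseteq> v \<longrightarrow> mem v r R \<longrightarrow> opair v r a b \<longrightarrow> sub v a \<alpha> \<longrightarrow> meet v b \<alpha>)"

lemma force_is_subset [simp]: "force (is_subset x y) w e \<longleftrightarrow> sub w (e x) (e y)"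
  by (simp add: is_subset_def sub_def)

lemma force_is_empty [simp]: "force (is_empty x) w e \<longleftrightarrow> emp w (e x)"
  by (simp add: is_empty_def emp_def)

lemma force_is_succ [simp]: "force (is_succ y x) w e \<longleftrightarrow> succ w (e y) (e x)"
  by (simp add: is_succ_def succ_def)

lemma force_is_inductive [simp]: "force (is_inductive x) w e \<longleftrightarrow> ind w (e x)"
  by (simp add: is_inductive_def ind_def)

lemma force_is_upair [simp]: "force (is_upair z x y) w e \<longleftrightarrow> upair w (e z) (e x) (e y)"
  by (simp add: is_upair_def upair_def)

lemma force_is_pair [simp]: "force (is_pair z x y) w e \<longleftrightarrow> opair w (e z) (e x) (e y)"
  by (simp add: is_pair_def opair_def)

lemma force_maps_to [simp]: "force (maps_to f x y) w e \<longleftrightarrow> maps w (e f) (e x) (e y)"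
  by (simp add: maps_to_def maps_def)

lemma force_is_function [simp]: "force (is_function f A B) w e \<longleftrightarrow> func w (e f) (e A) (e B)"
  by (simp add: is_function_def func_def)

lemma force_is_surjection [simp]: "force (is_surjection f A B) w e \<longleftrightarrow> surj w (e f) (e A) (e B)"
  by (simp add: is_surjection_def surj_def)

lemma force_enumerated_by [simp]: "force (enumerated_by n a) w e \<longleftrightarrow> enum w (e n) (e a)"
  by (simp add: enumerated_by_def enum_def)

lemma force_is_omega [simp]: "force (is_omega x) w e \<longleftrightarrow> om w (e x)"
  by (simp add: is_omega_def om_def)

lemma force_finitely_enumerable [simp]: "force (finitely_enumerable a) w e \<longleftrightarrow> finenum w (e a)"
  by (simp add: finitely_enumerable_def finenum_def)

lemma force_meets [simp]: "force (meets b x) w e \<longleftrightarrow> meet w (e b) (e x)"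
  by (simp add: meets_def meet_def)

lemma sub_mono: "sub v x y \<Longrightarrow> v \<sqsubseteq> w \<Longrightarrow> sub w x y"
  unfolding sub_def using le_trans by blast

lemma emp_mono: "emp v x \<Longrightarrow> v \<sqsubseteq> w \<Longrightarrow> emp w x"
  unfolding emp_def using le_trans by blast

lemma succ_mono: "succ v x y \<Longrightarrow> v \<sqsubseteq> w \<Longrightarrow> succ w x y"
  unfolding succ_def using le_trans sub_mono mem_mono by blast

lemma ind_mono: "ind v x \<Longrightarrow> v \<sqsubseteq> w \<Longrightarrow> ind w x"
  unfolding ind_def by (meson le_trans emp_mono mem_mono)

lemma om_mono: "om v x \<Longrightarrow> v \<sqsubseteq> w \<Longrightarrow> om w x"
  unfolding om_def by (meson le_trans ind_mono)

lemma upair_mono: "upair v z x y \<Longrightarrow> v \<sqsubseteq> w \<Longrightarrow> upair w z x y"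
  unfolding upair_def using le_trans mem_mono by blast

lemma opair_mono: "opair v z x y \<Longrightarrow> v \<sqsubseteq> w \<Longrightarrow> opair w z x y"
  unfolding opair_def using upair_mono mem_mono by blast

lemma maps_mono: "maps v f x y \<Longrightarrow> v \<sqsubseteq> w \<Longrightarrow> maps w f x y"
  unfolding maps_def using opair_mono mem_mono by blast

lemma func_mono: "func v f A B \<Longrightarrow> v \<sqsubseteq> w \<Longrightarrow> func w f A B"
  unfolding func_def by (meson le_trans)

lemma surj_mono: "surj v f A B \<Longrightarrow> v \<sqsubseteq> w \<Longrightarrow> surj w f A B"
  unfolding surj_def by (meson le_trans func_mono)

lemma closed_mono: "closed v a b \<Longrightarrow> v \<sqsubseteq> w \<Longrightarrow> closed w a b"
  unfolding closed_def by (meson le_trans)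

lemma upair_E: "upair w z x y \<Longrightarrow> E w z \<and> E w x \<and> E w y"
  unfolding upair_def using mem_E by blast

lemma opair_E: "opair w z x y \<Longrightarrow> E w z \<and> E w x \<and> E w y"
  unfolding opair_def using upair_E by blast

lemma force_is_closed [simp]: "force (is_closed x R) w e \<longleftrightarrow> closed w (e x) (e R)"
proof -
  have "(\<forall>v. w \<sqsubseteq> v \<longrightarrow> (\<forall>r. mem v r R \<longrightarrow> (\<forall>a. E v a \<longrightarrow> (\<forall>b. E v b \<longrightarrow>
      opair v r a b \<longrightarrow> (\<forall>p. v \<sqsubseteq> p \<longrightarrow> sub p a y \<longrightarrow> meet p b y)))))
    \<longleftrightarrow> closed w y R" (is "?L \<longleftrightarrow> _") for y R
  proof
    assume ?L
    then show "closed w y R" unfolding closed_def by (meson le_refl opair_E)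
  next
    assume *: "closed w y R"
    then show ?L unfolding closed_def by (meson le_trans mem_mono opair_mono)
  qed
  then show ?thesis by (simp add: is_closed_def)
qed

lemma mem_eq_right: "eq w x y \<Longrightarrow> mem w z x \<longleftrightarrow> mem w z y"
  using mem_cong eq_refl mem_E eq_sym by blast

lemma mem_eq_left: "eq w x y \<Longrightarrow> mem w x z \<longleftrightarrow> mem w y z"
  using mem_cong eq_refl mem_E eq_sym by blast

lemma emp_cong: "emp w x \<Longrightarrow> eq w x x' \<Longrightarrow> emp w x'"
  using force_cong[of "is_empty 0" w "\<lambda>_. x" "\<lambda>_. x'"] by simp

lemma sub_cong: "sub w x y \<Longrightarrow> eq w x x' \<Longrightarrow> eq w y y' \<Longrightarrow> sub w x' y'"
  using force_cong[of "is_subset 0 1" w "x \<cdot> (\<lambda>_. y)" "x' \<cdot> (\<lambda>_. y')"]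
  by (simp split: nat.split)

lemma upair_cong: "upair w z x y \<Longrightarrow> eq w z z' \<Longrightarrow> eq w x x' \<Longrightarrow> eq w y y' \<Longrightarrow> upair w z' x' y'"
  using force_cong[of "is_upair 0 1 2" w "z \<cdot> x \<cdot> (\<lambda>_. y)" "z' \<cdot> x' \<cdot> (\<lambda>_. y')"]
  by (simp split: nat.split)

lemma opair_cong: "opair w z x y \<Longrightarrow> eq w z z' \<Longrightarrow> eq w x x' \<Longrightarrow> eq w y y' \<Longrightarrow> opair w z' x' y'"
  using force_cong[of "is_pair 0 1 2" w "z \<cdot> x \<cdot> (\<lambda>_. y)" "z' \<cdot> x' \<cdot> (\<lambda>_. y')"]
  by (simp split: nat.split)

lemma maps_cong: "maps w z x y \<Longrightarrow> eq w z z' \<Longrightarrow> eq w x x' \<Longrightarrow> eq w y y' \<Longrightarrow> maps w z' x' y'"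
  using force_cong[of "maps_to 0 1 2" w "z \<cdot> x \<cdot> (\<lambda>_. y)" "z' \<cdot> x' \<cdot> (\<lambda>_. y')"]
  by (simp split: nat.split)

lemma maps_E: "maps w f x y \<Longrightarrow> E w f \<and> E w x \<and> E w y"
  unfolding maps_def using opair_E mem_E by blast

lemma upair_mem: "upair w z x y \<Longrightarrow> w \<sqsubseteq> v \<Longrightarrow> mem v t z \<longleftrightarrow> eq v t x \<or> eq v t y"
  using upair_mono[of w z x y v] mem_eq_left[of v t] unfolding upair_def by (meson le_refl)

lemma opair_inj:
  assumes "opair w p x y" "opair w p x' y'"
  shows "eq w x x' \<and> eq w y y'"
proof -
  obtain a b where a: "upair w a x x" and b: "upair w b x y" and p: "upair w p a b"
    using assms(1) unfolding opair_def by blast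
  obtain a' b' where a': "upair w a' x' x'" and b': "upair w b' x' y'" and p': "upair w p a' b'"
    using assms(2) unfolding opair_def by blast
  note m = upair_mem[OF _ le_refl]
  have ref: "eq w x x" "eq w y y" "eq w x' x'" "eq w y' y'" "eq w a a" "eq w b b" "eq w a' a'" "eq w b' b'"
    using a b a' b' upair_E eq_refl by blast+
  have 1: "eq w a a' \<or> eq w a b'" "eq w b a' \<or> eq w b b'" "eq w b' a \<or> eq w b' b"
    using m[OF p] m[OF p'] ref by blast+
  have x: "eq w x x'" using 1(1) m[OF a, of x] m[OF a, of x'] m[OF a', of x] m[OF b', of x'] ref
      mem_eq_right eq_sym by metis
  have "eq w y x' \<or> eq w y y'" using 1(2) m[OF b, of y] m[OF a', of y] m[OF b', of y] ref mem_eq_right by metis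
  moreover have "eq w y' x \<or> eq w y' y" using 1(3) m[OF b', of y'] m[OF a, of y'] m[OF b, of y'] ref mem_eq_right by metis
  \<comment> \<open>This avoids the undecidable case distinction on x = y: unless y = y' outright, y
    = x' and y' = x, and the equality of x and x' closes the circle.\<close>
  ultimately have "eq w y y'" using x eq_sym eq_trans by metis
  with x show ?thesis by blast
qed

lemma eq_refl_iff: "eq w x x \<longleftrightarrow> E w x"
  using eq_refl eq_E by blast

definition csub :: "'w \<Rightarrow> 'd \<Rightarrow> 'd \<Rightarrow> 'd \<Rightarrow> bool" where
  "csub w x S R \<longleftrightarrow> sub w x S \<and> closed w x R"

definition setgen :: "'w \<Rightarrow> 'd \<Rightarrow> 'd \<Rightarrow> bool" where
  "setgen w S R \<longleftrightarrow> (\<exists>G. E w G \<and> (\<forall>v x. w \<sqsubseteq> v \<longrightarrow> mem v x G \<longrightarrow> csub v x S R) \<and>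
    (\<forall>v x s. w \<sqsubseteq> v \<longrightarrow> E v x \<longrightarrow> csub v x S R \<longrightarrow> mem v s x \<longrightarrow>
      (\<exists>y. mem v y G \<and> mem v s y \<and> sub v y x)))"

text \<open>Leaving the condition on premises open makes both principles instances of
  \<open>nid\<close>.\<close>

definition rules :: "('w \<Rightarrow> 'd \<Rightarrow> bool) \<Rightarrow> 'w \<Rightarrow> 'd \<Rightarrow> 'd \<Rightarrow> bool" where
  "rules P w R S \<longleftrightarrow> (\<forall>v r. w \<sqsubseteq> v \<longrightarrow> mem v r R \<longrightarrow>
    (\<exists>a b. opair v r a b \<and> sub v a S \<and> sub v b S \<and> P v a))"

definition nid :: "('w \<Rightarrow> 'd \<Rightarrow> bool) \<Rightarrow> 'w \<Rightarrow> bool" where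
  "nid P w \<longleftrightarrow> (\<forall>v S R. w \<sqsubseteq> v \<longrightarrow> E v S \<longrightarrow> E v R \<longrightarrow> rules P v R S \<longrightarrow> setgen v S R)"

lemma csub_mono: "csub v x S R \<Longrightarrow> v \<sqsubseteq> w \<Longrightarrow> csub w x S R"
  unfolding csub_def using sub_mono closed_mono by blast

lemma force_is_closed_subset [simp]: "force (is_closed_subset x S R) w e \<longleftrightarrow> csub w (e x) (e S) (e R)"
  by (simp add: is_closed_subset_def csub_def)

lemma force_set_generated [simp]:
  "force (set_generated (is_closed_subset 0 2 1)) w (R \<cdot> S \<cdot> e) \<longleftrightarrow> setgen w S R"
proof -
  have "(\<forall>v. w \<sqsubseteq> v \<longrightarrow> (\<forall>x. E v x \<longrightarrow> csub v x S R \<longrightarrow>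
      (\<forall>u. v \<sqsubseteq> u \<longrightarrow> (\<forall>s. mem u s x \<longrightarrow> (\<exists>y. mem u y G \<and> mem u s y \<and> sub u y x))))) \<longleftrightarrow>
    (\<forall>v x s. w \<sqsubseteq> v \<longrightarrow> E v x \<longrightarrow> csub v x S R \<longrightarrow> mem v s x \<longrightarrow>
      (\<exists>y. mem v y G \<and> mem v s y \<and> sub v y x))" (is "?L \<longleftrightarrow> ?R") for G
  proof
    assume ?L
    then show ?R using le_refl by blast
  next
    assume ?R
    then show ?L using le_trans E_mono csub_mono by meson
  qed
  then show ?thesis
    by (simp add: set_generated_def setgen_def)
qed

lemma force_nary_rules [simp]:
  "force (nary_rules n R S) w e \<longleftrightarrow> rules (\<lambda>v. enum v (e n)) w (e R) (e S)"
  by (simp add: nary_rules_def is_rule_def rules_def) (meson opair_E)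

lemma force_finitary_rules [simp]:
  "force (finitary_rules R S) w e \<longleftrightarrow> rules finenum w (e R) (e S)"
  by (simp add: finitary_rules_def is_rule_def rules_def) (meson opair_E)

lemma force_NID_fin [simp]: "force NID_fin w e \<longleftrightarrow> nid finenum w"
  by (simp add: NID_fin_def nid_def force_set_generated[unfolded One_nat_def])

lemma force_NID [simp]: "force (NID n) w e \<longleftrightarrow> nid (\<lambda>v. enum v (e n)) w"
  by (simp add: NID_def nid_def force_set_generated[unfolded One_nat_def])

end

section \<open>Set existence\<close>

context ECST_model
begin

lemma force_ForallD: "force (Forall \<phi>) w e \<Longrightarrow> E w d \<Longrightarrow> force \<phi> w (d \<cdot> e)"
  using le_refl unfolding force.simps(7) by blast

lemma force_ImplD: "force (\<phi> \<^bold>\<longrightarrow> \<psi>) w e \<Longrightarrow> force \<phi> w e \<Longrightarrow> force \<psi> w e"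
  using le_refl unfolding force.simps(6) by blast

lemma extI:
  assumes "E w x" "E w y" "\<And>v z. w \<sqsubseteq> v \<Longrightarrow> mem v z x \<longleftrightarrow> mem v z y"
  shows "eq w x y"
proof -
  have "force (Forall (Forall (Forall (0 \<^bold>\<in> 2 \<^bold>\<longleftrightarrow> 0 \<^bold>\<in> 1) \<^bold>\<longrightarrow> 1 \<^bold>= 0))) w (\<lambda>_. x)"
    using assms(1) by (intro ECST_valid ECST.extensionality)
  then have "force (Forall (0 \<^bold>\<in> 2 \<^bold>\<longleftrightarrow> 0 \<^bold>\<in> 1) \<^bold>\<longrightarrow> 1 \<^bold>= 0) w (y \<cdot> x \<cdot> (\<lambda>_. x))"
    using assms(1,2) by (intro force_ForallD)
  moreover have "force (Forall (0 \<^bold>\<in> 2 \<^bold>\<longleftrightarrow> 0 \<^bold>\<in> 1)) w (y \<cdot> x \<cdot> (\<lambda>_. x))"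
    unfolding force.simps(7) force_Iff using assms(3) le_trans by simp
  ultimately have "force (1 \<^bold>= 0) w (y \<cdot> x \<cdot> (\<lambda>_. x))" by (rule force_ImplD)
  then show ?thesis by simp
qed

text \<open>The internal statement that the class \<open>P\<close> is a set. As \<open>P\<close> is
  a predicate of the metalogic, existence proofs compose freely, and a formula has to be written
  down only for separation and replacement.\<close>

definition ISet :: "'w \<Rightarrow> ('w \<Rightarrow> 'd \<Rightarrow> bool) \<Rightarrow> bool" where
  "ISet w P \<longleftrightarrow> (\<exists>Y. E w Y \<and> (\<forall>v y. w \<sqsubseteq> v \<longrightarrow> mem v y Y \<longleftrightarrow> P v y))"

lemma ISetE:
  assumes "ISet w P"
  obtains Y where "E w Y" "\<And>v y. w \<sqsubseteq> v \<Longrightarrow> mem v y Y \<longleftrightarrow> P v y"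
  using assms unfolding ISet_def by blast

lemma ISet_cong: "ISet w P \<Longrightarrow> (\<And>v y. w \<sqsubseteq> v \<Longrightarrow> P v y \<longleftrightarrow> Q v y) \<Longrightarrow> ISet w Q"
  unfolding ISet_def by simp

lemma ISet_mem: "E w A \<Longrightarrow> ISet w (\<lambda>v y. mem v y A)"
  unfolding ISet_def by blast

lemma ISet_upair:
  assumes "E w x" "E w y"
  shows "ISet w (\<lambda>v z. eq v z x \<or> eq v z y)"
proof -
  have "force (Forall (Forall (Exists (Forall (0 \<^bold>\<in> 1 \<^bold>\<longleftrightarrow> 0 \<^bold>= 3 \<^bold>\<or> 0 \<^bold>= 2))))) w (\<lambda>_. x)"
    using assms(1) by (intro ECST_valid ECST.pairing)
  then obtain Z where "E w Z" "\<And>v z. w \<sqsubseteq> v \<Longrightarrow> E v z \<Longrightarrow> mem v z Z \<longleftrightarrow> eq v z x \<or> eq v z y"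
    using assms unfolding force.simps(7,8) force_Iff E_flatten by simp (metis le_refl)
  then show ?thesis unfolding ISet_def using mem_E eq_E by metis
qed

lemma ISet_eq: "E w x \<Longrightarrow> ISet w (\<lambda>v z. eq v z x)"
  using ISet_upair[of w x x] by simp

lemma ISet_Union:
  assumes "E w A"
  shows "ISet w (\<lambda>v y. \<exists>a. mem v a A \<and> mem v y a)"
proof -
  have "force (Forall (Exists (Forall (0 \<^bold>\<in> 1 \<^bold>\<longleftrightarrow> BExists 2 (1 \<^bold>\<in> 0))))) w (\<lambda>_. A)"
    using assms(1) by (intro ECST_valid ECST.union)
  then obtain Z where "E w Z" "\<And>v z. w \<sqsubseteq> v \<Longrightarrow> E v z \<Longrightarrow> mem v z Z \<longleftrightarrow> (\<exists>a. mem v a A \<and> mem v z a)"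
    using assms unfolding force.simps(7,8) force_Iff E_flatten by simp (metis le_refl)
  then show ?thesis unfolding ISet_def using mem_E by metis
qed

lemma ISet_disj:
  assumes "ISet w P" "ISet w Q"
  shows "ISet w (\<lambda>v y. P v y \<or> Q v y)"
proof -
  obtain X where X: "E w X" "\<And>v y. w \<sqsubseteq> v \<Longrightarrow> mem v y X \<longleftrightarrow> P v y" using assms(1) by (rule ISetE) blast
  obtain Y where Y: "E w Y" "\<And>v y. w \<sqsubseteq> v \<Longrightarrow> mem v y Y \<longleftrightarrow> Q v y" using assms(2) by (rule ISetE) blast
  obtain Z where Z: "E w Z" "\<And>v y. w \<sqsubseteq> v \<Longrightarrow> mem v y Z \<longleftrightarrow> eq v y X \<or> eq v y Y"
    using ISet_upair[OF X(1) Y(1)] by (rule ISetE) blast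
  have "(\<exists>a. mem v a Z \<and> mem v y a) \<longleftrightarrow> P v y \<or> Q v y" if v: "w \<sqsubseteq> v" for v y
  proof -
    have "eq v X X" "eq v Y Y" using X(1) Y(1) v by (auto intro: eq_refl E_mono)
    then show ?thesis
      unfolding Z(2)[OF v] X(2)[OF v, symmetric] Y(2)[OF v, symmetric] using mem_eq_right by blast
  qed
  then show ?thesis by (rule ISet_cong[OF ISet_Union[OF Z(1)]])
qed

lemma ISet_sep:
  assumes "ISet w P" "restricted \<phi>" "\<And>i. E w (e i)"
  shows "ISet w (\<lambda>v y. P v y \<and> force \<phi> v (y \<cdot> e))"
proof -
  obtain A where A: "E w A" "\<And>v y. w \<sqsubseteq> v \<Longrightarrow> mem v y A \<longleftrightarrow> P v y" using assms(1) by (rule ISetE) blast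
  \<comment> \<open>In the axiom index 1 is the given set, while here the parameters begin at index
    1; weakening makes room for the set.\<close>
  let ?\<phi> = "rename (lift Suc) \<phi>"
  have "force (Forall (Exists (Forall (0 \<^bold>\<in> 1 \<^bold>\<longleftrightarrow> 0 \<^bold>\<in> 2 \<^bold>\<and> rename (lift Suc) ?\<phi>)))) w e"
    using assms by (intro ECST_valid ECST.restricted_separation restricted_rename)
  then obtain Z where "E w Z" "\<And>v z. w \<sqsubseteq> v \<Longrightarrow> E v z \<Longrightarrow> mem v z Z \<longleftrightarrow> mem v z A \<and> force \<phi> v (z \<cdot> e)"
    using A(1) unfolding force.simps(7,8) force_Iff E_flatten by simp (metis le_refl)
  then show ?thesis unfolding ISet_def using mem_E A(2) by metis
qed

text \<open>Replacement for the map that sends \<open>a\<close> to the set of all y with \<phi>(y,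
  a), which is single-valued by extensionality, followed by Union. Since \<open>\<phi>\<close> is
  arbitrary, unbounded definitions are admissible here, in contrast to
  \<open>ISet_sep\<close>.\<close>

lemma ISet_UN:
  assumes A: "E w A" and e: "\<And>i. E w (e i)"
    and set: "\<And>v a. w \<sqsubseteq> v \<Longrightarrow> mem v a A \<Longrightarrow> ISet v (\<lambda>u y. force \<phi> u (y \<cdot> a \<cdot> e))"
  shows "ISet w (\<lambda>u y. \<exists>a. mem u a A \<and> force \<phi> u (y \<cdot> a \<cdot> e))"
proof -
  \<comment> \<open>It says that \<open>Y\<close> is the set belonging to \<open>a\<close>. Below
    the quantifier the indices are 0 for the element, 1 for \<open>Y\<close>, 2 for
    \<open>a\<close>, 3 for \<open>A\<close>, and the parameters start at 4, which explains the
    renaming.\<close>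
  define \<chi> where "\<chi> = Forall (0 \<^bold>\<in> 1 \<^bold>\<longleftrightarrow> rename (case_nat 0 (case_nat 2 (\<lambda>i. i + 4))) \<phi>)"
  have comp: "(y \<cdot> Y \<cdot> a \<cdot> A' \<cdot> e') \<circ> case_nat 0 (case_nat 2 (\<lambda>i. i + 4)) = y \<cdot> a \<cdot> e'"
    for y Y a A' :: 'd and e'
    by (auto simp: fun_eq_iff numeral_eq_Suc split: nat.split)
  have \<chi>: "force \<chi> v (Y \<cdot> a \<cdot> A \<cdot> e) \<longleftrightarrow>
      (\<forall>u y. v \<sqsubseteq> u \<longrightarrow> mem u y Y \<longleftrightarrow> E u y \<and> force \<phi> u (y \<cdot> a \<cdot> e))" for v Y a
    unfolding \<chi>_def force.simps(7) force_Iff E_flatten using mem_E by (simp add: comp) meson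
  have fE: "E u y" if "w \<sqsubseteq> v" "mem v a A" "v \<sqsubseteq> u" "force \<phi> u (y \<cdot> a \<cdot> e)" for u v y a
    using set[OF that(1,2)] that(3,4) mem_E by (meson ISetE)
  have comp2: "(a \<cdot> y \<cdot> Z \<cdot> A' \<cdot> e') \<circ> case_nat 1 (case_nat 0 (\<lambda>i. i + 3)) = y \<cdot> a \<cdot> A' \<cdot> e'"
    for a y Z A' :: 'd and e'
    by (auto simp: fun_eq_iff numeral_eq_Suc split: nat.split)
  have "force (Forall (BForall 0 (Exists1 \<chi>) \<^bold>\<longrightarrow>
      Exists (Forall (0 \<^bold>\<in> 1 \<^bold>\<longleftrightarrow>
        BExists 2 (rename (case_nat 1 (case_nat 0 (\<lambda>i. i + 3))) \<chi>))))) w e"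
    using e by (intro ECST_valid ECST.replacement)
  then have *: "force (BForall 0 (Exists1 \<chi>)) w (A \<cdot> e) \<longrightarrow>
      force (Exists (Forall (0 \<^bold>\<in> 1 \<^bold>\<longleftrightarrow>
        BExists 2 (rename (case_nat 1 (case_nat 0 (\<lambda>i. i + 3))) \<chi>)))) w (A \<cdot> e)"
    using A le_refl unfolding force.simps(6,7) by blast
  have "\<exists>Y. E v Y \<and> force \<chi> v (Y \<cdot> a \<cdot> A \<cdot> e) \<and>
      (\<forall>u Y'. v \<sqsubseteq> u \<longrightarrow> E u Y' \<longrightarrow> force \<chi> u (Y' \<cdot> a \<cdot> A \<cdot> e) \<longrightarrow> eq u Y' Y)"
    if v: "w \<sqsubseteq> v" "mem v a A" for v a
  proof -
    obtain Y where Y: "E v Y" "\<And>u y. v \<sqsubseteq> u \<Longrightarrow> mem u y Y \<longleftrightarrow> force \<phi> u (y \<cdot> a \<cdot> e)"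
      using set[OF v] by (rule ISetE) blast
    have "force \<chi> v (Y \<cdot> a \<cdot> A \<cdot> e)" unfolding \<chi> using Y(2) fE[OF v] by blast
    moreover have "eq u Y' Y" if "v \<sqsubseteq> u" "E u Y'" "force \<chi> u (Y' \<cdot> a \<cdot> A \<cdot> e)" for u Y'
    proof (rule extI[OF that(2) E_mono[OF Y(1) that(1)]])
      fix t z assume t: "u \<sqsubseteq> t"
      then have "v \<sqsubseteq> t" using that(1) le_trans by blast
      then show "mem t z Y' \<longleftrightarrow> mem t z Y"
        using that(3) t Y(2) fE[OF v] unfolding \<chi> by blast
    qed
    ultimately show ?thesis using Y(1) by blast
  qed
  then have "force (BForall 0 (Exists1 \<chi>)) w (A \<cdot> e)"
    unfolding Exists1_def by simp
  with * have "force (Exists (Forall (0 \<^bold>\<in> 1 \<^bold>\<longleftrightarrow>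
      BExists 2 (rename (case_nat 1 (case_nat 0 (\<lambda>i. i + 3))) \<chi>)))) w (A \<cdot> e)" by blast
  then obtain Z where "E w Z" and
    "force (Forall (0 \<^bold>\<in> 1 \<^bold>\<longleftrightarrow>
      BExists 2 (rename (case_nat 1 (case_nat 0 (\<lambda>i. i + 3))) \<chi>))) w (Z \<cdot> A \<cdot> e)"
    unfolding force.simps(8) by blast
  then have Z: "E w Z"
    "\<And>v Y. w \<sqsubseteq> v \<Longrightarrow> E v Y \<Longrightarrow> mem v Y Z \<longleftrightarrow> (\<exists>a. mem v a A \<and> force \<chi> v (Y \<cdot> a \<cdot> A \<cdot> e))"
    unfolding force.simps(7) force_Iff E_flatten by (simp_all add: comp2[unfolded One_nat_def])
  have "(\<exists>Y. mem v Y Z \<and> mem v y Y) \<longleftrightarrow> (\<exists>a. mem v a A \<and> force \<phi> v (y \<cdot> a \<cdot> e))" if v: "w \<sqsubseteq> v" for v y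
  proof
    assume "\<exists>Y. mem v Y Z \<and> mem v y Y"
    then obtain Y a where "mem v y Y" "mem v a A" "force \<chi> v (Y \<cdot> a \<cdot> A \<cdot> e)"
      using Z(2)[OF v] mem_E by blast
    then show "\<exists>a. mem v a A \<and> force \<phi> v (y \<cdot> a \<cdot> e)" unfolding \<chi> using le_refl by blast
  next
    assume "\<exists>a. mem v a A \<and> force \<phi> v (y \<cdot> a \<cdot> e)"
    then obtain a where a: "mem v a A" "force \<phi> v (y \<cdot> a \<cdot> e)" by blast
    obtain Y where Y: "E v Y" "\<And>u y. v \<sqsubseteq> u \<Longrightarrow> mem u y Y \<longleftrightarrow> force \<phi> u (y \<cdot> a \<cdot> e)"
      using set[OF v a(1)] by (rule ISetE) blast
    have "force \<chi> v (Y \<cdot> a \<cdot> A \<cdot> e)" unfolding \<chi> using Y(2) fE[OF v a(1)] by blast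
    then show "\<exists>Y. mem v Y Z \<and> mem v y Y" using Z(2)[OF v Y(1)] Y(2)[OF le_refl] a by blast
  qed
  then show ?thesis by (rule ISet_cong[OF ISet_Union[OF Z(1)]])
qed

lemma upair_ex:
  assumes "E w x" "E w y"
  obtains z where "upair w z x y"
proof -
  obtain z where "E w z" "\<And>v t. w \<sqsubseteq> v \<Longrightarrow> mem v t z \<longleftrightarrow> eq v t x \<or> eq v t y"
    using ISet_upair[OF assms] by (rule ISetE) blast
  then show thesis using assms by (auto intro!: that[of z] simp: upair_def eq_refl)
qed

lemma upair_unique: "upair w z x y \<Longrightarrow> upair w z' x y \<Longrightarrow> eq w z z'"
  using upair_E by (intro extI) (blast, blast, simp add: upair_mem)

lemma opair_ex:
  assumes "E w x" "E w y"
  obtains p where "opair w p x y"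
proof -
  obtain a b where a: "upair w a x x" and b: "upair w b x y" using assms upair_ex by metis
  then obtain p where "upair w p a b" using upair_ex upair_E by metis
  then show thesis using a b that[of p] unfolding opair_def using upair_def by auto
qed

lemma opair_unique:
  assumes "opair w p x y" "opair w q x y"
  shows "eq w p q"
proof -
  obtain a b where a: "upair w a x x" and b: "upair w b x y" and p: "upair w p a b"
    using assms(1) unfolding opair_def by blast
  obtain a' b' where a': "upair w a' x x" and b': "upair w b' x y" and q: "upair w q a' b'"
    using assms(2) unfolding opair_def by blast
  have "eq w p p" using upair_E[OF p] eq_refl by blast
  then have "upair w p a' b'"
    using upair_cong[OF p] upair_unique[OF a a'] upair_unique[OF b b'] by blast
  then show ?thesis using q upair_unique by blast
qed

lemma ISet_opair:
  assumes "E w x" "E w y"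
  shows "ISet w (\<lambda>v p. opair v p x y)"
proof -
  obtain p where p: "opair w p x y" using opair_ex assms .
  have "eq v q p \<longleftrightarrow> opair v q x y" if "w \<sqsubseteq> v" for v q
    using opair_mono[OF p that] opair_unique opair_cong eq_sym eq_refl opair_E by meson
  with ISet_eq[of w p] opair_E[OF p] show ?thesis using ISet_cong by fastforce
qed

text \<open>Leastness of \<open>N\<close> applies to a subset only, and it is separation that makes
  the numbers with the property a set; hence the restriction on \<open>\<phi>\<close>.\<close>

lemma om_induct:
  assumes o: "om w N" and "restricted \<phi>" "\<And>i. E w (e i)" and k: "mem w k N"
    and base: "\<And>v z. w \<sqsubseteq> v \<Longrightarrow> mem v z N \<Longrightarrow> emp v z \<Longrightarrow> force \<phi> v (z \<cdot> e)"
    and step: "\<And>v i j. w \<sqsubseteq> v \<Longrightarrow> mem v i N \<Longrightarrow> mem v j N \<Longrightarrow> succ v j i \<Longrightarrow>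
      force \<phi> v (i \<cdot> e) \<Longrightarrow> force \<phi> v (j \<cdot> e)"
  shows "force \<phi> w (k \<cdot> e)"
proof -
  have "E w N" using k mem_E by blast
  then have "ISet w (\<lambda>v y. mem v y N \<and> force \<phi> v (y \<cdot> e))"
    using assms(2,3) by (intro ISet_sep ISet_mem)
  then obtain A where A: "E w A" "\<And>v y. w \<sqsubseteq> v \<Longrightarrow> mem v y A \<longleftrightarrow> mem v y N \<and> force \<phi> v (y \<cdot> e)"
    by (rule ISetE) blast
  have N: "ind w N" using o unfolding om_def by blast
  have "ind w A"
    unfolding ind_def
  proof (intro HOL.conjI allI impI)
    show "\<exists>z. mem w z A \<and> emp w z"
      using N base A(2) unfolding ind_def by (meson le_refl)
    fix v i assume v: "w \<sqsubseteq> v" "mem v i A"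
    then have "mem v i N" "force \<phi> v (i \<cdot> e)" using A(2) by blast+
    moreover obtain j where "mem v j N" "succ v j i" using N v calculation unfolding ind_def by blast
    ultimately show "\<exists>j. mem v j A \<and> succ v j i" using step A(2) v by blast
  qed
  then have "sub w N A" using o A(1) unfolding om_def by (meson le_refl)
  then show ?thesis using k A(2) unfolding sub_def by (meson le_refl)
qed

end

section \<open>Natural numbers\<close>

context ECST_model
begin

lemma succ_mem: "succ w y x \<Longrightarrow> w \<sqsubseteq> v \<Longrightarrow> mem v z y \<longleftrightarrow> mem v z x \<or> eq v z x"
proof -
  assume s: "succ w y x" and v: "w \<sqsubseteq> v"
  have "mem v x y" using s v mem_mono unfolding succ_def by blast
  then show ?thesis using s v mem_eq_left unfolding succ_def sub_def by blast
qed

text \<open>Numbers are transitive sets: an element of the successor of i lies in i or equals i, and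
  in both cases it is a subset of i.\<close>

lemma om_elem_sub:
  assumes "om w N" "mem w k N" "mem w i k"
  shows "sub w i k"
proof -
  have "restricted (BForall 0 (is_subset 0 1))"
    unfolding is_subset_def by (intro restricted.intros)
  then have "force (BForall 0 (is_subset 0 1)) w (k \<cdot> (\<lambda>_. N))"
  proof (rule om_induct[OF assms(1)])
    fix v z assume "emp v z"
    then show "force (BForall 0 (is_subset 0 1)) v (z \<cdot> (\<lambda>_. N))"
      using le_trans by (simp add: emp_def)
  next
    fix v i j assume s: "succ v j i" and IH: "force (BForall 0 (is_subset 0 1)) v (i \<cdot> (\<lambda>_. N))"
    have "sub u d j" if u: "v \<sqsubseteq> u" "mem u d j" for u d
    proof -
      have "sub u i j" using s u(1) sub_mono unfolding succ_def by blast
      moreover have "mem u d i \<or> eq u d i" using succ_mem[OF s u(1)] u(2) by blast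
      then have "sub u d i"
      proof
        assume "eq u d i"
        then show ?thesis using mem_eq_right eq_mono unfolding sub_def by blast
      qed (use IH u in simp)
      ultimately show ?thesis unfolding sub_def by blast
    qed
    then show "force (BForall 0 (is_subset 0 1)) v (j \<cdot> (\<lambda>_. N))" by simp
  qed (use assms mem_E in auto)
  then show ?thesis using assms(3) le_refl by simp
qed

lemma om_sub:
  assumes "om w N" "mem w k N"
  shows "sub w k N"
proof -
  have "restricted (is_subset 0 1)"
    unfolding is_subset_def by (intro restricted.intros)
  then have "force (is_subset 0 1) w (k \<cdot> (\<lambda>_. N))"
  proof (rule om_induct[OF assms(1)])
    fix v z assume "emp v z"
    then show "force (is_subset 0 1) v (z \<cdot> (\<lambda>_. N))"
      by (simp add: emp_def sub_def)
  next
    fix v i j assume s: "succ v j i" "mem v i N" and IH: "force (is_subset 0 1) v (i \<cdot> (\<lambda>_. N))"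
    then have "sub v i N" by simp
    then show "force (is_subset 0 1) v (j \<cdot> (\<lambda>_. N))"
      using succ_mem[OF s(1)] s(2) mem_eq_left mem_mono unfolding sub_def
      by (simp add: sub_def)
  qed (use assms mem_E in auto)
  then show ?thesis by simp
qed

text \<open>An induction that ignores its induction hypothesis. It is what makes being zero
  decidable on \<omega>.\<close>

lemma om_cases:
  assumes "om w N" "mem w k N"
  obtains "emp w k" | i where "mem w i N" "succ w k i"
proof -
  have "restricted (is_empty 0 \<^bold>\<or> BExists 1 (is_succ 1 0))"
    unfolding is_subset_def is_succ_def is_empty_def by (intro restricted.intros)
  then have "force (is_empty 0 \<^bold>\<or> BExists 1 (is_succ 1 0)) w (k \<cdot> (\<lambda>_. N))"
    by (rule om_induct[OF assms(1)]) (use assms mem_E in auto)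
  then show thesis using that by auto
qed

text \<open>Every assertion of \<open>finenum\<close> brings its own witness for \<omega>; this
  identifies it with the fixed \<open>N\<close>.\<close>

lemma om_unique:
  assumes "om w N" "om w M" "mem w k M"
  shows "mem w k N"
proof -
  have "ind w N" using assms(1) by (simp add: om_def)
  moreover from this have "E w N" using mem_E unfolding ind_def by blast
  ultimately have "sub w M N" using assms(2) le_refl unfolding om_def by blast
  then show ?thesis using assms(3) le_refl unfolding sub_def by blast
qed

text \<open>One argument of each kind for the function in \<open>enum_upair\<close>:
  \<open>z\<close> is zero and \<open>i\<close> is positive because it contains \<open>z\<close>.
  They make that function surjective.\<close>

definition ge2 :: "'w \<Rightarrow> 'd \<Rightarrow> bool" where
  "ge2 w n \<longleftrightarrow> (\<exists>z i. emp w z \<and> mem w z i \<and> mem w z n \<and> mem w i n)"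

lemma ge2_mono: "ge2 v n \<Longrightarrow> v \<sqsubseteq> w \<Longrightarrow> ge2 w n"
  unfolding ge2_def using emp_mono mem_mono by blast

text \<open>Whether 2 is an element of n or equal to it, 2 is a subset of n, so its elements 0 and 1
  are available.\<close>

lemma ge2I:
  assumes "om w N" "mem w n N" "force (at_least_two 0) w (n \<cdot> e)"
  shows "ge2 w n"
proof -
  obtain t z i where t: "emp w z" "succ w i z" "succ w t i" "mem w t n \<or> eq w t n"
    using assms(3) by (auto simp: at_least_two_def is_two_def)
  have "mem w z i" "mem w i t" "mem w z t" using t unfolding succ_def sub_def by (meson le_refl)+
  moreover have "sub w t n" using t(4)
  proof
    assume "mem w t n"
    then show ?thesis using om_elem_sub assms by blast
  next
    assume "eq w t n"
    then show ?thesis using mem_eq_right eq_mono unfolding sub_def by blast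
  qed
  ultimately show ?thesis using t(1) unfolding ge2_def sub_def by (meson le_refl)
qed

lemma enum_upair:
  assumes N: "om w N" "mem w n N" and n: "ge2 w n" and a: "upair w a x y"
  shows "enum w n a"
proof -
  have E: "E w n" "E w x" "E w y" using N(2) upair_E[OF a] mem_E by blast+
  \<comment> \<open>The graph sends zero to \<open>x\<close> and each inhabited number to
    \<open>y\<close>; the two values may coincide.\<close>
  define P where "P = (\<lambda>v p i. emp v i \<and> opair v p i x \<or> (\<exists>j. mem v j i) \<and> opair v p i y)"
  let ?\<phi> = "(is_empty 1 \<^bold>\<and> is_pair 0 1 2) \<^bold>\<or> (BExists 1 (0 \<^bold>= 0) \<^bold>\<and> is_pair 0 1 3)"
  have \<phi>: "force ?\<phi> v (p \<cdot> i \<cdot> x \<cdot> (\<lambda>_. y)) \<longleftrightarrow> P v p i" for v p i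
    unfolding P_def by simp (meson eq_refl mem_E)
  have dec: "emp v i \<or> (\<exists>j. mem v j i)" if "w \<sqsubseteq> v" "mem v i n" for v i
  proof -
    have "om v N" "mem v i N"
      using that N om_mono om_sub[OF N] unfolding sub_def by blast+
    then show ?thesis unfolding succ_def by (rule om_cases) (auto simp: succ_def)
  qed
  \<comment> \<open>The fibre over \<open>i\<close> is a single pair, and \<open>dec\<close> settles
    which one.\<close>
  have "ISet v (\<lambda>u p. P u p i)" if v: "w \<sqsubseteq> v" "mem v i n" for v i
  proof -
    have Ev: "E v i" "E v x" "E v y" using v E E_mono mem_E by blast+
    from dec[OF v] show ?thesis
    proof
      assume e: "emp v i"
      have "P u p i \<longleftrightarrow> opair u p i x" if "v \<sqsubseteq> u" for u p
        using e emp_mono[OF e that] that le_refl unfolding P_def emp_def by blast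
      then show ?thesis using ISet_cong[OF ISet_opair[OF Ev(1,2)]] by simp
    next
      assume "\<exists>j. mem v j i"
      then have "P u p i \<longleftrightarrow> opair u p i y" if "v \<sqsubseteq> u" for u p
        using that mem_mono le_refl unfolding P_def emp_def by blast
      then show ?thesis using ISet_cong[OF ISet_opair[OF Ev(1,3)]] by simp
    qed
  qed
  then have "ISet w (\<lambda>v p. \<exists>i. mem v i n \<and> P v p i)"
    using ISet_UN[OF E(1), of "x \<cdot> (\<lambda>_. y)" ?\<phi>] E(2,3) unfolding \<phi> by (simp split: nat.split)
  then obtain f where f: "E w f" "\<And>v p. w \<sqsubseteq> v \<Longrightarrow> mem v p f \<longleftrightarrow> (\<exists>i. mem v i n \<and> P v p i)"
    by (rule ISetE) blast
  have am: "mem v x a" "mem v y a" "mem v t a \<longleftrightarrow> eq v t x \<or> eq v t y" if "w \<sqsubseteq> v" for v t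
    using a that mem_mono upair_mem unfolding upair_def by blast+
  have m: "maps v f i t \<longleftrightarrow> emp v i \<and> eq v t x \<or> (\<exists>j. mem v j i) \<and> eq v t y"
    if v: "w \<sqsubseteq> v" and i: "mem v i n" for v i t
  proof
    assume "maps v f i t"
    then obtain p i' where p: "opair v p i t" "P v p i'" using f(2)[OF v] unfolding maps_def by blast
    then have "emp v i' \<and> eq v i i' \<and> eq v t x \<or> (\<exists>j. mem v j i') \<and> eq v i i' \<and> eq v t y"
      using opair_inj unfolding P_def by blast
    then show "emp v i \<and> eq v t x \<or> (\<exists>j. mem v j i) \<and> eq v t y"
      using emp_cong eq_sym mem_eq_right by blast
  next
    assume *: "emp v i \<and> eq v t x \<or> (\<exists>j. mem v j i) \<and> eq v t y"
    then have "E v i" "E v t" using i eq_E mem_E by blast+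
    then obtain p where p: "opair v p i t" using opair_ex by blast
    have "eq v p p" "eq v i i" using p opair_E eq_refl by blast+
    then have "P v p i" using * opair_cong[OF p] unfolding P_def by blast
    then show "maps v f i t" using p f(2)[OF v] i unfolding maps_def by blast
  qed
  have "surj w f n a"
    unfolding surj_def func_def
  proof (intro HOL.conjI allI impI)
    fix v p assume v: "w \<sqsubseteq> v" and "mem v p f"
    then show "\<exists>i t. mem v i n \<and> mem v t a \<and> opair v p i t"
      using f(2)[OF v] am[OF v] unfolding P_def by blast
  next
    fix v i assume v: "w \<sqsubseteq> v" and i: "mem v i n"
    have xy: "eq v x x" "eq v y y" using E E_mono[OF _ v] eq_refl by blast+
    from dec[OF v i] show "\<exists>t. mem v t a \<and> maps v f i t \<and>
      (\<forall>u t'. v \<sqsubseteq> u \<longrightarrow> mem u t' a \<longrightarrow> maps u f i t' \<longrightarrow> eq u t' t)"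
    proof
      assume e: "emp v i"
      have "eq u t' x" if "v \<sqsubseteq> u" "maps u f i t'" for u t'
        using m[OF le_trans[OF v that(1)] mem_mono[OF i that(1)]] that e unfolding emp_def by blast
      then show ?thesis using e m[OF v i] xy am[OF v] by blast
    next
      assume e: "\<exists>j. mem v j i"
      have "eq u t' y" if "v \<sqsubseteq> u" "maps u f i t'" for u t'
        using m[OF le_trans[OF v that(1)] mem_mono[OF i that(1)]] that e mem_mono le_refl
        unfolding emp_def by blast
      then show ?thesis using e m[OF v i] xy am[OF v] by blast
    qed
  next
    fix v t assume v: "w \<sqsubseteq> v" and t: "mem v t a"
    have "ge2 v n" using n v ge2_mono by blast
    then obtain z i where "emp v z" "mem v z n" "mem v z i" "mem v i n" unfolding ge2_def by blast
    then show "\<exists>i. mem v i n \<and> maps v f i t" using t am[OF v] m[OF v] by blast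
  qed
  then show ?thesis using f(1) unfolding enum_def by blast
qed

end

section \<open>Finitely enumerable subsets\<close>

(* b = {k} \<times> S *)
definition is_fib :: "nat \<Rightarrow> nat \<Rightarrow> nat \<Rightarrow> fm" where
  "is_fib b k S = Forall (0 \<^bold>\<in> b + 1 \<^bold>\<longleftrightarrow> BExists (S + 1) (is_pair 1 (k + 2) 0))"

(* r = ({(j, x)}, {k} \<times> S) *)
definition is_step_rule :: "nat \<Rightarrow> nat \<Rightarrow> nat \<Rightarrow> nat \<Rightarrow> nat \<Rightarrow> fm" where
  "is_step_rule r j k x S = Exists (Exists (Exists (is_pair 2 (j + 3) (x + 3) \<^bold>\<and> is_upair 1 2 2 \<^bold>\<and>
    is_fib 0 (k + 3) (S + 3) \<^bold>\<and> is_pair (r + 3) 1 0)))"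

(* y is the set of all s in S such that (i, s) \<in> f for some i in k *)
definition is_image :: "nat \<Rightarrow> nat \<Rightarrow> nat \<Rightarrow> nat \<Rightarrow> fm" where
  "is_image y f k S =
    BForall y (0 \<^bold>\<in> S + 1 \<^bold>\<and> BExists (k + 1) (maps_to (f + 2) 0 1)) \<^bold>\<and>
    BForall S (BExists (k + 1) (maps_to (f + 2) 0 1) \<^bold>\<longrightarrow> 0 \<^bold>\<in> y + 1)"

context kripke
begin

definition fib :: "'w \<Rightarrow> 'd \<Rightarrow> 'd \<Rightarrow> 'd \<Rightarrow> bool" where
  "fib w b k S \<longleftrightarrow> (\<forall>v q. w \<sqsubseteq> v \<longrightarrow> mem v q b \<longleftrightarrow> (\<exists>s. mem v s S \<and> opair v q k s))"

definition step_rule :: "'w \<Rightarrow> 'd \<Rightarrow> 'd \<Rightarrow> 'd \<Rightarrow> 'd \<Rightarrow> 'd \<Rightarrow> bool" where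
  "step_rule w r j k x S \<longleftrightarrow>
    (\<exists>p a b. opair w p j x \<and> upair w a p p \<and> E w b \<and> fib w b k S \<and> opair w r a b)"

definition image :: "'w \<Rightarrow> 'd \<Rightarrow> 'd \<Rightarrow> 'd \<Rightarrow> 'd \<Rightarrow> bool" where
  "image w y f k S \<longleftrightarrow> (\<forall>v s. w \<sqsubseteq> v \<longrightarrow>
    mem v s y \<longleftrightarrow> mem v s S \<and> (\<exists>i. mem v i k \<and> maps v f i s))"

lemma force_is_fib [simp]: "force (is_fib b k S) w e \<longleftrightarrow> fib w (e b) (e k) (e S)"
  unfolding is_fib_def force.simps(7) force_Iff E_flatten fib_def
  by simp (meson mem_E opair_E)

lemma force_is_step_rule [simp]:
  "force (is_step_rule r j k x S) w e \<longleftrightarrow> step_rule w (e r) (e j) (e k) (e x) (e S)"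
  by (simp add: is_step_rule_def step_rule_def) (meson opair_E upair_E)

lemma force_is_image [simp]: "force (is_image y f k S) w e \<longleftrightarrow> image w (e y) (e f) (e k) (e S)"
proof -
  have "(\<forall>v. w \<sqsubseteq> v \<longrightarrow> (\<forall>s. mem v s Y \<longrightarrow> mem v s T \<and> (\<exists>i. mem v i K \<and> maps v g i s))) \<and>
    (\<forall>v. w \<sqsubseteq> v \<longrightarrow> (\<forall>s. mem v s T \<longrightarrow> (\<exists>i. mem v i K \<and> maps v g i s) \<longrightarrow> mem v s Y)) \<longleftrightarrow>
    image w Y g K T" for Y g K T
    unfolding image_def by blast
  then show ?thesis by (simp add: is_image_def)
qed

end

context ECST_model
begin

lemma ISet_unique:
  assumes "E w x" "\<And>v y. w \<sqsubseteq> v \<Longrightarrow> P v y \<longleftrightarrow> eq v y x"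
  shows "ISet w P"
  using ISet_cong[OF ISet_eq[OF assms(1)]] assms(2) by simp

text \<open>A rule with fixed parameters is a pair whose components are unique up to
  \<open>eq\<close>; this reduces its existence to that uniqueness.\<close>

lemma ISet_pair_unique:
  assumes "E w a" "E w b" "\<And>v x. w \<sqsubseteq> v \<Longrightarrow> P v x \<longleftrightarrow> eq v x a" "\<And>v y. w \<sqsubseteq> v \<Longrightarrow> Q v y \<longleftrightarrow> eq v y b"
  shows "ISet w (\<lambda>v r. \<exists>x y. P v x \<and> Q v y \<and> opair v r x y)"
proof -
  have "opair v r a b \<longleftrightarrow> (\<exists>x y. P v x \<and> Q v y \<and> opair v r x y)" if v: "w \<sqsubseteq> v" for v r
  proof -
    have "eq v a a" "eq v b b" using assms(1,2) E_mono[OF _ v] eq_refl by blast+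
    then show ?thesis
      using assms(3,4)[OF v] opair_cong[of v r _ _ r a b] opair_E eq_refl by blast
  qed
  then show ?thesis by (rule ISet_cong[OF ISet_opair[OF assms(1,2)]])
qed

lemma upair_iff_eq:
  assumes "upair w a x y" "w \<sqsubseteq> v"
  shows "upair v b x y \<longleftrightarrow> eq v b a"
proof -
  have "upair v a x y" using assms upair_mono by blast
  moreover from this have "eq v x x" "eq v y y" using upair_E eq_refl by blast+
  ultimately show ?thesis using upair_unique upair_cong eq_sym by blast
qed

lemma fib_iff_eq:
  assumes "E w a" "fib w a k S" "w \<sqsubseteq> v"
  shows "E v b \<and> fib v b k S \<longleftrightarrow> eq v b a"
proof
  assume b: "E v b \<and> fib v b k S"
  have "mem u z b \<longleftrightarrow> mem u z a" if "v \<sqsubseteq> u" for u z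
    using b assms(2) that le_trans[OF assms(3) that] unfolding fib_def by simp
  then show "eq v b a" using b E_mono[OF assms(1,3)] by (intro extI) auto
next
  assume eq: "eq v b a"
  have "mem u z b \<longleftrightarrow> (\<exists>s. mem u s S \<and> opair u z k s)" if "v \<sqsubseteq> u" for u z
    using mem_eq_right[OF eq_mono[OF eq that]] assms(2) le_trans[OF assms(3) that]
    unfolding fib_def by simp
  then show "E v b \<and> fib v b k S" using eq eq_E unfolding fib_def by blast
qed

lemma ISet_fib:
  assumes "E w k" "E w S"
  shows "ISet w (\<lambda>v q. \<exists>s. mem v s S \<and> opair v q k s)"
proof -
  have "ISet v (\<lambda>u q. opair u q k s)" if "w \<sqsubseteq> v" "mem v s S" for v s
    using that assms(1) E_mono mem_E by (intro ISet_opair) blast+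
  then show ?thesis using ISet_UN[OF assms(2), of "\<lambda>_. k" "is_pair 0 2 1"] assms(1) by simp
qed

lemma fib_ex:
  assumes "E w k" "E w S"
  obtains b where "E w b" "fib w b k S"
  using ISet_fib[OF assms] unfolding fib_def by (rule ISetE) blast

lemma ISet_prod:
  assumes "E w N" "E w S"
  shows "ISet w (\<lambda>v q. \<exists>k. mem v k N \<and> (\<exists>s. mem v s S \<and> opair v q k s))"
proof -
  have "ISet v (\<lambda>u q. \<exists>s. mem u s S \<and> opair u q k s)" if "w \<sqsubseteq> v" "mem v k N" for v k
    using that assms E_mono mem_E by (intro ISet_fib) blast+
  then show ?thesis using ISet_UN[OF assms(1), of "\<lambda>_. S" "BExists 2 (is_pair 1 2 0)"] assms(2) by simp
qed

lemma step_rule_ex: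
  assumes "E w j" "E w k" "E w x" "E w S"
  obtains r where "step_rule w r j k x S"
proof -
  obtain p where p: "opair w p j x" using opair_ex assms by blast
  then obtain a where a: "upair w a p p" using upair_ex opair_E by blast
  obtain b where b: "E w b" "fib w b k S" using fib_ex assms by blast
  obtain r where "opair w r a b" using opair_ex[of w a b] upair_E[OF a] b(1) by blast
  then show thesis using that p a b unfolding step_rule_def by blast
qed

lemma ISet_step_rule:
  assumes "E w j" "E w k" "E w x" "E w S"
  shows "ISet w (\<lambda>v r. step_rule v r j k x S)"
proof -
  obtain p where p: "opair w p j x" using opair_ex assms by blast
  then obtain a where a: "upair w a p p" using upair_ex opair_E by blast
  obtain b where b: "E w b" "fib w b k S" using fib_ex assms by blast
  have A: "(\<exists>p. opair v p j x \<and> upair v a' p p) \<longleftrightarrow> eq v a' a" if "w \<sqsubseteq> v" for v a'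
  proof -
    have "opair v p j x" using p that opair_mono by blast
    moreover have "upair v a' p p" if "opair v q j x" "upair v a' q q" for q
    proof -
      have "eq v q p" "eq v a' a'"
        using opair_unique[OF that(1) calculation] upair_E[OF that(2)] eq_refl by blast+
      then show ?thesis using upair_cong[OF that(2)] by blast
    qed
    ultimately show ?thesis using upair_iff_eq[OF a that] by blast
  qed
  have "E w a" using a upair_E by blast
  have "ISet w (\<lambda>v r. \<exists>a' b'. (\<exists>p. opair v p j x \<and> upair v a' p p) \<and> (E v b' \<and> fib v b' k S) \<and> opair v r a' b')"
    using ISet_pair_unique[OF \<open>E w a\<close> b(1) A fib_iff_eq[OF b]] .
  then show ?thesis unfolding step_rule_def by (rule ISet_cong) blast
qed

lemma ISet_step_rules:
  assumes "E w N" "E w S"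
  shows "ISet w (\<lambda>v r. \<exists>j. mem v j N \<and> (\<exists>k. mem v k j \<and> (\<exists>x. mem v x S \<and> step_rule v r j k x S)))"
proof -
  have 1: "ISet v (\<lambda>v r. \<exists>x. mem v x S \<and> step_rule v r j k x S)"
    if "w \<sqsubseteq> v" "E v j" "E v k" for v j k
  proof -
    have "E v S" using that assms E_mono by blast
    have "ISet u (\<lambda>v r. step_rule v r j k x S)" if "v \<sqsubseteq> u" "mem u x S" for u x
      using that \<open>E v j\<close> \<open>E v k\<close> mem_E E_mono by (intro ISet_step_rule) blast+
    then show ?thesis
      using ISet_UN[OF \<open>E v S\<close>, of "j \<cdot> k \<cdot> (\<lambda>_. S)" "is_step_rule 0 2 3 1 4"] that \<open>E v S\<close>
      by (simp split: nat.split)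
  qed
  have 2: "ISet v (\<lambda>v r. \<exists>k. mem v k j \<and> (\<exists>x. mem v x S \<and> step_rule v r j k x S))"
    if v: "w \<sqsubseteq> v" "mem v j N" for v j
  proof -
    have E: "E v j" "E v S" using v assms E_mono mem_E by blast+
    have "ISet u (\<lambda>v r. \<exists>x. mem v x S \<and> step_rule v r j k x S)" if "v \<sqsubseteq> u" "mem u k j" for u k
      using that v E mem_E E_mono le_trans by (intro 1) blast+
    then show ?thesis
      using ISet_UN[OF \<open>E v j\<close>, of "j \<cdot> (\<lambda>_. S)" "BExists 3 (is_step_rule 1 3 2 0 4)"] E
      by (simp split: nat.split)
  qed
  show ?thesis
    using ISet_UN[OF \<open>E w N\<close>, of "\<lambda>_. S" "BExists 1 (BExists 3 (is_step_rule 2 3 1 0 4))"] assms 2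
    by simp
qed

lemma image_ex:
  assumes "E w f" "E w k" "E w S"
  obtains y where "E w y" "image w y f k S"
proof -
  have "restricted (BExists 1 (maps_to 3 0 1))"
    unfolding maps_to_def is_pair_def is_upair_def by (intro restricted.intros)
  then have "ISet w (\<lambda>v s. mem v s S \<and> force (BExists 1 (maps_to 3 0 1)) v (s \<cdot> k \<cdot> (\<lambda>_. f)))"
    using assms by (intro ISet_sep ISet_mem) (auto split: nat.split)
  then obtain y where "E w y" "\<And>v s. w \<sqsubseteq> v \<Longrightarrow> mem v s y \<longleftrightarrow> mem v s S \<and> (\<exists>i. mem v i k \<and> maps v f i s)"
    by (rule ISetE) simp
  then show thesis using that unfolding image_def by blast
qed

text \<open>By extensionality the class is the singleton of \<open>a\<close>. In this form images
  and traces can be collected by \<open>ISet_UN\<close>.\<close>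

lemma ISet_the:
  assumes "E w a" "\<And>v x. w \<sqsubseteq> v \<Longrightarrow> mem v x a \<longleftrightarrow> P v x"
  shows "ISet w (\<lambda>v b. E v b \<and> (\<forall>u x. v \<sqsubseteq> u \<longrightarrow> mem u x b \<longleftrightarrow> P u x))"
proof (rule ISet_unique[OF assms(1)])
  fix v b assume v: "w \<sqsubseteq> v"
  show "E v b \<and> (\<forall>u x. v \<sqsubseteq> u \<longrightarrow> mem u x b \<longleftrightarrow> P u x) \<longleftrightarrow> eq v b a"
  proof
    assume "E v b \<and> (\<forall>u x. v \<sqsubseteq> u \<longrightarrow> mem u x b \<longleftrightarrow> P u x)"
    then show "eq v b a"
      using assms(2) le_trans[OF v] E_mono[OF assms(1) v] by (intro extI) auto
  next
    assume eq: "eq v b a"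
    then have "mem u x b \<longleftrightarrow> mem u x a" if "v \<sqsubseteq> u" for u x
      using that mem_eq_right eq_mono by blast
    then show "E v b \<and> (\<forall>u x. v \<sqsubseteq> u \<longrightarrow> mem u x b \<longleftrightarrow> P u x)"
      using eq eq_E assms(2) le_trans[OF v] by blast
  qed
qed

lemma ISet_image:
  assumes "E w f" "E w k" "E w S"
  shows "ISet w (\<lambda>v y. E v y \<and> image v y f k S)"
proof -
  obtain y where "E w y" "image w y f k S" using image_ex assms by blast
  then show ?thesis unfolding image_def by (intro ISet_the) blast+
qed

lemma ISet_images:
  assumes "E w G" "E w N" "E w S"
  shows "ISet w (\<lambda>v y. \<exists>f. mem v f G \<and> (\<exists>k. mem v k N \<and> E v y \<and> image v y f k S))"
proof -
  have "ISet v (\<lambda>v y. \<exists>k. mem v k N \<and> E v y \<and> image v y f k S)" if v: "w \<sqsubseteq> v" "mem v f G" for v f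
  proof -
    have E: "E v f" "E v N" "E v S" using v assms E_mono mem_E by blast+
    have "ISet u (\<lambda>v y. E v y \<and> image v y f k S)" if "v \<sqsubseteq> u" "mem u k N" for u k
      using that E mem_E E_mono by (intro ISet_image) blast+
    then show ?thesis
      using ISet_UN[OF \<open>E v N\<close>, of "f \<cdot> (\<lambda>_. S)" "0 \<^bold>= 0 \<^bold>\<and> is_image 0 2 1 3"] E
      by (simp split: nat.split add: eq_refl_iff)
  qed
  then show ?thesis
    using ISet_UN[OF \<open>E w G\<close>, of "N \<cdot> (\<lambda>_. S)" "BExists 2 (1 \<^bold>= 1 \<^bold>\<and> is_image 1 2 0 4)"] assms
    by (simp split: nat.split add: eq_refl_iff)
qed

section \<open>Relations with down-closed domain, finite sequences and their images\<close>

definition step_closed :: "'w \<Rightarrow> 'd \<Rightarrow> 'd \<Rightarrow> 'd \<Rightarrow> bool" where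
  "step_closed w g N S \<longleftrightarrow> (\<forall>v j k x. w \<sqsubseteq> v \<longrightarrow> mem v j N \<longrightarrow> mem v k j \<longrightarrow> mem v x S \<longrightarrow>
    maps v g j x \<longrightarrow> (\<exists>s. mem v s S \<and> maps v g k s))"

definition in_prod :: "'w \<Rightarrow> 'd \<Rightarrow> 'd \<Rightarrow> 'd \<Rightarrow> bool" where
  "in_prod w g N S \<longleftrightarrow> (\<forall>v p. w \<sqsubseteq> v \<longrightarrow> mem v p g \<longrightarrow> (\<exists>i s. mem v i N \<and> mem v s S \<and> opair v p i s))"

lemma in_prod_maps: "in_prod w g N S \<Longrightarrow> w \<sqsubseteq> v \<Longrightarrow> maps v g i s \<Longrightarrow> mem v i N \<and> mem v s S"
  unfolding maps_def in_prod_def using opair_inj mem_eq_left by blast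

text \<open>The conclusion {k} x S of a step rule asks for some value at k without prescribing it,
  so closure under these rules amounts to \<open>step_closed\<close>. The rest verifies that they
  are n-ary rules on \<omega> x S.\<close>

lemma down_closed_relations:
  assumes N: "om w N" and n: "mem w n N" "ge2 w n" and nid: "nid (\<lambda>v. enum v n) w" and S: "E w S"
  obtains G where "E w G"
    "\<And>v g. w \<sqsubseteq> v \<Longrightarrow> mem v g G \<Longrightarrow> in_prod v g N S \<and> step_closed v g N S"
    "\<And>v g p. w \<sqsubseteq> v \<Longrightarrow> E v g \<Longrightarrow> in_prod v g N S \<Longrightarrow> step_closed v g N S \<Longrightarrow> mem v p g \<Longrightarrow>
      \<exists>h. mem v h G \<and> mem v p h \<and> sub v h g"
proof -
  have EN: "E w N" using n(1) mem_E by blast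
  obtain T where T: "E w T"
    "\<And>v q. w \<sqsubseteq> v \<Longrightarrow> mem v q T \<longleftrightarrow> (\<exists>k. mem v k N \<and> (\<exists>s. mem v s S \<and> opair v q k s))"
    using ISet_prod[OF EN S] by (rule ISetE) blast
  obtain R where R: "E w R" "\<And>v r. w \<sqsubseteq> v \<Longrightarrow> mem v r R \<longleftrightarrow>
      (\<exists>j. mem v j N \<and> (\<exists>k. mem v k j \<and> (\<exists>x. mem v x S \<and> step_rule v r j k x S)))"
    using ISet_step_rules[OF EN S] by (rule ISetE) blast
  \<comment> \<open>Transitivity of \<omega> keeps the conclusions {k} x S inside
    \<open>T\<close>.\<close>
  have subN: "mem v k N" if "w \<sqsubseteq> v" "mem v j N" "mem v k j" for v j k
    using om_sub[OF om_mono[OF N that(1)] that(2)] that(3) le_refl unfolding sub_def by blast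
  have "rules (\<lambda>v. enum v n) w R T"
    unfolding rules_def
  proof (intro allI impI)
    fix v r assume v: "w \<sqsubseteq> v" and "mem v r R"
    then obtain j k x p a b where j: "mem v j N" "mem v k j" "mem v x S"
      and r: "opair v p j x" "upair v a p p" "fib v b k S" "opair v r a b"
      unfolding R(2)[OF v] step_rule_def by blast
    have "mem v p T" using j r(1) T(2)[OF v] by blast
    have "sub v a T"
      unfolding sub_def
    proof (intro allI impI)
      fix u q assume u: "v \<sqsubseteq> u" "mem u q a"
      then have "eq u q p" using upair_mem[OF r(2)] by blast
      then show "mem u q T" using mem_eq_left mem_mono[OF \<open>mem v p T\<close> u(1)] by blast
    qed
    moreover have "sub v b T"
      unfolding sub_def
    proof (intro allI impI)
      fix u q assume u: "v \<sqsubseteq> u" "mem u q b"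
      then obtain s where "mem u s S" "opair u q k s" using r(3) unfolding fib_def by blast
      moreover have "mem u k N" using subN[OF v j(1,2)] mem_mono u(1) by blast
      ultimately show "mem u q T" using T(2)[OF le_trans[OF v u(1)]] by blast
    qed
    moreover have "enum v n a"
      using enum_upair[OF om_mono[OF N v] mem_mono[OF n(1) v] ge2_mono[OF n(2) v] r(2)] .
    ultimately show "\<exists>a b. opair v r a b \<and> sub v a T \<and> sub v b T \<and> enum v n a" using r(4) by blast
  qed
  then obtain G where G: "E w G" "\<And>v x. w \<sqsubseteq> v \<Longrightarrow> mem v x G \<Longrightarrow> csub v x T R"
    "\<And>v x s. w \<sqsubseteq> v \<Longrightarrow> E v x \<Longrightarrow> csub v x T R \<Longrightarrow> mem v s x \<Longrightarrow> \<exists>y. mem v y G \<and> mem v s y \<and> sub v y x"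
    using nid T(1) R(1) le_refl unfolding nid_def setgen_def by blast
  have sub_iff: "sub v g T \<longleftrightarrow> in_prod v g N S" if v: "w \<sqsubseteq> v" for v g
    using T(2)[OF le_trans[OF v]] unfolding sub_def in_prod_def by blast
  have closed: "closed v g R" if v: "w \<sqsubseteq> v" and g: "step_closed v g N S" for v g
    unfolding closed_def
  proof (intro allI impI)
    fix u r a b
    assume u: "v \<sqsubseteq> u" "mem u r R" "opair u r a b" "sub u a g"
    then obtain j k x p a' b' where j: "mem u j N" "mem u k j" "mem u x S"
      and r: "opair u p j x" "upair u a' p p" "fib u b' k S" "opair u r a' b'"
      unfolding R(2)[OF le_trans[OF v u(1)]] step_rule_def by blast
    have eq: "eq u a a'" "eq u b b'" using opair_inj[OF u(3) r(4)] by blast+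
    have "mem u p a" using r(2) mem_eq_right[OF eq(1)] unfolding upair_def by blast
    then have "mem u p g" using u(4) le_refl unfolding sub_def by blast
    then obtain s where s: "mem u s S" "maps u g k s"
      using g u(1) j r(1) unfolding step_closed_def maps_def by blast
    then obtain q where q: "mem u q g" "opair u q k s" unfolding maps_def by blast
    then have "mem u q b'" using r(3) s(1) le_refl unfolding fib_def by blast
    then have "mem u q b" using mem_eq_right[OF eq(2)] by blast
    then show "meet u b g" using q(1) unfolding meet_def by blast
  qed
  have step: "step_closed v g N S" if v: "w \<sqsubseteq> v" and g: "closed v g R" for v g
    unfolding step_closed_def
  proof (intro allI impI)
    fix u j k x
    assume u: "v \<sqsubseteq> u" and j: "mem u j N" "mem u k j" "mem u x S" and m: "maps u g j x"
    have wu: "w \<sqsubseteq> u" using v u le_trans by blast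
    obtain p where p: "mem u p g" "opair u p j x" using m unfolding maps_def by blast
    have "E u j" "E u k" "E u x" "E u S" using j mem_E by blast+
    then obtain r where r: "step_rule u r j k x S" by (rule step_rule_ex)
    then obtain p' a b where ab: "opair u p' j x" "upair u a p' p'" "fib u b k S" "opair u r a b"
      unfolding step_rule_def by blast
    have "mem u r R" using R(2)[OF wu] j r by blast
    moreover have "sub u a g"
      unfolding sub_def
    proof (intro allI impI)
      fix t q assume t: "u \<sqsubseteq> t" "mem t q a"
      then have "eq t q p'" using upair_mem[OF ab(2)] by blast
      then have "eq t q p" using opair_unique[OF ab(1) p(2)] eq_mono t(1) eq_trans by blast
      then show "mem t q g" using mem_eq_left mem_mono[OF p(1) t(1)] by blast
    qed
    ultimately have "meet u b g" using g u ab(4) unfolding closed_def by blast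
    then obtain q where q: "mem u q b" "mem u q g" unfolding meet_def by blast
    then obtain s where "mem u s S" "opair u q k s" using ab(3) le_refl unfolding fib_def by blast
    then show "\<exists>s. mem u s S \<and> maps u g k s" using q(2) unfolding maps_def by blast
  qed
  show thesis
  proof (rule that[OF G(1)])
    show "in_prod v g N S \<and> step_closed v g N S" if "w \<sqsubseteq> v" "mem v g G" for v g
      using G(2)[OF that] sub_iff[OF that(1)] step[OF that(1)] unfolding csub_def by blast
    show "\<exists>h. mem v h G \<and> mem v p h \<and> sub v h g"
      if "w \<sqsubseteq> v" "E v g" "in_prod v g N S" "step_closed v g N S" "mem v p g" for v g p
      using G(3)[OF that(1,2) _ that(5)] sub_iff[OF that(1)] closed[OF that(1)] that(3,4)
      unfolding csub_def by blast
  qed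
qed

text \<open>The domain is the successor of \<open>m\<close>. Indexing by the last argument supplies
  the pair (m, g(m)) from which the generating set is queried; the empty sequence offers no such
  pair and is left out.\<close>

definition fin_seq :: "'w \<Rightarrow> 'd \<Rightarrow> 'd \<Rightarrow> 'd \<Rightarrow> 'd \<Rightarrow> bool" where
  "fin_seq w g m N S \<longleftrightarrow> mem w m N \<and> in_prod w g N S \<and>
    (\<forall>v i s. w \<sqsubseteq> v \<longrightarrow> maps v g i s \<longrightarrow> mem v i m \<or> eq v i m) \<and>
    (\<forall>v i. w \<sqsubseteq> v \<longrightarrow> mem v i m \<or> eq v i m \<longrightarrow> (\<exists>s. maps v g i s)) \<and>
    (\<forall>v i s t. w \<sqsubseteq> v \<longrightarrow> maps v g i s \<longrightarrow> maps v g i t \<longrightarrow> eq v s t)"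

(* A member h of the generating set with (m, g m) \<in> h \<subseteq> g has the whole domain of g, so h = g. *)
lemma finite_sequences:
  assumes N: "om w N" and n: "mem w n N" "ge2 w n" and nid: "nid (\<lambda>v. enum v n) w" and S: "E w S"
  obtains G where "E w G"
    "\<And>v g m. w \<sqsubseteq> v \<Longrightarrow> E v g \<Longrightarrow> fin_seq v g m N S \<Longrightarrow> \<exists>h. mem v h G \<and> eq v h g"
proof -
  obtain G where G: "E w G"
    "\<And>v g. w \<sqsubseteq> v \<Longrightarrow> mem v g G \<Longrightarrow> in_prod v g N S \<and> step_closed v g N S"
    "\<And>v g p. w \<sqsubseteq> v \<Longrightarrow> E v g \<Longrightarrow> in_prod v g N S \<Longrightarrow> step_closed v g N S \<Longrightarrow> mem v p g \<Longrightarrow>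
      \<exists>h. mem v h G \<and> mem v p h \<and> sub v h g"
    using down_closed_relations[OF assms] by blast
  show thesis
  proof (rule that[OF G(1)])
    fix v g m assume v: "w \<sqsubseteq> v" and g: "E v g" "fin_seq v g m N S"
    have m: "mem v m N" and prod: "in_prod v g N S"
      and dom: "\<And>u i s. v \<sqsubseteq> u \<Longrightarrow> maps u g i s \<Longrightarrow> mem u i m \<or> eq u i m"
      and tot: "\<And>u i. v \<sqsubseteq> u \<Longrightarrow> mem u i m \<or> eq u i m \<Longrightarrow> \<exists>s. maps u g i s"
      and uniq: "\<And>u i s t. v \<sqsubseteq> u \<Longrightarrow> maps u g i s \<Longrightarrow> maps u g i t \<Longrightarrow> eq u s t"
      using g(2) unfolding fin_seq_def by blast+
    have "step_closed v g N S"
      unfolding step_closed_def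
    proof (intro allI impI)
      fix u j k x assume u: "v \<sqsubseteq> u" and j: "mem u j N" "mem u k j" "maps u g j x"
      have "mem u k m" using dom[OF u j(3)]
      proof
        assume "mem u j m"
        then have "sub u j m"
          using om_elem_sub[OF om_mono[OF N le_trans[OF v u]] mem_mono[OF m u]] by blast
        then show ?thesis using j(2) le_refl unfolding sub_def by blast
      next
        assume "eq u j m"
        then show ?thesis using j(2) mem_eq_right by blast
      qed
      then obtain s where "maps u g k s" using tot[OF u] by blast
      then show "\<exists>s. mem u s S \<and> maps u g k s" using in_prod_maps[OF prod u] by blast
    qed
    moreover have "eq v m m" using m mem_E eq_refl by blast
    then obtain s where s: "maps v g m s" using tot[OF le_refl] by blast
    then obtain p where p: "mem v p g" "opair v p m s" unfolding maps_def by blast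
    ultimately obtain h where h: "mem v h G" "mem v p h" "sub v h g"
      using G(3)[OF v g(1) prod] by blast
    have hs: "step_closed v h N S" using G(2)[OF v h(1)] by blast
    have hm: "maps v h m s" using h(2) p(2) unfolding maps_def by blast
    have htot: "\<exists>t. maps u h i t" if u: "v \<sqsubseteq> u" and i: "mem u i m \<or> eq u i m" for u i
      using i
    proof
      assume "mem u i m"
      moreover have "mem u s S" "mem u m N"
        using in_prod_maps[OF prod le_refl s] u mem_mono by blast+
      ultimately show ?thesis using hs u maps_mono[OF hm u] unfolding step_closed_def by blast
    next
      assume *: "eq u i m"
      have "eq u h h" "eq u s s" using maps_E[OF maps_mono[OF hm u]] eq_refl by blast+
      then show ?thesis using maps_cong[OF maps_mono[OF hm u]] eq_sym[OF *] by blast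
    qed
    have "mem u q h \<longleftrightarrow> mem u q g" if u: "v \<sqsubseteq> u" for u q
    proof
      assume "mem u q h"
      then show "mem u q g" using h(3) u unfolding sub_def by blast
    next
      assume q: "mem u q g"
      then obtain i t where it: "opair u q i t" using prod u unfolding in_prod_def by blast
      then have gi: "maps u g i t" using q unfolding maps_def by blast
      then obtain t' q' where q': "mem u q' h" "opair u q' i t'"
        using htot[OF u dom[OF u gi]] unfolding maps_def by blast
      \<comment> \<open>The value found in \<open>h\<close> is also a value of \<open>g\<close>, and
        \<open>g\<close> is single-valued.\<close>
      then have "maps u g i t'" using h(3) u unfolding sub_def maps_def by blast
      then have "eq u t t'" using uniq[OF u gi] by blast
      moreover have "eq u q q" "eq u i i" using it opair_E eq_refl by blast+
      ultimately have "opair u q i t'" using opair_cong[OF it] by blast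
      then have "eq u q q'" using opair_unique q'(2) by blast
      then show "mem u q h" using q'(1) mem_eq_left by blast
    qed
    then have "eq v h g" using g(1) h(1) mem_E by (intro extI) blast+
    then show "\<exists>h. mem v h G \<and> eq v h g" using h(1) by blast
  qed
qed

lemma surj_maps:
  assumes "surj w f m a" "w \<sqsubseteq> v" "maps v f i s"
  shows "mem v i m" "mem v s a"
proof -
  obtain p where "mem v p f" "opair v p i s" using assms(3) unfolding maps_def by blast
  moreover from this obtain i' s' where "mem v i' m" "mem v s' a" "opair v p i' s'"
    using assms(1,2) unfolding surj_def func_def by blast
  ultimately show "mem v i m" "mem v s a" using opair_inj mem_eq_left by blast+
qed

lemma surj_unique:
  assumes "surj w f m a" "w \<sqsubseteq> v" "maps v f i s" "maps v f i t"
  shows "eq v s t"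
proof -
  obtain y where "\<And>u z. v \<sqsubseteq> u \<Longrightarrow> mem u z a \<Longrightarrow> maps u f i z \<Longrightarrow> eq u z y"
    using assms(1,2) surj_maps(1)[OF assms(1-3)] unfolding surj_def func_def by blast
  then have "eq v s y" "eq v t y"
    using surj_maps(2)[OF assms(1,2)] assms(3,4) le_refl by blast+
  then show ?thesis using eq_sym eq_trans by blast
qed

lemma surj_total: "surj w f m a \<Longrightarrow> w \<sqsubseteq> v \<Longrightarrow> mem v i m \<Longrightarrow> \<exists>s. maps v f i s"
  unfolding surj_def func_def by blast

lemma surj_onto: "surj w f m a \<Longrightarrow> w \<sqsubseteq> v \<Longrightarrow> mem v s a \<Longrightarrow> \<exists>i. mem v i m \<and> maps v f i s"
  unfolding surj_def by blast

lemma fin_seq_surj: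
  assumes "om w N" "mem w m N" "succ w m' m" "surj w f m' a" "sub w a S"
  shows "fin_seq w f m N S"
proof -
  have *: "mem v i m' \<longleftrightarrow> mem v i m \<or> eq v i m" if "w \<sqsubseteq> v" for v i
    using succ_mem[OF assms(3) that] .
  have "mem v i N" if "w \<sqsubseteq> v" "mem v i m'" for v i
    using *[OF that(1), of i] that om_sub[OF assms(1,2)] mem_mono[OF assms(2) that(1)] mem_eq_left
    unfolding sub_def by blast
  then have "in_prod w f N S"
    using assms(4,5) unfolding in_prod_def surj_def func_def sub_def by blast
  then show ?thesis
    unfolding fin_seq_def
    using * surj_maps(1)[OF assms(4)] surj_total[OF assms(4)] surj_unique[OF assms(4)] assms(2)
    by blast
qed

lemma fin_seq_single:
  assumes "om w N" "mem w z N" "emp w z" "mem w x S"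
  obtains g where "E w g" "fin_seq w g z N S"
    "\<And>v i s. w \<sqsubseteq> v \<Longrightarrow> maps v g i s \<longleftrightarrow> eq v i z \<and> eq v s x"
proof -
  obtain p where p: "opair w p z x" using opair_ex assms mem_E by blast
  then obtain g where g: "upair w g p p" using upair_ex opair_E by blast
  have m: "maps v g i s \<longleftrightarrow> eq v i z \<and> eq v s x" if v: "w \<sqsubseteq> v" for v i s
  proof
    assume "maps v g i s"
    then obtain q where q: "mem v q g" "opair v q i s" unfolding maps_def by blast
    then have "eq v q p" using upair_mem[OF g v] by blast
    moreover have "eq v i i" "eq v s s" using q(2) opair_E eq_refl by blast+
    ultimately have "opair v p i s" using opair_cong[OF q(2)] by blast
    then show "eq v i z \<and> eq v s x" using opair_inj opair_mono[OF p v] by blast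
  next
    assume *: "eq v i z \<and> eq v s x"
    have "opair v p z x" using opair_mono[OF p v] .
    moreover have "eq v p p" using calculation opair_E eq_refl by blast
    ultimately have "opair v p i s" using * opair_cong eq_sym by blast
    moreover have "mem v p g" using upair_mono[OF g v] unfolding upair_def by blast
    ultimately show "maps v g i s" unfolding maps_def by blast
  qed
  have "in_prod w g N S"
    unfolding in_prod_def
  proof (intro allI impI)
    fix v q assume v: "w \<sqsubseteq> v" and "mem v q g"
    then have "eq v q p" using upair_mem[OF g v] by blast
    moreover have "opair v p z x" using opair_mono[OF p v] .
    moreover have "eq v z z" "eq v x x" using calculation opair_E eq_refl by blast+
    ultimately have "opair v q z x" using opair_cong eq_sym by blast
    then show "\<exists>i s. mem v i N \<and> mem v s S \<and> opair v q i s" using assms(2,4) mem_mono[OF _ v] by blast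
  qed
  moreover have "\<exists>s. maps v g i s" if "w \<sqsubseteq> v" "mem v i z \<or> eq v i z" for v i
  proof -
    have "eq v x x" using assms(4) that(1) mem_mono mem_E eq_refl by blast
    then show ?thesis using m[OF that(1)] that assms(3) unfolding emp_def by blast
  qed
  moreover have "eq v s t" if "w \<sqsubseteq> v" "maps v g i s" "maps v g i t" for v i s t
    using that m eq_sym eq_trans by blast
  moreover have "eq v i z" if "w \<sqsubseteq> v" "maps v g i s" for v i s
    using that m by blast
  ultimately have "fin_seq w g z N S"
    unfolding fin_seq_def using assms(2) by blast
  then show thesis using that m g upair_E by blast
qed

text \<open>\<open>F\<close> consists of the images of all k in \<omega> under members of
  \<open>G\<close>, not only of whole domains. Proper initial segments give the intermediate stages
  of the induction in \<open>nid_finenum\<close>, without any restriction of the sequence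
  itself.\<close>

lemma finite_subsets:
  assumes N: "om w N" and n: "mem w n N" "ge2 w n" and nid: "nid (\<lambda>v. enum v n) w" and S: "E w S"
  obtains F where "E w F" "\<And>v y. w \<sqsubseteq> v \<Longrightarrow> mem v y F \<Longrightarrow> sub v y S"
    "\<And>v x y. w \<sqsubseteq> v \<Longrightarrow> mem v x S \<Longrightarrow> E v y \<Longrightarrow> emp v y \<Longrightarrow> mem v y F"
    "\<And>v x y. w \<sqsubseteq> v \<Longrightarrow> mem v x S \<Longrightarrow> upair v y x x \<Longrightarrow> mem v y F"
    "\<And>v m m' f a k y. w \<sqsubseteq> v \<Longrightarrow> mem v m N \<Longrightarrow> succ v m' m \<Longrightarrow> E v f \<Longrightarrow> surj v f m' a \<Longrightarrow>
      sub v a S \<Longrightarrow> mem v k N \<Longrightarrow> E v y \<Longrightarrow> image v y f k S \<Longrightarrow> mem v y F"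
proof -
  have EN: "E w N" using n(1) mem_E by blast
  obtain G where G: "E w G"
    "\<And>v g m. w \<sqsubseteq> v \<Longrightarrow> E v g \<Longrightarrow> fin_seq v g m N S \<Longrightarrow> \<exists>h. mem v h G \<and> eq v h g"
    using finite_sequences[OF assms] by blast
  obtain F where F: "E w F" "\<And>v y. w \<sqsubseteq> v \<Longrightarrow>
      mem v y F \<longleftrightarrow> (\<exists>g. mem v g G \<and> (\<exists>k. mem v k N \<and> E v y \<and> image v y g k S))"
    using ISet_images[OF G(1) EN S] by (rule ISetE) blast
  have img: "mem v y F"
    if v: "w \<sqsubseteq> v" and g: "E v g" "fin_seq v g m N S" and k: "mem v k N" and y: "E v y" "image v y g k S"
    for v g m k y
  proof -
    obtain h where h: "mem v h G" "eq v h g" using G(2)[OF v g] by blast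
    have "maps u g i s \<longleftrightarrow> maps u h i s" if "v \<sqsubseteq> u" for u i s
      using maps_cong[of u _ i s _ i s] eq_mono[OF h(2) that] maps_E eq_refl eq_sym by blast
    then have "image v y h k S" using y(2) unfolding image_def by simp
    then show ?thesis using F(2)[OF v] h(1) k y(1) by blast
  qed
  have sing: "\<exists>g z. E v g \<and> mem v z N \<and> emp v z \<and> fin_seq v g z N S \<and>
      (\<forall>u i s. v \<sqsubseteq> u \<longrightarrow> maps u g i s \<longleftrightarrow> eq u i z \<and> eq u s x)"
    if v: "w \<sqsubseteq> v" and x: "mem v x S" for v x
  proof -
    have "om v N" using om_mono[OF N v] .
    moreover from this obtain z where "mem v z N" "emp v z" unfolding om_def ind_def by blast
    ultimately show ?thesis using x by (metis fin_seq_single)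
  qed
  show thesis
  proof (rule that[OF F(1)])
    show "sub v y S" if "w \<sqsubseteq> v" "mem v y F" for v y
      using that F(2) unfolding image_def sub_def by blast
    show "mem v y F" if v: "w \<sqsubseteq> v" and x: "mem v x S" and y: "E v y" "emp v y" for v x y
    proof -
      obtain g z where g: "E v g" "fin_seq v g z N S" and z: "mem v z N" "emp v z"
        using sing[OF v x] by blast
      \<comment> \<open>The empty set is the image of 0 under a sequence of length one, in place of
        the missing empty sequence.\<close>
      have "image v y g z S" using y(2) z(2) unfolding image_def emp_def by blast
      then show ?thesis using img[OF v g z(1) y(1)] by blast
    qed
    show "mem v y F" if v: "w \<sqsubseteq> v" and x: "mem v x S" and y: "upair v y x x" for v x y
    proof -
      obtain g z where g: "E v g" "fin_seq v g z N S" and z: "mem v z N" "emp v z"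
        and m: "\<And>u i s. v \<sqsubseteq> u \<Longrightarrow> maps u g i s \<longleftrightarrow> eq u i z \<and> eq u s x"
        using sing[OF v x] by blast
      \<comment> \<open>Here \<open>k\<close> is 1, the full domain of the sequence with the only
        value \<open>x\<close>.\<close>
      obtain k where k: "mem v k N" "succ v k z"
        using om_mono[OF N v] z(1) le_refl unfolding om_def ind_def by blast
      have "mem u s y \<longleftrightarrow> mem u s S \<and> (\<exists>i. mem u i k \<and> maps u g i s)" if u: "v \<sqsubseteq> u" for u s
      proof -
        have "mem u z k" using k(2) u mem_mono unfolding succ_def by blast
        moreover have "eq u z z" using calculation mem_E eq_refl by blast
        ultimately show ?thesis
          using upair_mem[OF y u] m[OF u] mem_mono[OF x u] mem_eq_left eq_sym by blast
      qed
      then have "image v y g k S" unfolding image_def by blast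
      then show ?thesis using img[OF v g k(1)] y upair_E by blast
    qed
    show "mem v y F"
      if "w \<sqsubseteq> v" "mem v m N" "succ v m' m" "E v f" "surj v f m' a" "sub v a S" "mem v k N" "E v y"
        "image v y f k S" for v m m' f a k y
      using img[OF that(1,4) fin_seq_surj[OF om_mono[OF N that(1)] that(2,3,5,6)] that(7-9)] .
  qed
qed

end

section \<open>From n-ary to finitary rules\<close>

(* y = {{s} | s \<in> b} *)
definition is_singletons :: "nat \<Rightarrow> nat \<Rightarrow> fm" where
  "is_singletons y b = Forall (0 \<^bold>\<in> y + 1 \<^bold>\<longleftrightarrow> BExists (b + 1) (is_upair 1 0 0))"

(* r = ({a, b}, {c}) and c \<subseteq> a \<union> b *)
definition is_union_rule :: "nat \<Rightarrow> nat \<Rightarrow> nat \<Rightarrow> nat \<Rightarrow> fm" where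
  "is_union_rule r a b c = BForall c (0 \<^bold>\<in> a + 1 \<^bold>\<or> 0 \<^bold>\<in> b + 1) \<^bold>\<and>
    Exists (Exists (is_upair 1 (a + 2) (b + 2) \<^bold>\<and> is_upair 0 (c + 2) (c + 2) \<^bold>\<and> is_pair (r + 2) 1 0))"

(* r = ({a}, {{s} | s \<in> b}) for q = (a, b) with a \<in> F *)
definition is_lifted_rule :: "nat \<Rightarrow> nat \<Rightarrow> nat \<Rightarrow> fm" where
  "is_lifted_rule r q F = Exists (Exists (Exists (Exists (3 \<^bold>\<in> F + 4 \<^bold>\<and> is_pair (q + 4) 3 2 \<^bold>\<and>
    is_upair 1 3 3 \<^bold>\<and> is_singletons 0 2 \<^bold>\<and> is_pair (r + 4) 1 0))))"

(* y is the set of all s in S with {s} \<in> x, and it is inhabited *)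
definition is_trace :: "nat \<Rightarrow> nat \<Rightarrow> nat \<Rightarrow> fm" where
  "is_trace y x S = BExists x (BExists (S + 1) (is_upair 1 0 0)) \<^bold>\<and>
    Forall (0 \<^bold>\<in> y + 1 \<^bold>\<longleftrightarrow> 0 \<^bold>\<in> S + 1 \<^bold>\<and> BExists (x + 1) (is_upair 0 1 1))"

context kripke
begin

definition singletons :: "'w \<Rightarrow> 'd \<Rightarrow> 'd \<Rightarrow> bool" where
  "singletons w y b \<longleftrightarrow> (\<forall>v t. w \<sqsubseteq> v \<longrightarrow> mem v t y \<longleftrightarrow> (\<exists>s. mem v s b \<and> upair v t s s))"

definition union_rule :: "'w \<Rightarrow> 'd \<Rightarrow> 'd \<Rightarrow> 'd \<Rightarrow> 'd \<Rightarrow> bool" where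
  "union_rule w r a b c \<longleftrightarrow> (\<forall>v t. w \<sqsubseteq> v \<longrightarrow> mem v t c \<longrightarrow> mem v t a \<or> mem v t b) \<and>
    (\<exists>x y. upair w x a b \<and> upair w y c c \<and> opair w r x y)"

definition lifted_rule :: "'w \<Rightarrow> 'd \<Rightarrow> 'd \<Rightarrow> 'd \<Rightarrow> bool" where
  "lifted_rule w r q F \<longleftrightarrow> (\<exists>a b x y. mem w a F \<and> opair w q a b \<and> upair w x a a \<and>
    E w y \<and> singletons w y b \<and> opair w r x y)"

definition trace :: "'w \<Rightarrow> 'd \<Rightarrow> 'd \<Rightarrow> 'd \<Rightarrow> bool" where
  "trace w y x S \<longleftrightarrow> (\<exists>t. mem w t x \<and> (\<exists>s. mem w s S \<and> upair w t s s)) \<and>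
    (\<forall>v s. w \<sqsubseteq> v \<longrightarrow> mem v s y \<longleftrightarrow> mem v s S \<and> (\<exists>t. mem v t x \<and> upair v t s s))"

lemma force_is_singletons [simp]: "force (is_singletons y b) w e \<longleftrightarrow> singletons w (e y) (e b)"
  unfolding is_singletons_def force.simps(7) force_Iff E_flatten singletons_def
  by simp (meson mem_E upair_E)

lemma force_is_union_rule [simp]:
  "force (is_union_rule r a b c) w e \<longleftrightarrow> union_rule w (e r) (e a) (e b) (e c)"
  by (simp add: is_union_rule_def union_rule_def) (meson upair_E)

lemma force_is_lifted_rule [simp]:
  "force (is_lifted_rule r q F) w e \<longleftrightarrow> lifted_rule w (e r) (e q) (e F)"
  by (simp add: is_lifted_rule_def lifted_rule_def) (meson opair_E upair_E)

lemma force_is_trace [simp]: "force (is_trace y x S) w e \<longleftrightarrow> trace w (e y) (e x) (e S)"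
proof -
  have "force (Forall (0 \<^bold>\<in> y + 1 \<^bold>\<longleftrightarrow> 0 \<^bold>\<in> S + 1 \<^bold>\<and> BExists (x + 1) (is_upair 0 1 1))) w e \<longleftrightarrow>
    (\<forall>v s. w \<sqsubseteq> v \<longrightarrow> mem v s (e y) \<longleftrightarrow> mem v s (e S) \<and> (\<exists>t. mem v t (e x) \<and> upair v t s s))"
    unfolding force.simps(7) force_Iff E_flatten by simp (meson mem_E)
  then show ?thesis unfolding is_trace_def trace_def force.simps(4) by simp
qed

end

context ECST_model
begin

lemma singletons_ex:
  assumes "E w b"
  obtains y where "E w y" "singletons w y b"
proof -
  have "ISet v (\<lambda>u t. upair u t s s)" if "w \<sqsubseteq> v" "mem v s b" for v s
  proof -
    have "E v s" using that mem_E by blast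
    then obtain t where "upair v t s s" using upair_ex by blast
    then show ?thesis using upair_iff_eq upair_E by (intro ISet_unique[of v t]) blast+
  qed
  then have "ISet w (\<lambda>v t. \<exists>s. mem v s b \<and> upair v t s s)"
    using ISet_UN[OF assms, of "\<lambda>_. b" "is_upair 0 1 1"] assms by simp
  then obtain y where "E w y" "\<And>v t. w \<sqsubseteq> v \<Longrightarrow> mem v t y \<longleftrightarrow> (\<exists>s. mem v s b \<and> upair v t s s)"
    by (rule ISetE) blast
  then show thesis using that unfolding singletons_def by blast
qed

lemma ISet_rule:
  assumes "E w a" "E w b" "E w d"
  shows "ISet w (\<lambda>v r. \<exists>x y. upair v x a b \<and> (E v y \<and> singletons v y d) \<and> opair v r x y)"
proof -
  obtain x where x: "upair w x a b" using upair_ex assms by blast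
  obtain y where y: "E w y" "singletons w y d" using singletons_ex assms by blast
  have *: "E v y' \<and> singletons v y' d \<longleftrightarrow> eq v y' y" if v: "w \<sqsubseteq> v" for v y'
  proof
    assume y': "E v y' \<and> singletons v y' d"
    have "mem u z y' \<longleftrightarrow> mem u z y" if "v \<sqsubseteq> u" for u z
      using y' y(2) that le_trans[OF v that] unfolding singletons_def by simp
    then show "eq v y' y" using y' E_mono[OF y(1) v] by (intro extI) auto
  next
    assume eq: "eq v y' y"
    have "mem u z y' \<longleftrightarrow> (\<exists>s. mem u s d \<and> upair u z s s)" if "v \<sqsubseteq> u" for u z
      using mem_eq_right[OF eq_mono[OF eq that]] y(2) le_trans[OF v that]
      unfolding singletons_def by simp
    then show "E v y' \<and> singletons v y' d" using eq eq_E unfolding singletons_def by blast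
  qed
  have "E w x" using upair_E[OF x] by blast
  show ?thesis by (rule ISet_pair_unique[OF \<open>E w x\<close> y(1) upair_iff_eq[OF x] *])
qed

lemma ISet_union_rule:
  assumes "E w a" "E w b" "E w c"
  shows "ISet w (\<lambda>v r. union_rule v r a b c)"
proof -
  obtain x where x: "upair w x a b" using upair_ex assms by blast
  obtain y where y: "upair w y c c" using upair_ex assms by blast
  have "E w x" "E w y" using x y upair_E by blast+
  then have 1: "ISet w (\<lambda>v r. \<exists>x y. upair v x a b \<and> upair v y c c \<and> opair v r x y)"
    using ISet_pair_unique[OF _ _ upair_iff_eq[OF x] upair_iff_eq[OF y]] by blast
  \<comment> \<open>Whether \<open>c\<close> is covered by \<open>a\<close> and \<open>b\<close> is
    not decidable, so separation cuts the class out of the singleton of the only candidate.\<close>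
  have "restricted (BForall 3 (0 \<^bold>\<in> 2 \<^bold>\<or> 0 \<^bold>\<in> 3))" by (intro restricted.intros)
  then have "ISet w (\<lambda>v r. (\<exists>x y. upair v x a b \<and> upair v y c c \<and> opair v r x y) \<and>
      force (BForall 3 (0 \<^bold>\<in> 2 \<^bold>\<or> 0 \<^bold>\<in> 3)) v (r \<cdot> a \<cdot> b \<cdot> (\<lambda>_. c)))"
    using assms by (intro ISet_sep 1) (auto split: nat.split)
  then show ?thesis by (rule ISet_cong) (auto simp: union_rule_def)
qed

lemma ISet_union_rules:
  assumes "E w F"
  shows "ISet w (\<lambda>v r. \<exists>a. mem v a F \<and> (\<exists>b. mem v b F \<and> (\<exists>c. mem v c F \<and> union_rule v r a b c)))"
proof -
  have 1: "ISet v (\<lambda>v r. \<exists>c. mem v c F \<and> union_rule v r a b c)"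
    if "w \<sqsubseteq> v" "E v a" "E v b" for v a b
  proof -
    have "E v F" using that assms E_mono by blast
    have "ISet u (\<lambda>v r. union_rule v r a b c)" if "v \<sqsubseteq> u" "mem u c F" for u c
      using that \<open>E v a\<close> \<open>E v b\<close> mem_E E_mono by (intro ISet_union_rule) blast+
    then show ?thesis
      using ISet_UN[OF \<open>E v F\<close>, of "a \<cdot> (\<lambda>_. b)" "is_union_rule 0 2 3 1"] that
      by (simp split: nat.split)
  qed
  have 2: "ISet v (\<lambda>v r. \<exists>b. mem v b F \<and> (\<exists>c. mem v c F \<and> union_rule v r a b c))"
    if v: "w \<sqsubseteq> v" "mem v a F" for v a
  proof -
    have E: "E v a" "E v F" using v mem_E by blast+
    have "ISet u (\<lambda>v r. \<exists>c. mem v c F \<and> union_rule v r a b c)" if "v \<sqsubseteq> u" "mem u b F" for u b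
      using that v E mem_E E_mono le_trans by (intro 1) blast+
    then show ?thesis
      using ISet_UN[OF \<open>E v F\<close>, of "a \<cdot> (\<lambda>_. F)" "BExists 3 (is_union_rule 1 3 2 0)"] E
      by (simp split: nat.split)
  qed
  show ?thesis
    using ISet_UN[OF \<open>E w F\<close>, of "\<lambda>_. F" "BExists 2 (BExists 3 (is_union_rule 2 3 1 0))"] assms 2
    by simp
qed

text \<open>The components of \<open>q\<close> are unique, so there is one candidate; the undecided
  condition that its premise lies in \<open>F\<close> is imposed by separation.\<close>

lemma ISet_lifted_rule:
  assumes q: "opair w q a b" and F: "E w F"
  shows "ISet w (\<lambda>v r. lifted_rule v r q F)"
proof -
  have "E w a" "E w b" using q opair_E by blast+
  have "restricted (1 \<^bold>\<in> 2)" by (rule restricted.intros)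
  then have "ISet w (\<lambda>v r. (\<exists>x y. upair v x a a \<and> (E v y \<and> singletons v y b) \<and> opair v r x y) \<and>
      force (1 \<^bold>\<in> 2) v (r \<cdot> a \<cdot> (\<lambda>_. F)))"
    using \<open>E w a\<close> \<open>E w b\<close> F by (intro ISet_sep ISet_rule) (auto split: nat.split)
  then show ?thesis
  proof (rule ISet_cong)
    fix v r assume v: "w \<sqsubseteq> v"
    have qv: "opair v q a b" using opair_mono[OF q v] .
    show "(\<exists>x y. upair v x a a \<and> (E v y \<and> singletons v y b) \<and> opair v r x y) \<and>
      force (1 \<^bold>\<in> 2) v (r \<cdot> a \<cdot> (\<lambda>_. F)) \<longleftrightarrow> lifted_rule v r q F"
    proof
      assume "lifted_rule v r q F"
      then obtain a' b' x y where *: "mem v a' F" "opair v q a' b'" "upair v x a' a'" "E v y"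
        "singletons v y b'" "opair v r x y"
        unfolding lifted_rule_def by blast
      have eq: "eq v a' a" "eq v b' b" using opair_inj[OF *(2) qv] by blast+
      have "upair v x a a" using *(3) eq(1) upair_cong upair_E eq_refl by blast
      moreover have "mem v a F" using *(1) mem_eq_left[OF eq(1)] by blast
      moreover have "singletons v y b"
        using *(5) mem_eq_right[OF eq_mono[OF eq(2)]] unfolding singletons_def by simp
      ultimately show "(\<exists>x y. upair v x a a \<and> (E v y \<and> singletons v y b) \<and> opair v r x y) \<and>
        force (1 \<^bold>\<in> 2) v (r \<cdot> a \<cdot> (\<lambda>_. F))" using *(4,6) by auto
    qed (use qv in \<open>auto simp: lifted_rule_def\<close>)
  qed
qed

lemma ISet_lifted_rules:
  assumes R: "E w R" "rules P w R S" and F: "E w F"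
  shows "ISet w (\<lambda>v r. \<exists>q. mem v q R \<and> lifted_rule v r q F)"
proof -
  have "ISet v (\<lambda>v r. lifted_rule v r q F)" if "w \<sqsubseteq> v" "mem v q R" for v q
    using that R(2) E_mono[OF F that(1)] ISet_lifted_rule unfolding rules_def by blast
  then show ?thesis using ISet_UN[OF R(1), of "\<lambda>_. F" "is_lifted_rule 0 1 2"] F by simp
qed

lemma trace_ex:
  assumes "E w x" "E w S" "mem w t x" "mem w s S" "upair w t s s"
  obtains y where "E w y" "trace w y x S"
proof -
  have "restricted (BExists 1 (is_upair 0 1 1))"
    unfolding is_upair_def by (intro restricted.intros)
  then have "ISet w (\<lambda>v s. mem v s S \<and> force (BExists 1 (is_upair 0 1 1)) v (s \<cdot> (\<lambda>_. x)))"
    using assms by (intro ISet_sep ISet_mem) auto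
  then obtain y where "E w y"
    "\<And>v s. w \<sqsubseteq> v \<Longrightarrow> mem v s y \<longleftrightarrow> mem v s S \<and> (\<exists>t. mem v t x \<and> upair v t s s)"
    by (rule ISetE) auto
  then show thesis using that assms(3-5) unfolding trace_def by blast
qed

lemma ISet_trace:
  assumes "E w x" "E w S"
  shows "ISet w (\<lambda>v y. E v y \<and> trace v y x S)"
proof -
  have "restricted (BExists 1 (is_upair 0 1 1))" "restricted (BExists 1 (BExists 3 (is_upair 1 0 0)))"
    unfolding is_upair_def by (intro restricted.intros)+
  then have "ISet w (\<lambda>v s. mem v s S \<and> force (BExists 1 (is_upair 0 1 1)) v (s \<cdot> (\<lambda>_. x)))"
    using assms by (intro ISet_sep ISet_mem) auto
  then obtain y where y: "E w y"
    "\<And>v s. w \<sqsubseteq> v \<Longrightarrow> mem v s y \<longleftrightarrow> mem v s S \<and> (\<exists>t. mem v t x \<and> upair v t s s)"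
    by (rule ISetE) auto
  have 1: "ISet w (\<lambda>v z. E v z \<and> (\<forall>u s. v \<sqsubseteq> u \<longrightarrow> mem u s z \<longleftrightarrow> mem u s S \<and> (\<exists>t. mem u t x \<and> upair u t s s)))"
    using ISet_the[OF y] .
  \<comment> \<open>The trace as a set always exists. Separation then retains it under the condition
    that \<open>x\<close> contains a singleton, so the class has at most one element but need not be
    inhabited.\<close>
  have "ISet w (\<lambda>v z. (E v z \<and> (\<forall>u s. v \<sqsubseteq> u \<longrightarrow> mem u s z \<longleftrightarrow> mem u s S \<and> (\<exists>t. mem u t x \<and> upair u t s s)))
      \<and> force (BExists 1 (BExists 3 (is_upair 1 0 0))) v (z \<cdot> x \<cdot> (\<lambda>_. S)))"
    by (rule ISet_sep[OF 1]) (fact, simp add: assms split: nat.split)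
  then show ?thesis by (rule ISet_cong) (auto simp: trace_def)
qed

lemma ISet_traces:
  assumes "E w G" "E w S"
  shows "ISet w (\<lambda>v y. \<exists>x. mem v x G \<and> E v y \<and> trace v y x S)"
proof -
  have "ISet v (\<lambda>v y. E v y \<and> trace v y x S)" if "w \<sqsubseteq> v" "mem v x G" for v x
    using that assms mem_E E_mono by (intro ISet_trace) blast+
  then show ?thesis
    using ISet_UN[OF \<open>E w G\<close>, of "\<lambda>_. S" "0 \<^bold>= 0 \<^bold>\<and> is_trace 0 1 2"] assms
    by (simp add: eq_refl_iff)
qed

section \<open>Reduction of finitary rules to n-ary rules\<close>

lemma nid_mono: "nid P v \<Longrightarrow> v \<sqsubseteq> w \<Longrightarrow> nid P w"
  unfolding nid_def using le_trans by blast

lemma trace_mono: "trace v y x S \<Longrightarrow> v \<sqsubseteq> w \<Longrightarrow> trace w y x S"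
  unfolding trace_def by (meson le_trans mem_mono upair_mono)

lemma closedD: "closed w x R \<Longrightarrow> mem w r R \<Longrightarrow> opair w r a b \<Longrightarrow> sub w a x \<Longrightarrow> meet w b x"
  unfolding closed_def using le_refl by blast

lemma sub_upair:
  assumes "upair w a x y" "mem w x z" "mem w y z"
  shows "sub w a z"
  unfolding sub_def
proof (intro allI impI)
  fix v t assume v: "w \<sqsubseteq> v" "mem v t a"
  then have "eq v t x \<or> eq v t y" using upair_mem[OF assms(1)] by blast
  then show "mem v t z" using mem_eq_left mem_mono[OF _ v(1)] assms(2,3) by blast
qed

lemma sub_singletons:
  assumes "singletons w y b" "\<And>v s t. w \<sqsubseteq> v \<Longrightarrow> mem v s b \<Longrightarrow> upair v t s s \<Longrightarrow> mem v t z"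
  shows "sub w y z"
  using assms unfolding sub_def singletons_def by blast

lemma emp_surj:
  assumes "surj w f m a" "emp w m"
  shows "emp w a"
  using assms surj_onto unfolding emp_def by blast

lemma image_surj:
  assumes "surj w f m a" "sub w a S" "image w y f m S" "E w y" "E w a"
  shows "eq w y a"
proof (rule extI[OF assms(4,5)])
  fix v s assume v: "w \<sqsubseteq> v"
  show "mem v s y \<longleftrightarrow> mem v s a"
    using surj_maps(2)[OF assms(1) v] surj_onto[OF assms(1) v] assms(2,3) v
    unfolding image_def sub_def by blast
qed

lemma nid_finenum:
  assumes N: "om w N" and n: "mem w n N" "ge2 w n" and nid: "nid (\<lambda>v. enum v n) w"
    and S: "E w S" and R: "E w R" "rules finenum w R S"
  shows "setgen w S R"
proof -
  obtain F where F: "E w F" and F_sub: "\<And>v y. w \<sqsubseteq> v \<Longrightarrow> mem v y F \<Longrightarrow> sub v y S"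
    and F_emp: "\<And>v x y. w \<sqsubseteq> v \<Longrightarrow> mem v x S \<Longrightarrow> E v y \<Longrightarrow> emp v y \<Longrightarrow> mem v y F"
    and F_single: "\<And>v x y. w \<sqsubseteq> v \<Longrightarrow> mem v x S \<Longrightarrow> upair v y x x \<Longrightarrow> mem v y F"
    and F_image: "\<And>v m m' f a k y. w \<sqsubseteq> v \<Longrightarrow> mem v m N \<Longrightarrow> succ v m' m \<Longrightarrow> E v f \<Longrightarrow>
      surj v f m' a \<Longrightarrow> sub v a S \<Longrightarrow> mem v k N \<Longrightarrow> E v y \<Longrightarrow> image v y f k S \<Longrightarrow> mem v y F"
    using finite_subsets[OF N n nid S] by blast
  obtain R' where R': "E w R'" and R'_iff: "\<And>v r. w \<sqsubseteq> v \<Longrightarrow> mem v r R' \<longleftrightarrow>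
      (\<exists>a. mem v a F \<and> (\<exists>b. mem v b F \<and> (\<exists>c. mem v c F \<and> union_rule v r a b c))) \<or>
      (\<exists>q. mem v q R \<and> lifted_rule v r q F)"
    using ISet_disj[OF ISet_union_rules[OF F] ISet_lifted_rules[OF R F]] by (rule ISetE) blast
  have R_sub: "sub v b S" if v: "w \<sqsubseteq> v" and q: "mem v q R" "opair v q a b" for v q a b
  proof -
    obtain a' b' where "opair v q a' b'" "sub v b' S" using R(2) v q(1) unfolding rules_def by blast
    moreover from this have "eq v b' b" using opair_inj q(2) by blast
    ultimately show ?thesis using sub_cong mem_E eq_refl E_mono[OF S v] by blast
  qed
  have "rules (\<lambda>v. enum v n) w R' F"
    unfolding rules_def
  proof (intro allI impI)
    fix v r assume v: "w \<sqsubseteq> v" and r: "mem v r R'"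
    have enum: "enum v n x" if "upair v x a b" for x a b
      using enum_upair[OF om_mono[OF N v] mem_mono[OF n(1) v] ge2_mono[OF n(2) v] that] .
    from r[unfolded R'_iff[OF v]]
    show "\<exists>x y. opair v r x y \<and> sub v x F \<and> sub v y F \<and> enum v n x"
    proof
      assume "\<exists>a. mem v a F \<and> (\<exists>b. mem v b F \<and> (\<exists>c. mem v c F \<and> union_rule v r a b c))"
      then obtain a b c x y where *: "mem v a F" "mem v b F" "mem v c F"
        "upair v x a b" "upair v y c c" "opair v r x y"
        unfolding union_rule_def by blast
      then show ?thesis using sub_upair enum by blast
    next
      assume "\<exists>q. mem v q R \<and> lifted_rule v r q F"
      then obtain q a b x y where *: "mem v q R" "mem v a F" "opair v q a b" "upair v x a a"
        "singletons v y b" "opair v r x y"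
        unfolding lifted_rule_def by blast
      have "sub v b S" using R_sub[OF v *(1,3)] .
      then have "mem u t F" if "v \<sqsubseteq> u" "mem u s b" "upair u t s s" for u s t
        using F_single[OF le_trans[OF v that(1)] _ that(3)] that(1,2) unfolding sub_def by blast
      then have "sub v y F" using sub_singletons[OF *(5)] by blast
      then show ?thesis using * sub_upair enum by blast
    qed
  qed
  then obtain G where G: "E w G" and G_csub: "\<And>v x. w \<sqsubseteq> v \<Longrightarrow> mem v x G \<Longrightarrow> csub v x F R'"
    and G_gen: "\<And>v x s. w \<sqsubseteq> v \<Longrightarrow> E v x \<Longrightarrow> csub v x F R' \<Longrightarrow> mem v s x \<Longrightarrow>
      \<exists>y. mem v y G \<and> mem v s y \<and> sub v y x"
    using nid F R' le_refl unfolding nid_def setgen_def by blast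
  \<comment> \<open>The conclusion \<open>c\<close> may be any member of \<open>F\<close> covered by
    \<open>a\<close> and \<open>b\<close>. Thus \<open>F\<close> need not contain their union, and a
    = b with empty \<open>c\<close> is a legitimate instance.\<close>
  have union: "mem v c x"
    if v: "w \<sqsubseteq> v" and x: "csub v x F R'" and m: "mem v a x" "mem v b x" "mem v c F"
      and c: "\<And>u t. v \<sqsubseteq> u \<Longrightarrow> mem u t c \<Longrightarrow> mem u t a \<or> mem u t b" for v x a b c
  proof -
    have ab: "mem v a F" "mem v b F" using x m le_refl unfolding csub_def sub_def by blast+
    have "E v a" "E v b" "E v c" using m mem_E by blast+
    then obtain p q where p: "upair v p a b" and q: "upair v q c c" using upair_ex by metis
    then have "E v p" "E v q" using upair_E by blast+
    then obtain r where r: "opair v r p q" by (rule opair_ex)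
    have "union_rule v r a b c" unfolding union_rule_def using c p q r by blast
    then have "mem v r R'" using R'_iff[OF v] ab m(3) by blast
    then have "meet v q x" using closedD r sub_upair[OF p m(1,2)] x unfolding csub_def by blast
    then obtain t where "mem v t q" "mem v t x" unfolding meet_def by blast
    then show ?thesis using upair_mem[OF q le_refl] mem_eq_left by blast
  qed
  have premise: "mem v a x"
    if v: "w \<sqsubseteq> v" and x: "csub v x F R'" and y: "trace v y x S" and a: "sub v a y" "E v a" "finenum v a"
    for v x y a
  proof -
    obtain t0 s0 where t0: "mem v t0 x" "mem v s0 S" using y unfolding trace_def by blast
    have aS: "sub v a S" using a(1) y unfolding sub_def trace_def by blast
    \<comment> \<open>The inhabitant of the trace provides both the member \<open>t0\<close> of
      \<open>x\<close> to start from and the element of \<open>S\<close> that \<open>F_emp\<close>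
      asks for.\<close>
    have emp: "mem v z x" if "E v z" "emp v z" for z
      using union[OF v x t0(1) t0(1) F_emp[OF v t0(2) that]] that(2) unfolding emp_def by blast
    obtain M m f where M: "om v M" "mem v m M" "E v f" "surj v f m a"
      using a(3) unfolding finenum_def enum_def by blast
    have Nv: "om v N" using om_mono[OF N v] .
    have m: "mem v m N" using om_unique[OF Nv M(1,2)] .
    from Nv m show ?thesis
    proof (rule om_cases)
      \<comment> \<open>A premise enumerated by 0 is treated apart, since \<open>F_image\<close>
        requires a successor as length.\<close>
      assume "emp v m"
      then show ?thesis using emp[OF a(2) emp_surj[OF M(4)]] by blast
    next
      fix m1 assume m1: "mem v m1 N" "succ v m m1"
      \<comment> \<open>The image of \<open>k\<close> under \<open>f\<close> is an element of
        \<open>x\<close>. The witness is bounded by \<open>x\<close>, and \<open>is_image\<close> is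
        written with bounded quantifiers only, so \<open>om_induct\<close> accepts the formula. The
        guard confines it to k below or equal to m, as the induction runs through all of
        \<omega>.\<close>
      let ?\<phi> = "is_subset 0 1 \<^bold>\<longrightarrow> BExists 2 (is_image 0 4 1 5)"
      let ?e = "m \<cdot> x \<cdot> f \<cdot> (\<lambda>_. S)"
      have \<phi>: "force ?\<phi> u (k \<cdot> ?e) \<longleftrightarrow>
        (\<forall>u'. u \<sqsubseteq> u' \<longrightarrow> sub u' k m \<longrightarrow> (\<exists>z. mem u' z x \<and> image u' z f k S))" for u k
        by simp
      have "restricted ?\<phi>"
        unfolding is_subset_def is_image_def maps_to_def is_pair_def is_upair_def
        by (intro restricted.intros)
      then have "force ?\<phi> v (m \<cdot> ?e)"
      proof (rule om_induct[OF Nv])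
        have "E v m" "E v x" "E v f" "E v S" using m t0 M(3) mem_E by blast+
        then show "E v (?e i)" for i by (simp split: nat.split)
        show "mem v m N" by fact
      next
        fix u z assume u: "v \<sqsubseteq> u" "mem u z N" "emp u z"
        have "mem u z x" if "E u z" "emp u z"
          using union[OF le_trans[OF v u(1)] csub_mono[OF x u(1)] mem_mono[OF t0(1) u(1)]
            mem_mono[OF t0(1) u(1)] F_emp[OF le_trans[OF v u(1)] mem_mono[OF t0(2) u(1)] that]]
            that(2) unfolding emp_def by blast
        \<comment> \<open>The number zero is the empty set, so \<open>z\<close> is its own image
          under \<open>f\<close>.\<close>
        then have "mem u z x" using u mem_E by blast
        then have "mem u' z x \<and> image u' z f z S" if "u \<sqsubseteq> u'" for u'
          using that u(3) mem_mono emp_mono[OF u(3) that] unfolding image_def emp_def by blast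
        then show "force ?\<phi> u (z \<cdot> ?e)" unfolding \<phi> by blast
      next
        fix u i j assume u: "v \<sqsubseteq> u" and ij: "mem u i N" "mem u j N" "succ u j i"
          and IH: "force ?\<phi> u (i \<cdot> ?e)"
        have "\<exists>z. mem u' z x \<and> image u' z f j S" if u': "u \<sqsubseteq> u'" and j: "sub u' j m" for u'
        proof -
          have vu: "v \<sqsubseteq> u'" using u u' le_trans by blast
          then have wu: "w \<sqsubseteq> u'" using v le_trans by blast
          have s: "succ u' j i" using succ_mono[OF ij(3) u'] .
          then have "sub u' i m" using j unfolding succ_def sub_def by blast
          then obtain z where z: "mem u' z x" "image u' z f i S" using IH u' unfolding \<phi> by blast
          have "mem u' i m" using s j le_refl unfolding succ_def sub_def by blast
          then obtain t where t: "maps u' f i t" using surj_total[OF M(4) vu] by blast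
          have "mem u' t a" using surj_maps(2)[OF M(4) vu t] .
          then have "mem u' t y" using a(1) vu unfolding sub_def by blast
          then obtain p where p: "mem u' p x" "upair u' p t t" using y vu unfolding trace_def by blast
          have "E u' f" "E u' j" "E u' S" using E_mono[OF M(3) vu] ij(2) mem_mono u' mem_E E_mono[OF S wu] by blast+
          then obtain z' where z': "E u' z'" "image u' z' f j S" by (rule image_ex)
          \<comment> \<open>The next stage \<open>z'\<close> is covered by \<open>z\<close> and the
            singleton \<open>p\<close> of f(i), and \<open>p\<close> is in \<open>x\<close> because
            f(i) belongs to the trace. It remains to see that \<open>z'\<close> is in
            \<open>F\<close>.\<close>
          have "mem u' z' F"
            using F_image[OF wu mem_mono[OF m1(1) vu] succ_mono[OF m1(2) vu] \<open>E u' f\<close>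
              surj_mono[OF M(4) vu] sub_mono[OF aS vu] mem_mono[OF ij(2) u'] z'] .
          moreover have "mem u'' q z \<or> mem u'' q p" if u'': "u' \<sqsubseteq> u''" "mem u'' q z'" for u'' q
          proof -
            obtain l where l: "mem u'' q S" "mem u'' l j" "maps u'' f l q"
              using z'(2) u'' unfolding image_def by blast
            have "mem u'' l i \<or> eq u'' l i" using succ_mem[OF s u''(1)] l(2) by blast
            then show ?thesis
            proof
              assume "mem u'' l i"
              then show ?thesis using z(2) u''(1) l unfolding image_def by blast
            next
              assume "eq u'' l i"
              then have "maps u'' f i q" using maps_cong[OF l(3)] maps_E[OF l(3)] eq_refl by blast
              then have "eq u'' q t"
                using surj_unique[OF M(4) le_trans[OF vu u''(1)]] maps_mono[OF t u''(1)] by blast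
              then show ?thesis using upair_mem[OF p(2) u''(1)] by blast
            qed
          qed
          ultimately have "mem u' z' x"
            using union[OF wu csub_mono[OF x vu] z(1) p(1)] by blast
          then show ?thesis using z'(2) by blast
        qed
        then show "force ?\<phi> u (j \<cdot> ?e)" unfolding \<phi> by blast
      qed
      moreover have "sub v m m" unfolding sub_def by blast
      ultimately obtain z where z: "mem v z x" "image v z f m S" unfolding \<phi> using le_refl by blast
      then have "eq v z a" using image_surj[OF M(4) aS z(2)] mem_E a(2) by blast
      then show ?thesis using z(1) mem_eq_left by blast
    qed
  qed
  \<comment> \<open>Members of \<open>G\<close> that contain no singleton contribute nothing, so
    every element of \<open>H\<close> is the trace of a set to which \<open>premise\<close>
    applies.\<close>
  obtain H where H: "E w H"
    and H_iff: "\<And>v y. w \<sqsubseteq> v \<Longrightarrow> mem v y H \<longleftrightarrow> (\<exists>x. mem v x G \<and> E v y \<and> trace v y x S)"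
    using ISet_traces[OF G S] by (rule ISetE) blast
  have "csub v y S R" if v: "w \<sqsubseteq> v" and y: "mem v y H" for v y
  proof -
    obtain x where x: "mem v x G" "E v y" "trace v y x S" using y H_iff[OF v] by blast
    have xc: "csub v x F R'" using G_csub[OF v x(1)] .
    have "closed v y R"
      unfolding closed_def
    proof (intro allI impI)
      fix u q a b assume u: "v \<sqsubseteq> u" and q: "mem u q R" "opair u q a b" "sub u a y"
      have wu: "w \<sqsubseteq> u" using v u le_trans by blast
      have y: "trace u y x S" using trace_mono[OF x(3) u] .
      have xu: "csub u x F R'" using csub_mono[OF xc u] .
      obtain a' b' where ab': "opair u q a' b'" "finenum u a'"
        using R(2) q(1) wu unfolding rules_def by blast
      have eq: "eq u a a'" using opair_inj[OF q(2) ab'(1)] by blast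
      have "sub u a' y" using q(3) mem_eq_right[OF eq_mono[OF eq]] unfolding sub_def by blast
      then have "mem u a' x" using premise[OF wu xu y] ab' opair_E by blast
      then have a: "mem u a x" using mem_eq_left[OF eq] by blast
      \<comment> \<open>Membership in \<open>F\<close>, which the lifted rule demands, comes for
        free once the premise has been collected into \<open>x\<close>.\<close>
      then have aF: "mem u a F" using xu le_refl unfolding csub_def sub_def by blast
      obtain p where p: "upair u p a a" using upair_ex a mem_E by blast
      obtain d where d: "E u d" "singletons u d b" using singletons_ex opair_E[OF q(2)] by blast
      obtain r where r: "opair u r p d" using opair_ex[of u p d] upair_E[OF p] d(1) by blast
      have "lifted_rule u r q F" unfolding lifted_rule_def using aF q(2) p d r by blast
      then have "mem u r R'" using R'_iff[OF wu] q(1) by blast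
      then have "meet u d x" using closedD r sub_upair[OF p a a] xu unfolding csub_def by blast
      then obtain t s where t: "mem u t x" "mem u s b" "upair u t s s"
        using d(2) le_refl unfolding meet_def singletons_def by blast
      moreover have "mem u s S" using R_sub[OF wu q(1,2)] t(2) le_refl unfolding sub_def by blast
      ultimately have "mem u s y" using y le_refl unfolding trace_def by blast
      then show "meet u b y" using t(2) unfolding meet_def by blast
    qed
    moreover have "sub v y S" using x(3) unfolding trace_def sub_def by blast
    ultimately show ?thesis unfolding csub_def by blast
  qed
  moreover have "\<exists>y. mem v y H \<and> mem v s y \<and> sub v y x"
    if v: "w \<sqsubseteq> v" and x: "E v x" "csub v x S R" and s: "mem v s x" for v x s
  proof -
    have "E v F" using E_mono[OF F v] .
    have xS: "sub v x S" and xR: "closed v x R" using x(2) unfolding csub_def by blast+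
    have "restricted (is_subset 0 1)" unfolding is_subset_def by (intro restricted.intros)
    then have "ISet v (\<lambda>u t. mem u t F \<and> force (is_subset 0 1) u (t \<cdot> (\<lambda>_. x)))"
      using \<open>E v F\<close> x(1) by (intro ISet_sep ISet_mem)
    then obtain z where z: "E v z" and z_iff: "\<And>u t. v \<sqsubseteq> u \<Longrightarrow> mem u t z \<longleftrightarrow> mem u t F \<and> sub u t x"
      by (rule ISetE) simp
    have single: "mem u t z" if u: "v \<sqsubseteq> u" and "mem u s x" "upair u t s s" for u s t
    proof -
      have "mem u s S" using that xS unfolding sub_def by blast
      then show ?thesis
        using z_iff[OF u] F_single[OF le_trans[OF v u]] sub_upair that by blast
    qed
    have "closed v z R'"
      unfolding closed_def
    proof (intro allI impI)
      fix u r p d assume u: "v \<sqsubseteq> u" and r: "mem u r R'" "opair u r p d" "sub u p z"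
      have wu: "w \<sqsubseteq> u" using v u le_trans by blast
      from r(1)[unfolded R'_iff[OF wu]] show "meet u d z"
      proof
        assume "\<exists>a. mem u a F \<and> (\<exists>b. mem u b F \<and> (\<exists>c. mem u c F \<and> union_rule u r a b c))"
        then obtain a b c p' d' where c: "mem u c F"
          "\<And>u' t. u \<sqsubseteq> u' \<Longrightarrow> mem u' t c \<Longrightarrow> mem u' t a \<or> mem u' t b"
          and pd: "upair u p' a b" "upair u d' c c" "opair u r p' d'"
          unfolding union_rule_def by blast
        have eq: "eq u p p'" "eq u d d'" using opair_inj[OF r(2) pd(3)] by blast+
        have "mem u a z" "mem u b z"
          using r(3) mem_eq_right[OF eq(1)] pd(1) le_refl unfolding sub_def upair_def by blast+
        then have "sub u a x" "sub u b x" using z_iff[OF u] by blast+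
        then have "sub u c x" using c(2) unfolding sub_def by blast
        then have "mem u c z" using z_iff[OF u] c(1) by blast
        moreover have "mem u c d" using pd(2) mem_eq_right[OF eq(2)] unfolding upair_def by blast
        ultimately show ?thesis unfolding meet_def by blast
      next
        assume "\<exists>q. mem u q R \<and> lifted_rule u r q F"
        then obtain q a b p' d' where q: "mem u q R" "opair u q a b"
          and pd: "upair u p' a a" "singletons u d' b" "opair u r p' d'"
          unfolding lifted_rule_def by blast
        have eq: "eq u p p'" "eq u d d'" using opair_inj[OF r(2) pd(3)] by blast+
        have "mem u a z"
          using r(3) mem_eq_right[OF eq(1)] pd(1) le_refl unfolding sub_def upair_def by blast
        then have "sub u a x" using z_iff[OF u] by blast
        then have "meet u b x" using closedD[OF closed_mono[OF xR u]] q by blast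
        then obtain s where s: "mem u s b" "mem u s x" unfolding meet_def by blast
        then obtain t where t: "upair u t s s" using upair_ex mem_E by blast
        then have "mem u t d'" using pd(2) s(1) le_refl unfolding singletons_def by blast
        then have "mem u t d" using mem_eq_right[OF eq(2)] by blast
        then show ?thesis using single[OF u s(2) t] unfolding meet_def by blast
      qed
    qed
    moreover have "sub v z F" using z_iff unfolding sub_def by blast
    ultimately have zc: "csub v z F R'" unfolding csub_def by blast
    obtain t where t: "upair v t s s" using upair_ex s mem_E by blast
    have "mem v t z" using single[OF le_refl s t] .
    then obtain g where g: "mem v g G" "mem v t g" "sub v g z" using G_gen[OF v z zc] by blast
    have sS: "mem v s S" using xS s le_refl unfolding sub_def by blast
    have "E v g" "E v S" using g sS mem_E by blast+
    \<comment> \<open>The singleton of \<open>s\<close> in \<open>g\<close> is the inhabitant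
      required for a trace, and it also puts \<open>s\<close> into that trace.\<close>
    then obtain y where y: "E v y" "trace v y g S" using trace_ex g(2) sS t by blast
    have "mem v y H" using H_iff[OF v] g(1) y by blast
    moreover have "mem v s y" using y(2) le_refl sS g(2) t unfolding trace_def by blast
    moreover have "sub v y x"
      unfolding sub_def
    proof (intro allI impI)
      fix u q assume u: "v \<sqsubseteq> u" and "mem u q y"
      then obtain p where p: "mem u p g" "upair u p q q" using y(2) unfolding trace_def by blast
      then have "sub u p x" using g(3) u z_iff[OF u] unfolding sub_def by blast
      then show "mem u q x" using p(2) le_refl unfolding sub_def upair_def by blast
    qed
    ultimately show ?thesis by blast
  qed
  ultimately show ?thesis unfolding setgen_def using H by blast
qed

lemma rules_imp: "rules P w R S \<Longrightarrow> (\<And>v a. w \<sqsubseteq> v \<Longrightarrow> P v a \<Longrightarrow> Q v a) \<Longrightarrow> rules Q w R S"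
  unfolding rules_def by blast

text \<open>In the easy direction \<open>n\<close> itself is the length that witnesses finite
  enumerability. In the other, \<open>nid_finenum\<close> is applied at each later world, all its
  hypotheses being persistent.\<close>

lemma NID_equivalence:
  assumes N: "om w N" and n: "mem w n N" and ge: "force (at_least_two 0) w (n \<cdot> e)"
  shows "nid finenum w \<longleftrightarrow> nid (\<lambda>v. enum v n) w"
proof
  assume nid: "nid finenum w"
  have "finenum v a" if "w \<sqsubseteq> v" "enum v n a" for v a
    using that om_mono[OF N] mem_mono[OF n] mem_E unfolding finenum_def by blast
  then have "rules finenum v R S" if "w \<sqsubseteq> v" "rules (\<lambda>v. enum v n) v R S" for v R S
    using that le_trans rules_imp by blast
  then show "nid (\<lambda>v. enum v n) w" using nid unfolding nid_def by blast
next
  assume nid: "nid (\<lambda>v. enum v n) w"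
  have "ge2 w n" using ge2I assms .
  then show "nid finenum w"
    unfolding nid_def
    using nid_finenum[OF om_mono[OF N] mem_mono[OF n] ge2_mono nid_mono[OF nid]] by blast
qed

lemma force_NID_equivalence:
  "force (Forall (in_omega 0 \<^bold>\<longrightarrow> at_least_two 0 \<^bold>\<longrightarrow> (NID_fin \<^bold>\<longleftrightarrow> NID 0))) w e"
proof -
  have "nid finenum t \<longleftrightarrow> nid (\<lambda>v. enum v n) t"
    if v: "force (in_omega 0) v (n \<cdot> e)" and u: "v \<sqsubseteq> u" "force (at_least_two 0) u (n \<cdot> e)"
      and t: "u \<sqsubseteq> t" for v u t n
  proof -
    \<comment> \<open>The equivalence is to be forced at all later worlds, to which both hypotheses
      persist.\<close>
    have "force (in_omega 0) t (n \<cdot> e)" "force (at_least_two 0) t (n \<cdot> e)"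
      using force_mono v u t le_trans by blast+
    then show ?thesis using NID_equivalence[of t _ n e] by (auto simp: in_omega_def)
  qed
  then have "force (NID_fin \<^bold>\<longleftrightarrow> NID 0) u (n \<cdot> e)"
    if "force (in_omega 0) v (n \<cdot> e)" "v \<sqsubseteq> u" "force (at_least_two 0) u (n \<cdot> e)" for v u n
    using that unfolding force_Iff by simp
  then show ?thesis unfolding force.simps(6,7) by blast
qed

end

theorem proposition20:
  "ECST \<turnstile> Forall (in_omega 0 \<^bold>\<longrightarrow> at_least_two 0 \<^bold>\<longrightarrow> (NID_fin \<^bold>\<longleftrightarrow> NID 0))"
  by (intro completeness canon.force_NID_equivalence)

end
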